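(* Let $N\ge 1$ be an integer, let $\alpha\ge 0$, $A>0$, and let $\rho:\mathbb{R}^N\to\mathbb{R}$ be a radial continuous function with $\rho(x)\ge A(1+|x|^2)^{\alpha/2}$ for all $x\in\mathbb{R}^N$. For $1<p\le\theta$ consider the system $$-\Delta u=\rho(x)v^p,\qquad -\Delta v=\rho(x)u^\theta,\qquad u,v>0\quad\text{in }\mathbb{R}^N, \tag{S}$$ and let $x_0$ be the largest root of the polynomial $$H(x)=x^4-\frac{16p\theta(p+1)(\theta+1)}{(p\theta-1)^2}x^2+\frac{16p\theta(p+1)(\theta+1)(p+\theta+2)}{(p\theta-1)^3}x-\frac{16p\theta(p+1)^2(\theta+1)^2}{(p\theta-1)^4}.$$ Then the following hold. (i) If $\frac43<p\le\theta$ and $N<2+(2+\alpha)x_0$, then (S) has no stable classical solution. In particular, if $N\le 10+4\alpha$, then (S) has no stable classical solution for any $\frac43<p\le\theta$. (ii) If $1<p\le\min(\frac43,\theta)$ and $$N<2+\left[\frac p2+\frac{(2-p)(p\theta-1)}{(\theta+p-2)(\theta+1)}\right](\alpha+2)x_0,$$ then (S) has no bounded stable classical solution. Therefore, if $N\le 6+2\alpha$, the system (S) has no bounded stable classical solution for any $\theta\ge p>1$.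
   Context: A classical solution $(u,v)$ of the system $-\Delta u=\rho v^p$, $-\Delta v=\rho u^\theta$, $u,v>0$ in $\mathbb{R}^N$ is called stable if there exist positive smooth (i.e. of class $C^2$) functions $\xi,\zeta$ on $\mathbb{R}^N$ such that $$-\Delta\xi=p\,\rho(x)v^{p-1}\zeta,\qquad -\Delta\zeta=\theta\,\rho(x)u^{\theta-1}\xi\quad\text{in }\mathbb{R}^N.$$ *)

theory Defs
  imports "HOL-Analysis.Analysis" "HOL-Computational_Algebra.Polynomial"
begin

definition partial_deriv :: "'n::finite \<Rightarrow> (real^'n \<Rightarrow> real) \<Rightarrow> real^'n \<Rightarrow> real" where
  "partial_deriv i f x = frechet_derivative f (at x) (axis i 1)"

definition C1_fun :: "(real^'n::finite \<Rightarrow> real) \<Rightarrow> bool" where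
  "C1_fun f \<longleftrightarrow> (\<forall>x. f differentiable (at x)) \<and> (\<forall>i. continuous_on UNIV (partial_deriv i f))"

definition C2_fun :: "(real^'n::finite \<Rightarrow> real) \<Rightarrow> bool" where
  "C2_fun f \<longleftrightarrow> C1_fun f \<and> (\<forall>i. C1_fun (partial_deriv i f))"

definition laplacian :: "(real^'n::finite \<Rightarrow> real) \<Rightarrow> real^'n \<Rightarrow> real" where
  "laplacian f x = (\<Sum>i\<in>UNIV. partial_deriv i (partial_deriv i f) x)"

definition radial :: "(real^'n::finite \<Rightarrow> real) \<Rightarrow> bool" where
  "radial f \<longleftrightarrow> (\<forall>x y. norm x = norm y \<longrightarrow> f x = f y)"

definition classical_solution ::
  "(real^'n::finite \<Rightarrow> real) \<Rightarrow> real \<Rightarrow> real \<Rightarrow> (real^'n \<Rightarrow> real) \<Rightarrow> (real^'n \<Rightarrow> real) \<Rightarrow> bool" where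
  "classical_solution \<rho> p \<theta> u v \<longleftrightarrow>
     C2_fun u \<and> C2_fun v \<and> (\<forall>x. u x > 0 \<and> v x > 0) \<and>
     (\<forall>x. - laplacian u x = \<rho> x * v x powr p) \<and>
     (\<forall>x. - laplacian v x = \<rho> x * u x powr \<theta>)"

definition stable_classical_solution ::
  "(real^'n::finite \<Rightarrow> real) \<Rightarrow> real \<Rightarrow> real \<Rightarrow> (real^'n \<Rightarrow> real) \<Rightarrow> (real^'n \<Rightarrow> real) \<Rightarrow> bool" where
  "stable_classical_solution \<rho> p \<theta> u v \<longleftrightarrow>
     classical_solution \<rho> p \<theta> u v \<and>
     (\<exists>\<xi> \<zeta>. C2_fun \<xi> \<and> C2_fun \<zeta> \<and> (\<forall>x. \<xi> x > 0 \<and> \<zeta> x > 0) \<and>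
        (\<forall>x. - laplacian \<xi> x = p * \<rho> x * v x powr (p - 1) * \<zeta> x) \<and>
        (\<forall>x. - laplacian \<zeta> x = \<theta> * \<rho> x * u x powr (\<theta> - 1) * \<xi> x))"

definition bounded_pair :: "(real^'n::finite \<Rightarrow> real) \<Rightarrow> (real^'n \<Rightarrow> real) \<Rightarrow> bool" where
  "bounded_pair u v \<longleftrightarrow> bounded (range u) \<and> bounded (range v)"

definition H_poly :: "real \<Rightarrow> real \<Rightarrow> real poly" where
  "H_poly p \<theta> =
     [: - (16 * p * \<theta> * (p + 1)^2 * (\<theta> + 1)^2 / (p * \<theta> - 1)^4),
        16 * p * \<theta> * (p + 1) * (\<theta> + 1) * (p + \<theta> + 2) / (p * \<theta> - 1)^3,
        - (16 * p * \<theta> * (p + 1) * (\<theta> + 1) / (p * \<theta> - 1)^2),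
        0,
        1 :]"

definition x0 :: "real \<Rightarrow> real \<Rightarrow> real" where
  "x0 p \<theta> = Max {x. poly (H_poly p \<theta>) x = 0}"

text \<open>For exponents above 1 the maximum is taken over a finite nonempty set, so
  \<^term>\<open>x0 p \<theta>\<close> is indeed the largest real root.\<close>

lemma x0_largest_root:
  assumes "1 < p" "1 < \<theta>"
  shows "poly (H_poly p \<theta>) (x0 p \<theta>) = 0"
    and "poly (H_poly p \<theta>) x = 0 \<Longrightarrow> x \<le> x0 p \<theta>"
proof -
  let ?R = "{x. poly (H_poly p \<theta>) x = 0}"
  have nz: "H_poly p \<theta> \<noteq> 0" by (simp add: H_poly_def)
  have fin: "finite ?R" using poly_roots_finite[OF nz] .
  have "p * \<theta> > 1" using assms by (simp add: less_1_mult)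
  then have neg: "poly (H_poly p \<theta>) 0 < 0"
    using assms by (simp add: H_poly_def)
  have "lead_coeff (H_poly p \<theta>) > 0" by (simp add: H_poly_def)
  then obtain b where b: "\<forall>x\<ge>b. poly (H_poly p \<theta>) x \<ge> lead_coeff (H_poly p \<theta>)"
    using poly_pinfty_gt_lc by blast
  have "poly (H_poly p \<theta>) (max b 1) > 0"
    using b \<open>lead_coeff (H_poly p \<theta>) > 0\<close> by (meson less_le_trans max.cobounded1)
  then have "?R \<noteq> {}" using poly_IVT_pos[of 0 "max b 1" "H_poly p \<theta>"] neg
    by (auto simp: less_max_iff_disj)
  with fin show "poly (H_poly p \<theta>) (x0 p \<theta>) = 0"
    unfolding x0_def using Max_in by blast
  show "poly (H_poly p \<theta>) x = 0 \<Longrightarrow> x \<le> x0 p \<theta>"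
    unfolding x0_def using fin by simp
qed

end

theory Submission
  imports Defs
begin

text \<open>
  Rescaling maps the system to itself, with a weight that stays bounded below away from the origin, so it is enough to
  bound a stable solution on a fixed ball and to let the scale tend to infinity. Testing the equations with powers of a
  cutoff bounds \<open>\<rho> v\<^sup>p\<close> and \<open>\<rho> u\<^sup>\<theta>\<close> in mean. In particular the averages of \<open>u\<close> and \<open>v\<close> over large balls tend
  to 0, so that suitable subharmonic functions vanish; this gives \<open>u \<le> l v\<^sup>\<sigma>\<close> with \<open>\<sigma> = (p + 1)/(\<theta> + 1)\<close>, and
  \<open>v \<le> K u\<close> if \<open>v\<close> is bounded.

  The stability inequality is tested with \<open>u\<^sup>q \<eta>\<close> and with \<open>v\<^sup>s \<eta>\<close>, where \<open>q = s/\<sigma>\<close>. The two resulting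
  inequalities interpolate each other, and the combination is absorbed exactly when a quartic in \<open>s\<close>, a rescaling of
  the polynomial \<open>H\<close>, is negative. Its negativity set contains an interval that ends at the largest root. There the
  gradient of \<open>v\<^sup>s \<eta>\<close> is controlled by the mean of \<open>v\<^bsup>2s\<^esup>\<close>, and a Sobolev inequality with a small gain moves \<open>s\<close> up to
  the root. The bootstrap starts at \<open>s = p/2\<close> if \<open>p > 4/3\<close>; for smaller \<open>p\<close> it starts at \<open>s = 1\<close>, where
  boundedness supplies the first bound through \<open>v \<le> K u\<close>.
\<close>

subsection \<open>Gradients and Laplacians\<close>

text \<open>The dimension enters through one count of powers. Put E = (2 + \<alpha>)/(p\<theta> -
  1), so that u and v scale with exponents E(p + 1) and E(\<theta> + 1). A fixed positive energy of
  the solution, seen at scale R with exponent s, grows at least like R^(2 + 2sE(\<theta> + 1) - N),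
  whereas the estimates allow at most R^(2s\<tau>) if the starting bound costs R^\<tau>. With x =
  2(\<theta> + 1)s/(p\<theta> - 1) and \<tau> = 0 this is N \<ge> 2 + (2 + \<alpha>)x, and x may
  approach the largest root of H; a positive \<tau> produces the bracket of the bounded case.

  The obstacle is the origin, where the lower bound on the rescaled weight vanishes. In the
  estimates at unit scale the weight is therefore divided out only on annuli, and the energy
  inequality is kept in a form whose right-hand side contains just v^(2s) times the squared gradient
  of a cutoff.

  The threshold 4/3 belongs to the starting exponent. At s = p/2 the mean of v^(2s) is the a priori
  bound, and for p = \<theta> > 1 the quartic is negative there exactly when 16(p - 1)^2 >
  p^2.\<close>

definition has_grad :: "(real^'n::finite \<Rightarrow> real) \<Rightarrow> (real^'n \<Rightarrow> real^'n) \<Rightarrow> bool" where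
  "has_grad f g \<longleftrightarrow> (\<forall>x. (f has_derivative (\<lambda>h. g x \<bullet> h)) (at x)) \<and> continuous_on UNIV g"

definition grad :: "(real^'n::finite \<Rightarrow> real) \<Rightarrow> real^'n \<Rightarrow> real^'n" where
  "grad f x = (\<chi> i. partial_deriv i f x)"

lemma inner_axis1: "(g::real^'n::finite) \<bullet> axis i 1 = g $ i"
  by (simp add: inner_axis)

lemma has_derivative_grad:
  fixes f :: "real^'n::finite \<Rightarrow> real"
  assumes "f differentiable (at x)"
  shows "(f has_derivative (\<lambda>h. grad f x \<bullet> h)) (at x)"
proof -
  let ?D = "frechet_derivative f (at x)"
  have D: "(f has_derivative ?D) (at x)"
    using assms frechet_derivative_works by blast
  then have lin: "linear ?D" by (simp add: has_derivative_linear)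
  have "?D h = grad f x \<bullet> h" for h
  proof -
    have "?D h = ?D (\<Sum>i\<in>UNIV. h $ i *s axis i 1)" by (simp add: basis_expansion)
    also have "\<dots> = (\<Sum>i\<in>UNIV. h $ i * ?D (axis i 1))"
      by (simp add: linear_sum[OF lin] scalar_mult_eq_scaleR linear_cmul[OF lin])
    also have "\<dots> = grad f x \<bullet> h"
      by (simp add: grad_def partial_deriv_def inner_vec_def mult.commute)
    finally show ?thesis .
  qed
  then have "?D = (\<lambda>h. grad f x \<bullet> h)" by auto
  with D show ?thesis by simp
qed

lemma partial_deriv_eq:
  assumes "(f has_derivative (\<lambda>h. g \<bullet> h)) (at x)"
  shows "partial_deriv i f x = g $ i"
proof -
  have "frechet_derivative f (at x) = (\<lambda>h. g \<bullet> h)" using frechet_derivative_at[OF assms] by simp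
  then show ?thesis by (simp add: partial_deriv_def inner_axis1)
qed

lemma has_grad_partial_deriv: "has_grad f g \<Longrightarrow> partial_deriv i f = (\<lambda>x. g x $ i)"
  by (auto simp: has_grad_def intro!: partial_deriv_eq)

lemma has_grad_unique: "has_grad f g \<Longrightarrow> grad f = g"
  by (auto simp: grad_def has_grad_partial_deriv vec_eq_iff)

lemma C1_fun_has_grad: "C1_fun f \<Longrightarrow> has_grad f (grad f)"
  unfolding C1_fun_def has_grad_def
proof (intro conjI allI; elim conjE)
  assume "\<forall>i. continuous_on UNIV (partial_deriv i f)"
  then show "continuous_on UNIV (grad f)"
    by (auto intro!: continuous_on_vec_lambda simp: grad_def[abs_def])
qed (simp add: has_derivative_grad)

lemma has_grad_continuous: "has_grad f g \<Longrightarrow> continuous_on UNIV f"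
  by (meson has_grad_def has_derivative_continuous continuous_at_imp_continuous_on)

lemma has_grad_continuous_grad: "has_grad f g \<Longrightarrow> continuous_on UNIV g"
  by (auto simp: has_grad_def)

lemma has_grad_C1_fun: "has_grad f g \<Longrightarrow> C1_fun f"
  unfolding C1_fun_def
proof (intro conjI allI)
  assume g: "has_grad f g"
  show "f differentiable (at x)" for x using g by (auto simp: has_grad_def differentiable_def)
  show "continuous_on UNIV (partial_deriv i f)" for i
    unfolding has_grad_partial_deriv[OF g]
    by (intro continuous_intros has_grad_continuous_grad[OF g])
qed

lemma has_gradI:
  assumes "\<And>x. (f has_derivative f' x) (at x)" "\<And>x h. f' x h = g x \<bullet> h" "continuous_on UNIV g"
  shows "has_grad f g"
proof -
  have "f' x = (\<lambda>h. g x \<bullet> h)" for x using assms(2) by (simp add: fun_eq_iff)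
  then show ?thesis using assms(1,3) unfolding has_grad_def by metis
qed

lemma has_gradD: "has_grad f g \<Longrightarrow> (f has_derivative (\<lambda>h. g x \<bullet> h)) (at x)"
  by (simp add: has_grad_def)

lemma has_grad_mult:
  assumes "has_grad f f'" "has_grad g g'"
  shows "has_grad (\<lambda>x. f x * g x) (\<lambda>x. f x *\<^sub>R g' x + g x *\<^sub>R f' x)"
proof (rule has_gradI)
  show "((\<lambda>x. f x * g x) has_derivative (\<lambda>h. f x * (g' x \<bullet> h) + f' x \<bullet> h * g x)) (at x)" for x
    by (rule has_derivative_mult[OF assms[THEN has_gradD]])
  show "f x * (g' x \<bullet> h) + f' x \<bullet> h * g x = (f x *\<^sub>R g' x + g x *\<^sub>R f' x) \<bullet> h" for x h
    by (simp add: inner_add_left)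
  show "continuous_on UNIV (\<lambda>x. f x *\<^sub>R g' x + g x *\<^sub>R f' x)"
    by (intro continuous_intros assms[THEN has_grad_continuous] assms[THEN has_grad_continuous_grad])
qed

lemma has_grad_add:
  assumes "has_grad f f'" "has_grad g g'"
  shows "has_grad (\<lambda>x. f x + g x) (\<lambda>x. f' x + g' x)"
proof (rule has_gradI)
  show "((\<lambda>x. f x + g x) has_derivative (\<lambda>h. f' x \<bullet> h + g' x \<bullet> h)) (at x)" for x
    by (rule has_derivative_add[OF assms[THEN has_gradD]])
  show "f' x \<bullet> h + g' x \<bullet> h = (f' x + g' x) \<bullet> h" for x h
    by (simp add: inner_add_left)
  show "continuous_on UNIV (\<lambda>x. f' x + g' x)"
    by (intro continuous_intros assms[THEN has_grad_continuous_grad])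
qed

lemma has_grad_const: "has_grad (\<lambda>x. c) (\<lambda>x. 0)"
  by (rule has_gradI[OF has_derivative_const]) simp_all

lemma has_grad_cmult:
  assumes "has_grad f f'"
  shows "has_grad (\<lambda>x. c * f x) (\<lambda>x. c *\<^sub>R f' x)"
  using has_grad_mult[OF has_grad_const assms, of c] by simp

text \<open>Differentiability of \<open>h\<close> is asked only on a set \<open>S\<close> containing
  the values of \<open>f\<close>, so that real powers can be composed with positive functions
  whatever happens at 0.\<close>

lemma has_grad_compose:
  assumes f: "has_grad f f'" and S: "\<And>x. f x \<in> S"
    and h: "\<And>y. y \<in> S \<Longrightarrow> (h has_real_derivative h' y) (at y)" and h': "continuous_on S h'"
  shows "has_grad (\<lambda>x. h (f x)) (\<lambda>x. h' (f x) *\<^sub>R f' x)"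
  unfolding has_grad_def
proof (intro conjI allI)
  fix x
  have 1: "(f has_derivative (\<lambda>k. f' x \<bullet> k)) (at x)" using f by (simp add: has_grad_def)
  have 2: "(h has_derivative (\<lambda>k. h' (f x) * k)) (at (f x))"
    using h[OF S] by (simp add: has_field_derivative_def)
  show "((\<lambda>x. h (f x)) has_derivative (\<lambda>k. h' (f x) *\<^sub>R f' x \<bullet> k)) (at x)"
    using has_derivative_compose[OF 1 2] by simp
next
  have "continuous_on UNIV (\<lambda>x. h' (f x))"
    by (rule continuous_on_compose2[OF h' has_grad_continuous[OF f]]) (use S in auto)
  then show "continuous_on UNIV (\<lambda>x. h' (f x) *\<^sub>R f' x)"
    using has_grad_continuous_grad[OF f] by (auto intro!: continuous_intros)
qed

lemma has_grad_affine:
  assumes f: "has_grad f f'"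
  shows "has_grad (\<lambda>x. f (c + t *\<^sub>R x)) (\<lambda>x. t *\<^sub>R f' (c + t *\<^sub>R x))"
  unfolding has_grad_def
proof (intro conjI allI)
  fix x
  have 1: "(f has_derivative (\<lambda>k. f' (c + t *\<^sub>R x) \<bullet> k)) (at (c + t *\<^sub>R x))"
    using f by (simp add: has_grad_def)
  have 2: "((\<lambda>x. c + t *\<^sub>R x) has_derivative (\<lambda>k. t *\<^sub>R k)) (at x)"
    by (rule has_derivative_eq_rhs, (rule derivative_intros)+) simp
  show "((\<lambda>x. f (c + t *\<^sub>R x)) has_derivative (\<lambda>k. t *\<^sub>R f' (c + t *\<^sub>R x) \<bullet> k)) (at x)"
    using has_derivative_compose[OF 2 1] by simp
next
  show "continuous_on UNIV (\<lambda>x. t *\<^sub>R f' (c + t *\<^sub>R x))"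
    by (intro continuous_intros continuous_on_compose2[OF has_grad_continuous_grad[OF f]]) auto
qed

lemma C2_fun_C1: "C2_fun f \<Longrightarrow> C1_fun f"
  by (simp add: C2_fun_def)

lemma C2_fun_has_grad: "C2_fun f \<Longrightarrow> has_grad f (grad f)"
  by (simp add: C2_fun_C1 C1_fun_has_grad)

lemma C2_fun_has_grad2: "C2_fun f \<Longrightarrow> has_grad (\<lambda>x. grad f x $ i) (grad (partial_deriv i f))"
  using C1_fun_has_grad[of "partial_deriv i f"] by (simp add: C2_fun_def grad_def)

lemma C2_fun_continuous: "C2_fun f \<Longrightarrow> continuous_on UNIV f"
  using C2_fun_has_grad has_grad_continuous by blast

lemma C2_fun_continuous_grad: "C2_fun f \<Longrightarrow> continuous_on UNIV (grad f)"
  using C2_fun_has_grad has_grad_continuous_grad by blast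

text \<open>Second derivatives are produced through this rule: \<open>H i\<close> is the gradient of
  the i-th component of \<open>g\<close>, and the Laplacian is the trace of the matrix with rows
  \<open>H i\<close>. Carrying explicit gradient fields keeps \<open>frechet_derivative\<close> out
  of the later computations.\<close>

lemma C2_funI:
  assumes "has_grad f g" "\<And>i. has_grad (\<lambda>x. g x $ i) (H i)"
  shows "C2_fun f" "laplacian f = (\<lambda>x. \<Sum>i\<in>UNIV. H i x $ i)" "grad f = g"
proof -
  show "C2_fun f"
    unfolding C2_fun_def has_grad_partial_deriv[OF assms(1)]
    using has_grad_C1_fun[OF assms(1)] has_grad_C1_fun[OF assms(2)] by auto
  show "laplacian f = (\<lambda>x. \<Sum>i\<in>UNIV. H i x $ i)"
    unfolding laplacian_def[abs_def] has_grad_partial_deriv[OF assms(1)]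
    using has_grad_partial_deriv[OF assms(2)] by simp
  show "grad f = g" using has_grad_unique[OF assms(1)] .
qed

lemma laplacian_grad: "laplacian f x = (\<Sum>i\<in>UNIV. grad (partial_deriv i f) x $ i)"
  by (simp add: laplacian_def grad_def)

lemma C2_fun_continuous_laplacian: "C2_fun f \<Longrightarrow> continuous_on UNIV (laplacian f)"
  unfolding laplacian_grad[abs_def] using has_grad_continuous_grad[OF C2_fun_has_grad2]
  by (auto intro!: continuous_intros)

lemma C2_fun_const: "C2_fun (\<lambda>x. c)"
proof -
  have "has_grad (\<lambda>x::real^'n. (0::real^'n) $ i) (\<lambda>x. 0)" for i by (rule has_grad_const)
  then show "C2_fun (\<lambda>x::real^'n. c)" by (rule C2_funI(1)[OF has_grad_const])
qed

lemma C2_fun_add: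
  assumes "C2_fun f" "C2_fun g"
  shows "C2_fun (\<lambda>x. f x + g x)" "laplacian (\<lambda>x. f x + g x) = (\<lambda>x. laplacian f x + laplacian g x)"
    "grad (\<lambda>x. f x + g x) = (\<lambda>x. grad f x + grad g x)"
proof -
  have 1: "has_grad (\<lambda>x. (grad f x + grad g x) $ i)
      (\<lambda>x. grad (partial_deriv i f) x + grad (partial_deriv i g) x)" for i
    using has_grad_add[OF C2_fun_has_grad2[OF assms(1)] C2_fun_has_grad2[OF assms(2)]] by simp
  note 2 = C2_funI[OF has_grad_add[OF C2_fun_has_grad[OF assms(1)] C2_fun_has_grad[OF assms(2)]] 1]
  show "C2_fun (\<lambda>x. f x + g x)" "grad (\<lambda>x. f x + g x) = (\<lambda>x. grad f x + grad g x)"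
    by (fact 2)+
  show "laplacian (\<lambda>x. f x + g x) = (\<lambda>x. laplacian f x + laplacian g x)"
    unfolding 2(2) by (simp add: laplacian_grad sum.distrib)
qed

lemma C2_fun_cmult:
  assumes "C2_fun f"
  shows "C2_fun (\<lambda>x. c * f x)" "laplacian (\<lambda>x. c * f x) = (\<lambda>x. c * laplacian f x)"
    "grad (\<lambda>x. c * f x) = (\<lambda>x. c *\<^sub>R grad f x)"
proof -
  have 1: "has_grad (\<lambda>x. (c *\<^sub>R grad f x) $ i) (\<lambda>x. c *\<^sub>R grad (partial_deriv i f) x)" for i
    using has_grad_cmult[OF C2_fun_has_grad2[OF assms]] by simp
  note 2 = C2_funI[OF has_grad_cmult[OF C2_fun_has_grad[OF assms]] 1]
  show "C2_fun (\<lambda>x. c * f x)" "grad (\<lambda>x. c * f x) = (\<lambda>x. c *\<^sub>R grad f x)"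
    by (fact 2)+
  show "laplacian (\<lambda>x. c * f x) = (\<lambda>x. c * laplacian f x)"
    unfolding 2(2) by (simp add: laplacian_grad sum_distrib_left)
qed

lemma C2_fun_affine:
  assumes "C2_fun f"
  shows "C2_fun (\<lambda>x. f (c + t *\<^sub>R x))"
    "laplacian (\<lambda>x. f (c + t *\<^sub>R x)) = (\<lambda>x. t^2 * laplacian f (c + t *\<^sub>R x))"
    "grad (\<lambda>x. f (c + t *\<^sub>R x)) = (\<lambda>x. t *\<^sub>R grad f (c + t *\<^sub>R x))"
proof -
  have 1: "has_grad (\<lambda>x. (t *\<^sub>R grad f (c + t *\<^sub>R x)) $ i)
      (\<lambda>x. t *\<^sub>R (t *\<^sub>R grad (partial_deriv i f) (c + t *\<^sub>R x)))" for i
    using has_grad_cmult[OF has_grad_affine[OF C2_fun_has_grad2[OF assms]]] by simp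
  note 2 = C2_funI[OF has_grad_affine[OF C2_fun_has_grad[OF assms]] 1]
  show "C2_fun (\<lambda>x. f (c + t *\<^sub>R x))"
    "grad (\<lambda>x. f (c + t *\<^sub>R x)) = (\<lambda>x. t *\<^sub>R grad f (c + t *\<^sub>R x))"
    by (fact 2)+
  show "laplacian (\<lambda>x. f (c + t *\<^sub>R x)) = (\<lambda>x. t^2 * laplacian f (c + t *\<^sub>R x))"
    unfolding 2(2) by (simp add: laplacian_grad sum_distrib_left power2_eq_square mult.assoc)
qed

lemma C2_fun_compose:
  assumes f: "C2_fun f" and S: "\<And>x. f x \<in> S"
    and h: "\<And>y. y \<in> S \<Longrightarrow> (h has_real_derivative h' y) (at y)"
    and h': "\<And>y. y \<in> S \<Longrightarrow> (h' has_real_derivative h'' y) (at y)" and h'': "continuous_on S h''"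
  shows "C2_fun (\<lambda>x. h (f x))"
    "laplacian (\<lambda>x. h (f x)) = (\<lambda>x. h'' (f x) * (norm (grad f x))^2 + h' (f x) * laplacian f x)"
    "grad (\<lambda>x. h (f x)) = (\<lambda>x. h' (f x) *\<^sub>R grad f x)"
proof -
  have c: "continuous_on S h'"
    using h' by (meson DERIV_continuous continuous_at_imp_continuous_on)
  note 1 = has_grad_compose[OF C2_fun_has_grad[OF f] S h c]
  have 3: "has_grad (\<lambda>x. (h' (f x) *\<^sub>R grad f x) $ i)
     (\<lambda>x. h' (f x) *\<^sub>R grad (partial_deriv i f) x + grad f x $ i *\<^sub>R (h'' (f x) *\<^sub>R grad f x))" for i
    using has_grad_mult[OF has_grad_compose[OF C2_fun_has_grad[OF f] S h' h''] C2_fun_has_grad2[OF f], of i] by simp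
  note 4 = C2_funI[OF 1 3]
  show "C2_fun (\<lambda>x. h (f x))" "grad (\<lambda>x. h (f x)) = (\<lambda>x. h' (f x) *\<^sub>R grad f x)"
    using 4(1,3) by simp_all
  show "laplacian (\<lambda>x. h (f x)) = (\<lambda>x. h'' (f x) * (norm (grad f x))^2 + h' (f x) * laplacian f x)"
  proof (rule ext)
    fix x
    have "laplacian (\<lambda>x. h (f x)) x = (\<Sum>i\<in>UNIV. (h' (f x) *\<^sub>R grad (partial_deriv i f) x
        + grad f x $ i *\<^sub>R (h'' (f x) *\<^sub>R grad f x)) $ i)"
      using fun_cong[OF 4(2), of x] by simp
    also have "\<dots> = h'' (f x) * (norm (grad f x))^2 + h' (f x) * laplacian f x"
      unfolding laplacian_grad power2_norm_eq_inner inner_vec_def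
      by (simp add: sum.distrib sum_distrib_left algebra_simps)
    finally show "laplacian (\<lambda>x. h (f x)) x = h'' (f x) * (norm (grad f x))^2 + h' (f x) * laplacian f x" .
  qed
qed

lemma C2_fun_norm2:
  shows "C2_fun (\<lambda>x::real^'n::finite. (norm x)^2)" "grad (\<lambda>x::real^'n::finite. (norm x)^2) = (\<lambda>x. 2 *\<^sub>R x)"
proof -
  have 1: "has_grad (\<lambda>x::real^'n. (norm x)^2) (\<lambda>x. 2 *\<^sub>R x)"
    unfolding power2_norm_eq_inner
    by (rule has_gradI[OF has_derivative_inner[OF has_derivative_ident has_derivative_ident]])
      (simp_all add: inner_commute continuous_intros)
  have 2: "has_grad (\<lambda>x::real^'n. (2 *\<^sub>R x) $ i) (\<lambda>x. 2 *\<^sub>R axis i 1)" for i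
    by (rule has_gradI[OF bounded_linear.has_derivative[OF bounded_linear_vec_nth
          has_derivative_scaleR_right[OF has_derivative_ident]]])
      (simp_all add: inner_axis inner_commute)
  show "C2_fun (\<lambda>x::real^'n::finite. (norm x)^2)" "grad (\<lambda>x::real^'n::finite. (norm x)^2) = (\<lambda>x. 2 *\<^sub>R x)"
    using C2_funI[OF 1 2] by auto
qed

text \<open>Confines the gradient of a cutoff to the annulus where it is not locally constant;
  applied to the components of the gradient it does the same for the Laplacian.\<close>

lemma grad_zero_open:
  assumes "has_grad f g" "open S" "x \<in> S" "\<And>y. y \<in> S \<Longrightarrow> f y = c"
  shows "g x = 0"
proof -
  have 1: "(f has_derivative (\<lambda>h. g x \<bullet> h)) (at x)" using assms by (simp add: has_grad_def)
  have "((\<lambda>_. c) has_derivative (\<lambda>h. g x \<bullet> h)) (at x)"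
    by (rule has_derivative_transform_within_open[OF 1 assms(2,3)]) (use assms(4) in auto)
  from has_derivative_unique[OF this has_derivative_const] have "g x \<bullet> g x = 0"
    by (rule fun_cong)
  then show ?thesis by simp
qed

lemma laplacian_zero_open:
  assumes f: "C2_fun f" and "open S" "x \<in> S" "\<And>y. y \<in> S \<Longrightarrow> f y = c"
  shows "laplacian f x = 0"
proof -
  have "grad f y = 0" if "y \<in> S" for y
    using grad_zero_open[OF C2_fun_has_grad[OF f] assms(2) that] assms(4) by auto
  then have "grad (partial_deriv i f) x = 0" for i
    using grad_zero_open[OF C2_fun_has_grad2[OF f] assms(2,3)] by auto
  then show ?thesis by (simp add: laplacian_grad)
qed

subsection \<open>Compactly supported functions and integration by parts\<close>

text \<open>Integrands are kept continuous with bounded support, so that most integrability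
  conditions below reduce to closure rules. The codomain is general in order to cover gradient
  fields.\<close>

definition cc :: "('a::real_normed_vector \<Rightarrow> 'b::real_normed_vector) \<Rightarrow> bool" where
  "cc f \<longleftrightarrow> continuous_on UNIV f \<and> (\<exists>B. \<forall>x. B < norm x \<longrightarrow> f x = 0)"

lemma ccI: "continuous_on UNIV f \<Longrightarrow> (\<And>x. B < norm x \<Longrightarrow> f x = 0) \<Longrightarrow> cc f"
  by (auto simp: cc_def)

lemma cc_continuous: "cc f \<Longrightarrow> continuous_on UNIV f"
  by (simp add: cc_def)

lemma cc_mono_support:
  assumes "cc f" "continuous_on UNIV g" "\<And>x. f x = 0 \<Longrightarrow> g x = 0"
  shows "cc g"
  using assms unfolding cc_def by blast

lemma cc_mult: "cc f \<Longrightarrow> continuous_on UNIV g \<Longrightarrow> cc (\<lambda>x. f x * g x :: real)"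
  by (rule cc_mono_support[of f]) (auto intro!: continuous_intros dest: cc_continuous)

lemma cc_mult2: "cc g \<Longrightarrow> continuous_on UNIV f \<Longrightarrow> cc (\<lambda>x. f x * g x :: real)"
  by (rule cc_mono_support[of g]) (auto intro!: continuous_intros dest: cc_continuous)

lemma cc_add: 
  assumes "cc f" "cc g" shows "cc (\<lambda>x. f x + g x)"
proof -
  obtain B1 B2 where "\<forall>x. B1 < norm x \<longrightarrow> f x = 0" "\<forall>x. B2 < norm x \<longrightarrow> g x = 0"
    using assms by (auto simp: cc_def)
  then show ?thesis using assms
    by (intro ccI[of _ "max B1 B2"]) (auto intro!: continuous_intros simp: cc_def)
qed

lemma cc_cmult: "cc f \<Longrightarrow> cc (\<lambda>x. c * f x :: real)"
  by (rule cc_mult2) auto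

lemma cc_diff: "cc f \<Longrightarrow> cc g \<Longrightarrow> cc (\<lambda>x. f x - g x :: real)"
  using cc_add[of f "\<lambda>x. (-1) * g x"] cc_cmult[of g "-1"] by simp

lemma cc_norm_power: "cc f \<Longrightarrow> n > 0 \<Longrightarrow> cc (\<lambda>x. (norm (f x))^n)"
  by (rule cc_mono_support[of f]) (auto intro!: continuous_intros dest: cc_continuous)

lemma cc_bounded:
  fixes f :: "'a::euclidean_space \<Rightarrow> 'b::real_normed_vector"
  assumes "cc f" shows "\<exists>M>0. \<forall>x. norm (f x) \<le> M"
proof -
  obtain B where B: "\<forall>x. B < norm x \<longrightarrow> f x = 0" using assms by (auto simp: cc_def)
  have "compact (f ` cball 0 B)"
    using assms by (auto intro!: compact_continuous_image continuous_on_subset[OF cc_continuous])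
  then obtain M where M: "M > 0" "\<And>y. y \<in> f ` cball 0 B \<Longrightarrow> norm y \<le> M"
    using compact_imp_bounded bounded_pos by metis
  have "norm (f x) \<le> M" for x
    using B M by (cases "B < norm x") auto
  then show ?thesis using M by auto
qed

lemma cc_integrable:
  fixes f :: "'a::euclidean_space \<Rightarrow> real"
  assumes "cc f" shows "integrable lborel f"
proof -
  obtain B where B: "\<forall>x. B < norm x \<longrightarrow> f x = 0" using assms by (auto simp: cc_def)
  have "integrable lborel (\<lambda>x. indicator (cball 0 B) x *\<^sub>R f x)"
    by (rule borel_integrable_compact) (auto intro: continuous_on_subset[OF cc_continuous[OF assms]])
  moreover have "(\<lambda>x. indicator (cball 0 B) x *\<^sub>R f x) = f"
    using B by (auto simp: fun_eq_iff indicator_def)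
  ultimately show ?thesis by simp
qed

lemma cc_integral_mono:
  fixes f :: "'a::euclidean_space \<Rightarrow> real"
  shows "cc f \<Longrightarrow> cc g \<Longrightarrow> (\<And>x. f x \<le> g x) \<Longrightarrow> integral\<^sup>L lborel f \<le> integral\<^sup>L lborel g"
  by (intro integral_mono cc_integrable)

lemma cc_affine:
  fixes f :: "'a::real_normed_vector \<Rightarrow> 'b::real_normed_vector"
  assumes "cc f" "t \<noteq> 0" shows "cc (\<lambda>x. f (c + t *\<^sub>R x))"
proof -
  obtain B where B: "\<forall>x. B < norm x \<longrightarrow> f x = 0" using assms by (auto simp: cc_def)
  show ?thesis
  proof (rule ccI)
    show "continuous_on UNIV (\<lambda>x. f (c + t *\<^sub>R x))"
      by (rule continuous_on_compose2[OF cc_continuous[OF assms(1)]]) (auto intro!: continuous_intros)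
    fix x :: 'a assume "(B + norm c) / \<bar>t\<bar> < norm x"
    then have "B + norm c < norm (t *\<^sub>R x)" using assms(2) by (simp add: pos_divide_less_eq mult.commute)
    moreover have "norm (t *\<^sub>R x) \<le> norm (c + t *\<^sub>R x) + norm c"
      using norm_triangle_ineq4[of "c + t *\<^sub>R x" c] by simp
    ultimately show "f (c + t *\<^sub>R x) = 0" using B by auto
  qed
qed

section \<open>Changes of variables and difference quotients\<close>

lemma integral_lborel_affine:
  fixes f :: "'a::euclidean_space \<Rightarrow> real"
  assumes "t \<noteq> 0" "f \<in> borel_measurable borel"
  shows "(\<integral>x. f x \<partial>lborel) = \<bar>t\<bar>^DIM('a) * (\<integral>x. f (c + t *\<^sub>R x) \<partial>lborel)"
proof -
  have "(\<integral>x. f x \<partial>lborel) = (\<integral>x. f x \<partial>(density (distr lborel borel (\<lambda>x. c + t *\<^sub>R x)) (\<lambda>_. ennreal (\<bar>t\<bar>^DIM('a)))))"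
    using lborel_affine[OF assms(1), of c] by simp
  also have "\<dots> = \<bar>t\<bar>^DIM('a) * (\<integral>x. f (c + t *\<^sub>R x) \<partial>lborel)"
    using assms by (simp add: integral_density integral_distr)
  finally show ?thesis .
qed

lemma cc_measurable: "cc f \<Longrightarrow> f \<in> borel_measurable borel"
  by (intro borel_measurable_continuous_onI cc_continuous)

lemma cc_integral_affine:
  fixes f :: "real^'n::finite \<Rightarrow> real"
  assumes "t > 0" "cc f"
  shows "(\<integral>x. f (c + t *\<^sub>R x) \<partial>lborel) = (\<integral>x. f x \<partial>lborel) / t^CARD('n)"
  using integral_lborel_affine[OF _ cc_measurable[OF assms(2)], of t c] assms(1) by (simp add: field_simps)

lemma cc_integral_pos:
  fixes f :: "'a::euclidean_space \<Rightarrow> real"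
  assumes "cc f" "\<And>x. 0 \<le> f x" "0 < f a"
  shows "0 < integral\<^sup>L lborel f"
proof -
  have "isCont f a" using cc_continuous[OF assms(1)] by (simp add: continuous_on_eq_continuous_at)
  then obtain d where d: "d > 0" "\<And>x. dist x a < d \<Longrightarrow> dist (f x) (f a) < f a / 2"
    unfolding continuous_at_eps_delta using assms(3) by (meson half_gt_zero)
  have "0 < f a / 2 * measure lborel (ball a d)"
    using content_ball_pos[OF d(1), of a] assms(3) by simp
  also have "\<dots> = (\<integral>x. f a / 2 * indicator (ball a d) x \<partial>lborel)" by simp
  also have "\<dots> \<le> integral\<^sup>L lborel f"
  proof (rule integral_mono)
    show "integrable lborel (\<lambda>x. f a / 2 * indicator (ball a d) x)"
      by (intro integrable_mult_right integrable_real_indicator)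
        (simp_all add: emeasure_bounded_finite[OF bounded_cball, unfolded infinity_ennreal_def]
          emeasure_bounded_finite[OF bounded_ball, unfolded infinity_ennreal_def])
    show "integrable lborel f" by (rule cc_integrable[OF assms(1)])
    fix x
    show "f a / 2 * indicator (ball a d) x \<le> f x"
    proof (cases "x \<in> ball a d")
      case True
      then have "dist x a < d" by (simp add: dist_commute)
      from d(2)[OF this] have "f a / 2 \<le> f x" unfolding dist_real_def by linarith
      then show ?thesis using True by simp
    qed (simp add: assms(2))
  qed
  finally show ?thesis .
qed

lemma has_grad_lipschitz:
  assumes "has_grad f g" "\<And>x. norm (g x) \<le> M"
  shows "\<bar>f x - f y\<bar> \<le> M * norm (x - y)"
proof -
  have "norm (f x - f y) \<le> M * norm (x - y)"
  proof (rule differentiable_bound[of UNIV])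
    show "onorm (\<lambda>h. g x \<bullet> h) \<le> M" for x
    proof (rule onorm_bound)
      show "0 \<le> M" using assms(2)[of x] norm_ge_zero order_trans by blast
      show "norm (g x \<bullet> h) \<le> M * norm h" for h
        using Cauchy_Schwarz_ineq2[of "g x" h] mult_right_mono[OF assms(2)[of x], of "norm h"] by simp
    qed
  qed (use has_gradD[OF assms(1)] in auto)
  then show ?thesis by simp
qed

lemma cc_grad:
  assumes f: "cc f" and g: "has_grad f g" shows "cc g"
proof -
  obtain B where B: "\<forall>x. B < norm x \<longrightarrow> f x = 0" using assms by (auto simp: cc_def)
  have "g x = 0" if "B < norm x" for x
  proof (rule grad_zero_open[OF g, of "{x. B < norm x}"])
    show "open {x::real^'a. B < norm x}" by (intro open_Collect_less continuous_intros)
  qed (use that B in auto)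
  then show ?thesis by (intro ccI has_grad_continuous_grad[OF g])
qed

lemma has_grad_line:
  assumes "has_grad f g"
  shows "((\<lambda>t. f (x + t *\<^sub>R y)) has_real_derivative g (x + t *\<^sub>R y) \<bullet> y) (at t within S)"
proof -
  have 2: "((\<lambda>t. x + t *\<^sub>R y) has_derivative (\<lambda>k. k *\<^sub>R y)) (at t)"
    by (rule has_derivative_eq_rhs, (rule derivative_intros)+) simp
  have "((\<lambda>t. f (x + t *\<^sub>R y)) has_derivative (\<lambda>k. g (x + t *\<^sub>R y) \<bullet> (k *\<^sub>R y))) (at t)"
    by (rule has_derivative_compose[OF 2 has_gradD[OF assms]])
  then have "((\<lambda>t. f (x + t *\<^sub>R y)) has_real_derivative g (x + t *\<^sub>R y) \<bullet> y) (at t)"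
    unfolding has_field_derivative_def by (simp add: mult.commute[of _ "g (x + t *\<^sub>R y) \<bullet> y"] mult_commute_abs)
  then show ?thesis by (rule DERIV_subset) simp
qed

text \<open>Prepared for dominated convergence: along the steps 1/(n + 1) the quotients converge to
  the directional derivative under one common bound with compact support.\<close>

lemma difference_quotient:
  fixes f :: "real^'n::finite \<Rightarrow> real" and y :: "real^'n"
  assumes f: "cc f" and g: "has_grad f g"
  defines "F \<equiv> \<lambda>n x. (f (x + inverse (real (Suc n)) *\<^sub>R y) - f x) / inverse (real (Suc n))"
  shows "cc (F n)" "(\<lambda>n. F n x) \<longlonglongrightarrow> g x \<bullet> y"
    "\<exists>B M. \<forall>n x. \<bar>F n x\<bar> \<le> indicator (cball 0 B) x * M"
proof -
  define t where "t n = inverse (real (Suc n))" for n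
  have t: "0 < t n" "t n \<le> 1" for n by (auto simp: t_def field_simps)
  have F: "F n x = (f (x + t n *\<^sub>R y) - f x) / t n" for n x by (simp add: F_def t_def)
  have sh: "cc (\<lambda>x. f (x + z))" for z using cc_affine[OF f, of 1 z] by (simp add: add.commute)
  show "cc (F n)"
    using cc_cmult[OF cc_diff[OF sh f], of "1 / t n"] by (simp add: F[abs_def])
  show "(\<lambda>n. F n x) \<longlonglongrightarrow> g x \<bullet> y"
  proof -
    have "((\<lambda>s. f (x + s *\<^sub>R y)) has_real_derivative g x \<bullet> y) (at 0)"
      using has_grad_line[OF g, of x y 0] by simp
    then have 1: "((\<lambda>h. (f (x + h *\<^sub>R y) - f x) / h) \<longlongrightarrow> g x \<bullet> y) (at 0)"
      unfolding DERIV_def by simp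
    have "filterlim t (at 0) sequentially"
      unfolding filterlim_at using LIMSEQ_inverse_real_of_nat t(1)
      by (auto simp: t_def[abs_def])
    from filterlim_compose[OF 1 this] show ?thesis by (simp add: F)
  qed
  obtain B where B: "\<forall>x. B < norm x \<longrightarrow> f x = 0" using f by (auto simp: cc_def)
  obtain M where M: "M > 0" "\<And>x. norm (g x) \<le> M" using cc_bounded[OF cc_grad[OF f g]] by auto
  \<comment> \<open>The steps are at most 1, so every shift moves the support by at most
    \<open>norm y\<close>.\<close>
  define B' where "B' = \<bar>B\<bar> + norm y"
  have "\<bar>F n x\<bar> \<le> indicator (cball 0 B') x * (M * norm y)" for n x
  proof (cases "norm x \<le> B'")
    case True
    have "\<bar>f (x + t n *\<^sub>R y) - f x\<bar> \<le> M * norm y * t n"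
      using has_grad_lipschitz[OF g M(2), of "x + t n *\<^sub>R y" x] t[of n] by (simp add: algebra_simps)
    then show ?thesis using True t[of n] by (simp add: F abs_divide pos_divide_le_eq)
  next
    case False
    have "norm (t n *\<^sub>R y) \<le> norm y" using t[of n] mult_right_mono[of "t n" 1 "norm y"] by simp
    then have "norm x \<le> norm (x + t n *\<^sub>R y) + norm y"
      using norm_triangle_ineq4[of "x + t n *\<^sub>R y" "t n *\<^sub>R y"] by simp
    then have "B < norm (x + t n *\<^sub>R y)" "B < norm x" using False norm_ge_zero[of y] unfolding B'_def by linarith+
    then show ?thesis using B False by (simp add: F)
  qed
  then show "\<exists>B M. \<forall>n x. \<bar>F n x\<bar> \<le> indicator (cball 0 B) x * M" by blast
qed

lemma integrable_indicator_cball_mult: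
  "integrable lborel (\<lambda>x::'a::euclidean_space. indicator (cball 0 B) x * (M::real))"
  by (intro integrable_mult_left integrable_real_indicator)
    (simp_all add: emeasure_bounded_finite[OF bounded_cball, unfolded infinity_ennreal_def])

text \<open>Takes the place of the divergence theorem. A difference quotient integrates to 0 by
  translation invariance, and the quotients converge dominatedly to the partial derivative.\<close>

lemma integral_grad_zero:
  fixes f :: "real^'n::finite \<Rightarrow> real"
  assumes f: "cc f" and g: "has_grad f g"
  shows "(\<integral>x. g x $ i \<partial>lborel) = 0"
proof -
  define e :: "real^'n" where "e = axis i 1"
  define F where "F n x = (f (x + inverse (real (Suc n)) *\<^sub>R e) - f x) / inverse (real (Suc n))" for n x
  note D = difference_quotient[OF f g, where y=e, folded F_def]
  obtain B M where bd: "\<And>n x. \<bar>F n x\<bar> \<le> indicator (cball 0 B) x * M" using D(3) by blast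
  have F0: "(\<integral>x. F n x \<partial>lborel) = 0" for n
  proof -
    have sh: "cc (\<lambda>x. f (x + z))" for z using cc_affine[OF f, of 1 z] by (simp add: add.commute)
    have "(\<integral>x. f (x + z) \<partial>lborel) = (\<integral>x. f x \<partial>lborel)" for z
      using cc_integral_affine[OF _ f, of 1 z] by (simp add: add.commute)
    then show ?thesis unfolding F_def using cc_integrable[OF f] cc_integrable[OF sh] by simp
  qed
  have "(\<lambda>n. \<integral>x. F n x \<partial>lborel) \<longlonglongrightarrow> (\<integral>x. g x \<bullet> e \<partial>lborel)"
  proof (rule integral_dominated_convergence[where w="\<lambda>x. indicator (cball 0 B) x * M"])
    show "(\<lambda>x. g x \<bullet> e) \<in> borel_measurable lborel"
      using borel_measurable_continuous_onI[OF continuous_on_component[OF has_grad_continuous_grad[OF g], of i]]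
      by (simp add: e_def inner_axis1)
    show "F n \<in> borel_measurable lborel" for n using cc_measurable[OF D(1)[of n]] by (simp add: F_def[abs_def])
    show "integrable lborel (\<lambda>x::real^'n. indicator (cball 0 B) x * M)" by (rule integrable_indicator_cball_mult)
  qed (use D(2) bd in auto)
  then show ?thesis by (simp add: F0 LIMSEQ_const_iff e_def inner_axis1)
qed

text \<open>\<open>integral_grad_zero\<close> applied to \<open>\<phi>\<close> times each partial
  derivative of \<open>f\<close>. One factor with bounded support suffices: test functions supply it
  as \<open>\<phi>\<close>, and \<open>green_swap\<close> uses both alternatives.\<close>

lemma green:
  fixes f :: "real^'n::finite \<Rightarrow> real"
  assumes f: "C2_fun f" and g: "has_grad \<phi> g" and c: "cc \<phi> \<or> cc f"
  shows "(\<integral>x. \<phi> x * laplacian f x \<partial>lborel) = - (\<integral>x. g x \<bullet> grad f x \<partial>lborel)"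
proof -
  have cg: "cc (grad f)" if "cc f" using cc_grad[OF that C2_fun_has_grad[OF f]] .
  have ch: "cc (\<lambda>x. grad f x $ i)" if "cc f" for i
    by (rule cc_mono_support[OF cg[OF that] continuous_on_component[OF C2_fun_continuous_grad[OF f]]]) simp
  have cH: "cc (grad (partial_deriv i f))" if "cc f" for i
    using cc_grad[OF ch[OF that] C2_fun_has_grad2[OF f]] .
  note ct = has_grad_continuous[OF g] has_grad_continuous_grad[OF g] C2_fun_continuous_grad[OF f]
    has_grad_continuous_grad[OF C2_fun_has_grad2[OF f]]
  have k1: "continuous_on UNIV (\<lambda>x. grad f x $ i)" for i by (rule continuous_on_component[OF ct(3)])
  have k2: "continuous_on UNIV (\<lambda>x. g x $ i)" for i by (rule continuous_on_component[OF ct(2)])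
  have k3: "continuous_on UNIV (\<lambda>x. grad (partial_deriv i f) x $ i)" for i
    by (rule continuous_on_component[OF ct(4)])
  have hg: "has_grad (\<lambda>x. \<phi> x * grad f x $ i) (\<lambda>x. \<phi> x *\<^sub>R grad (partial_deriv i f) x + grad f x $ i *\<^sub>R g x)" for i
    by (rule has_grad_mult[OF g C2_fun_has_grad2[OF f]])
  have c1: "cc (\<lambda>x. \<phi> x * grad f x $ i)" for i
    using c
  proof
    assume "cc \<phi>" then show ?thesis by (rule cc_mult) (rule k1)
  next
    assume "cc f" then show ?thesis by (rule cc_mult2[OF ch ct(1)])
  qed
  have c2: "cc (\<lambda>x. \<phi> x * grad (partial_deriv i f) x $ i)" for i
    using c
  proof
    assume "cc \<phi>" then show ?thesis by (rule cc_mult) (rule k3)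
  next
    assume "cc f" then have "cc (\<lambda>x. grad (partial_deriv i f) x $ i)"
      using cc_mono_support[OF cH[OF \<open>cc f\<close>, of i] k3[of i]] by simp
    then show ?thesis by (rule cc_mult2[OF _ ct(1)])
  qed
  have c3: "cc (\<lambda>x. grad f x $ i * g x $ i)" for i
    using c
  proof
    assume "cc \<phi>" then have "cc (\<lambda>x. g x $ i)"
      by (rule cc_mono_support[OF cc_grad[OF _ g] k2]) simp
    then show ?thesis by (rule cc_mult2[OF _ k1])
  next
    assume "cc f" then show ?thesis by (rule cc_mult[OF ch k2])
  qed
  have z: "(\<integral>x. \<phi> x * grad (partial_deriv i f) x $ i \<partial>lborel) + (\<integral>x. grad f x $ i * g x $ i \<partial>lborel) = 0" for i
    using integral_grad_zero[OF c1 hg, of i i]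
      Bochner_Integration.integral_add[OF cc_integrable[OF c2[of i]] cc_integrable[OF c3[of i]]] by simp
  have "(\<integral>x. \<phi> x * laplacian f x \<partial>lborel) = (\<Sum>i\<in>UNIV. \<integral>x. \<phi> x * grad (partial_deriv i f) x $ i \<partial>lborel)"
    unfolding laplacian_grad sum_distrib_left using cc_integrable[OF c2] by (intro Bochner_Integration.integral_sum)
  also have "\<dots> = (\<Sum>i\<in>UNIV. - (\<integral>x. grad f x $ i * g x $ i \<partial>lborel))"
    using z by (intro sum.cong) (auto simp: add_eq_0_iff2)
  also have "\<dots> = - (\<integral>x. (\<Sum>i\<in>UNIV. grad f x $ i * g x $ i) \<partial>lborel)"
    using cc_integrable[OF c3] by (simp add: sum_negf Bochner_Integration.integral_sum)
  finally show ?thesis by (simp add: inner_vec_def mult.commute)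
qed

subsection \<open>The quartic polynomial\<close>

text \<open>With q = s(\<theta> + 1)/(p + 1) and s > 1/2, negativity says q^2 s^2 < p\<theta> (2s -
  1)(2q - 1): the product of q^2/(2q - 1) and s^2/(2s - 1), the limiting constants from testing the
  two equations, stays below the square of the factor \<open>sqrt (p * \<theta>)\<close> in the
  stability inequality.\<close>

definition quart :: "real \<Rightarrow> real \<Rightarrow> real \<Rightarrow> real" where
  "quart p \<theta> s = ((\<theta> + 1) / (p + 1))^2 * s^4 - p * \<theta> * (2 * s - 1) * (2 * ((\<theta> + 1) / (p + 1)) * s - 1)"

lemma sixteen_diff_divide_neg: "0 < b - a \<Longrightarrow> 0 < c \<Longrightarrow> 16 * (a - b) / c < (0::real)"
  by (intro divide_neg_pos) auto

lemma quart_eq: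
  assumes "1 < p"
  shows "quart p \<theta> s =
    ((\<theta> + 1)^2 * s^4 - p * \<theta> * (2 * s - 1) * (2 * (\<theta> + 1) * s - (p + 1)) * (p + 1)) / (p + 1)^2"
proof -
  define w where "w = p + 1"
  define \<kappa> where "\<kappa> = (\<theta> + 1) / (p + 1)"
  have w: "w \<noteq> 0" and k: "\<theta> + 1 = \<kappa> * w" using assms by (simp_all add: w_def \<kappa>_def)
  have "(\<kappa>^2 * s^4 - p * \<theta> * (2 * s - 1) * (2 * \<kappa> * s - 1)) * w^2
    = (\<kappa> * w)^2 * s^4 - p * \<theta> * (2 * s - 1) * (2 * (\<kappa> * w) * s - w) * w" by algebra
  then show ?thesis unfolding quart_def w_def[symmetric] \<kappa>_def[symmetric] k
    using w by (simp add: eq_divide_eq)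
qed

text \<open>The dictionary between the exponent s of the estimates and the variable of H; the factor
  in front is positive, so the signs agree.\<close>

lemma H_poly_quart:
  assumes "1 < p" "p \<le> \<theta>"
  shows "poly (H_poly p \<theta>) (2 * (\<theta> + 1) * s / (p * \<theta> - 1))
    = 16 * (\<theta> + 1)^2 * (p + 1)^2 / (p * \<theta> - 1)^4 * quart p \<theta> s"
proof -
  define D where "D = p * \<theta> - 1"
  have "p * \<theta> > 1" using assms less_1_mult[of p \<theta>] by simp
  then have D: "D > 0" by (simp add: D_def)
  have p1: "p + 1 \<noteq> 0" using assms by simp
  show ?thesis
  proof -
    \<comment> \<open>Division by \<open>D\<close> becomes multiplication by \<open>E\<close>, which
      leaves a polynomial identity for \<open>algebra\<close>.\<close>
    define E where "E = inverse D"
    have dv: "a / D^n = a * E^n" "a / D = a * E" for a n by (simp_all add: E_def divide_inverse power_inverse)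
    have "poly [:- (16 * p * \<theta> * (p + 1)^2 * (\<theta> + 1)^2 * E^4),
        16 * p * \<theta> * (p + 1) * (\<theta> + 1) * (p + \<theta> + 2) * E^3,
        - (16 * p * \<theta> * (p + 1) * (\<theta> + 1) * E^2), 0, 1:] (2 * (\<theta> + 1) * s * E)
      = 16 * (\<theta> + 1)^2 * E^4 * ((\<theta> + 1)^2 * s^4 - p * \<theta> * (2 * s - 1) * (2 * (\<theta> + 1) * s - (p + 1)) * (p + 1))"
      unfolding poly_pCons poly_0 by algebra
    then show ?thesis
      unfolding H_poly_def D_def[symmetric] dv quart_eq[OF assms(1)] using p1 by simp
  qed
qed

lemma quart_factor_pos:
  fixes p \<theta> :: real
  assumes "1 < p" "p \<le> \<theta>"
  shows "16 * (\<theta> + 1)^2 * (p + 1)^2 / (p * \<theta> - 1)^4 > 0"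
proof -
  have "p * \<theta> > 1" using assms less_1_mult[of p \<theta>] by simp
  then show ?thesis using assms by (intro divide_pos_pos mult_pos_pos zero_less_power) auto
qed

lemma degree_H_poly: "degree (H_poly p \<theta>) = 4"
  by (simp add: H_poly_def)

section \<open>Signs of the quartic at special points and lower bounds for the largest root\<close>

lemma x0_greater:
  assumes "1 < p" "p \<le> \<theta>" "poly (H_poly p \<theta>) x < 0"
  shows "x < x0 p \<theta>"
proof -
  have "lead_coeff (H_poly p \<theta>) > 0" by (simp add: H_poly_def)
  then obtain b where b: "\<forall>x\<ge>b. poly (H_poly p \<theta>) x \<ge> lead_coeff (H_poly p \<theta>)"
    using poly_pinfty_gt_lc by blast
  then have "poly (H_poly p \<theta>) (max b (x + 1)) > 0"
    using \<open>lead_coeff (H_poly p \<theta>) > 0\<close> by (meson less_le_trans max.cobounded1)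
  then obtain y where y: "x < y" "poly (H_poly p \<theta>) y = 0"
    using poly_IVT_pos[of x "max b (x + 1)" "H_poly p \<theta>"] assms(3) by (auto simp: less_max_iff_disj)
  with x0_largest_root(2)[OF _ _ y(2)] assms show ?thesis by simp
qed

text \<open>If \<^term>\<open>quart\<close> were nonnegative at \<open>s\<close>, it would have five roots: one negative and one in each of
  \<open>(0, 1/2)\<close>, \<open>(1/2, b)\<close>, \<open>(b, s]\<close> and \<open>(s, \<infinity>)\<close>.\<close>

lemma quart_neg_below_x0:
  assumes p: "1 < p" "p \<le> \<theta>" and b: "1/2 < b" "quart p \<theta> b < 0" "b \<le> s"
    and s: "2 * (\<theta> + 1) * s / (p * \<theta> - 1) < x0 p \<theta>"
  shows "quart p \<theta> s < 0"
proof (rule ccontr)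
  assume "\<not> quart p \<theta> s < 0"
  then have qs: "quart p \<theta> s \<ge> 0" by simp
  define c where "c = 2 * (\<theta> + 1) / (p * \<theta> - 1)"
  let ?H = "H_poly p \<theta>"
  have "p * \<theta> > 1" using p less_1_mult[of p \<theta>] by simp
  then have c: "c > 0" using p by (simp add: c_def)
  have H: "poly ?H (c * t) = 16 * (\<theta> + 1)^2 * (p + 1)^2 / (p * \<theta> - 1)^4 * quart p \<theta> t" for t
    using H_poly_quart[OF p, of t] by (simp add: c_def)
  note F = quart_factor_pos[OF p]
  have Hneg: "poly ?H (c * t) < 0 \<longleftrightarrow> quart p \<theta> t < 0" for t unfolding H using F by (metis mult_less_0_iff less_asym)
  have Hpos: "poly ?H (c * t) > 0 \<longleftrightarrow> quart p \<theta> t > 0" for t unfolding H using F by (metis mult_pos_pos zero_less_mult_pos)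
  have H0: "poly ?H (c * 0) < 0" unfolding Hneg using p by (simp add: quart_def)
  have H12: "poly ?H (c * (1/2)) > 0" unfolding Hpos using p by (simp add: quart_def)
  have Hb: "poly ?H (c * b) < 0" unfolding Hneg by (rule b)
  obtain r2 where r2: "c * 0 < r2" "r2 < c * (1/2)" "poly ?H r2 = 0"
    using poly_IVT_pos[OF _ H0 H12] c by auto
  obtain r3 where r3: "c * (1/2) < r3" "r3 < c * b" "poly ?H r3 = 0"
    using poly_IVT_neg[OF _ H12 Hb] c b(1) by (auto simp: mult_less_cancel_left_pos simp del: times_divide_eq_right)
  have "\<exists>r. c * b < r \<and> r \<le> c * s \<and> poly ?H r = 0"
  proof (cases "quart p \<theta> s = 0")
    case True
    moreover from this have "b < s" using b by (cases "b = s") auto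
    ultimately show ?thesis using c by (intro exI[of _ "c * s"]) (simp add: H)
  next
    case False
    then have Hs: "poly ?H (c * s) > 0" unfolding Hpos using qs by simp
    have "b < s" using b False qs by (cases "b = s") auto
    then obtain r where "c * b < r" "r < c * s" "poly ?H r = 0"
      using poly_IVT_pos[OF _ Hb Hs] c by auto
    then show ?thesis by auto
  qed
  then obtain r4 where r4: "c * b < r4" "r4 \<le> c * s" "poly ?H r4 = 0" by auto
  have r5: "c * s < x0 p \<theta>" "poly ?H (x0 p \<theta>) = 0"
    using s x0_largest_root(1)[of p \<theta>] p by (auto simp: c_def)
  have "\<exists>t<0. quart p \<theta> t > 0"
  proof -
    define \<kappa> where "\<kappa> = (\<theta> + 1) / (p + 1)"
    have k: "\<kappa> \<ge> 1" using p by (simp add: \<kappa>_def)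
    \<comment> \<open>Large enough for a crude estimate: at t = 3p\<theta> the product 9 p\<theta>
      \<kappa> t^2 equals 3 \<kappa> t^3, which \<kappa>^2 t^4 dominates because \<kappa> \<ge> 1
      and t \<ge> 3.\<close>
    define t where "t = 3 * p * \<theta>"
    have t: "t \<ge> 3" using \<open>p * \<theta> > 1\<close> by (simp add: t_def)
    have "p * \<theta> * (2 * t + 1) * (2 * \<kappa> * t + 1) \<le> p * \<theta> * (3 * t) * (3 * \<kappa> * t)"
      using t k p mult_mono[OF k, of 1 t] by (intro mult_mono) auto
    also have "\<dots> = 3 * \<kappa> * t^3" by (simp add: t_def power3_eq_cube)
    also have "\<dots> \<le> \<kappa>^2 * t^3 * 3"
      using k t mult_right_mono[of 1 \<kappa> "\<kappa> * t^3"] by (simp add: power2_eq_square algebra_simps)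
    also have "\<dots> \<le> \<kappa>^2 * t^3 * t" using t k by (intro mult_left_mono) auto
    finally have "p * \<theta> * (2 * t + 1) * (2 * \<kappa> * t + 1) \<le> \<kappa>^2 * t^4" by (simp add: power4_eq_xxxx power3_eq_cube algebra_simps)
    moreover have "quart p \<theta> (-t) = \<kappa>^2 * t^4 - p * \<theta> * (2 * t + 1) * (2 * \<kappa> * t + 1)"
      unfolding quart_def \<kappa>_def[symmetric] by algebra
    ultimately have "quart p \<theta> (-t) \<ge> 0" by simp
    show ?thesis
    proof (cases "quart p \<theta> (-t) = 0")
      case False then show ?thesis using \<open>quart p \<theta> (-t) \<ge> 0\<close> t by (intro exI[of _ "-t"]) auto
    next
      \<comment> \<open>Equality at -t is not excluded by the crude estimate; at -2t the same
        estimate is strict.\<close>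
      case True
      have "(4 * t + 1) * (4 * \<kappa> * t + 1) < (6 * t) * (6 * \<kappa> * t)"
        using t k mult_mono[OF k, of 1 t] by (intro mult_strict_mono) auto
      then have "p * \<theta> * ((4 * t + 1) * (4 * \<kappa> * t + 1)) < p * \<theta> * ((6 * t) * (6 * \<kappa> * t))"
        using \<open>p * \<theta> > 1\<close> by (intro mult_strict_left_mono) auto
      then have "p * \<theta> * (4 * t + 1) * (4 * \<kappa> * t + 1) < p * \<theta> * (6 * t) * (6 * \<kappa> * t)"
        by (simp only: mult.assoc)
      also have "p * \<theta> * (6 * t) * (6 * \<kappa> * t) = 12 * \<kappa> * t^3"
        by (simp add: t_def power3_eq_cube algebra_simps)
      also have "\<dots> \<le> \<kappa>^2 * t^3 * 12"
        using k t mult_right_mono[of 1 \<kappa> "\<kappa> * t^3"] by (simp add: power2_eq_square algebra_simps)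
      also have "\<dots> \<le> \<kappa>^2 * t^3 * (16 * t)" using t k by (intro mult_left_mono) auto
      finally have "p * \<theta> * (4 * t + 1) * (4 * \<kappa> * t + 1) < 16 * \<kappa>^2 * t^4"
        by (simp add: power4_eq_xxxx power3_eq_cube algebra_simps)
      moreover have "quart p \<theta> (-(2*t)) = 16 * \<kappa>^2 * t^4 - p * \<theta> * (4 * t + 1) * (4 * \<kappa> * t + 1)"
        unfolding quart_def \<kappa>_def[symmetric] by algebra
      ultimately show ?thesis using t by (intro exI[of _ "-(2*t)"]) auto
    qed
  qed
  then obtain t where t: "t < 0" "quart p \<theta> t > 0" by auto
  then have "poly ?H (c * t) > 0" unfolding Hpos by simp
  then obtain r1 where r1: "r1 < c * 0" "poly ?H r1 = 0"
    using poly_IVT_neg[OF _ _ H0, of "c * t"] t(1) c by (auto simp: mult_pos_neg)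
  have "card {r1, r2, r3, r4, x0 p \<theta>} \<le> card {x. poly ?H x = 0}"
    using r1 r2 r3 r4 r5 by (intro card_mono poly_roots_finite) (auto simp: H_poly_def)
  also have "\<dots> \<le> 4" using card_poly_roots_bound[of ?H] degree_H_poly[of p \<theta>] by (simp add: H_poly_def)
  finally have "card {r1, r2, r3, r4, x0 p \<theta>} \<le> 4" .
  moreover have "r1 < r2" "r2 < r3" "r3 < r4" "r4 < x0 p \<theta>" using r1 r2 r3 r4 r5 by auto
  ultimately show False by (simp add: card_insert_if)
qed

text \<open>In g = p - 4/3 and h = \<theta> - p the difference to be signed has only positive
  coefficients. It has no constant term, so it vanishes at p = \<theta> = 4/3, which is where the
  threshold comes from.\<close>

lemma quart_half_p:
  assumes "4/3 < p" "p \<le> \<theta>" shows "quart p \<theta> (p / 2) < 0"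
proof -
  define g where "g = p - 4/3"
  define h where "h = \<theta> - p"
  have p: "p = g + 4/3" and th: "\<theta> = g + 4/3 + h" by (simp_all add: g_def h_def)
  have g: "g > 0" "h \<ge> 0" using assms by (simp_all add: g_def h_def)
  have "16 * \<theta> * (p^2 - 1) * (p * \<theta> - 1) - p^3 * (\<theta> + 1)^2 > 0"
  proof -
    have "16 * \<theta> * (p^2 - 1) * (p * \<theta> - 1) - p^3 * (\<theta> + 1)^2 = (560/27 * h + 128/9 * h^2 + 1568/27 * g + 1312/9 * g * h + 64 * g * h^2 + 1820/9 * g^2 + 264 * g^2 * h + 60 * g^2 * h^2 + 223 * g^3 + 158 * g^3 * h + 15 * g^3 * h^2 + 98 * g^4 + 30 * g^4 * h + 15 * g^5)"
      unfolding p th by algebra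
    also have "\<dots> > 0" using g by (simp add: add_pos_nonneg add_nonneg_pos)
    finally show ?thesis .
  qed
  then have "p * (p^3 * (\<theta> + 1)^2) < p * (16 * \<theta> * (p^2 - 1) * (p * \<theta> - 1))" using assms by simp
  moreover have "quart p \<theta> (p / 2) = (p * (p^3 * (\<theta> + 1)^2) - p * (16 * \<theta> * (p^2 - 1) * (p * \<theta> - 1))) / (16 * (p + 1)^2)"
  proof -
    have "(\<theta> + 1)^2 * (p/2)^4 - p * \<theta> * (2 * (p/2) - 1) * (2 * (\<theta> + 1) * (p/2) - (p + 1)) * (p + 1)
      = (p * (p^3 * (\<theta> + 1)^2) - p * (16 * \<theta> * (p^2 - 1) * (p * \<theta> - 1))) / 16"
      by (simp add: field_simps power2_eq_square power3_eq_cube power4_eq_xxxx)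
    then show ?thesis using assms quart_eq[of p \<theta> "p/2"] by (simp only: divide_divide_eq_left)
  qed
  ultimately show ?thesis using assms by (simp add: divide_neg_pos)
qed

text \<open>The exponent 1 is admissible for every p > 1, which makes it the start of the bootstrap
  for small p. Shifting to p - 1 and \<theta> - p again leaves positive coefficients only.\<close>

lemma quart_one:
  assumes "1 < p" "p \<le> \<theta>" shows "quart p \<theta> 1 < 0"
proof -
  define g where "g = p - 1"
  define h where "h = \<theta> - p"
  have p: "p = g + 1" and th: "\<theta> = g + 1 + h" by (simp_all add: g_def h_def)
  have g: "g > 0" "h \<ge> 0" using assms by (simp_all add: g_def h_def)
  have "p * \<theta> * (p + 1) * (2 * \<theta> + 1 - p) - (\<theta> + 1)^2 > 0"
  proof -
    have "p * \<theta> * (p + 1) * (2 * \<theta> + 1 - p) - (\<theta> + 1)^2 = (4 * h + 3 * h^2 + 8 * g + 16 * g * h + 6 * g * h^2 + 12 * g^2 + 13 * g^2 * h + 2 * g^2 * h^2 + 6 * g^3 + 3 * g^3 * h + 1 * g^4)"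
      unfolding p th by algebra
    also have "\<dots> > 0" using g by (simp add: add_pos_nonneg add_nonneg_pos)
    finally show ?thesis .
  qed
  moreover have "quart p \<theta> 1 = ((\<theta> + 1)^2 - p * \<theta> * (p + 1) * (2 * \<theta> + 1 - p)) / (p + 1)^2"
  proof -
    have "(\<theta> + 1)^2 * 1^4 - p * \<theta> * (2 * 1 - 1) * (2 * (\<theta> + 1) * 1 - (p + 1)) * (p + 1)
      = (\<theta> + 1)^2 - p * \<theta> * (p + 1) * (2 * \<theta> + 1 - p)" by (simp add: algebra_simps)
    then show ?thesis using assms quart_eq[of p \<theta> 1] by simp
  qed
  ultimately show ?thesis using assms by (simp add: divide_neg_pos)
qed

text \<open>The number 4 turns 2 + (2 + \<alpha>)x into 10 + 4\<alpha>. At p = \<theta> = 4/3 it is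
  itself a root of H: the expansion in p - 4/3 and \<theta> - p has no constant term.\<close>

lemma x0_greater_4:
  assumes "4/3 < p" "p \<le> \<theta>" shows "4 < x0 p \<theta>"
proof (rule x0_greater)
  show "1 < p" "p \<le> \<theta>" using assms by auto
  define D where "D = p * \<theta> - 1"
  have "p * \<theta> > 1" using assms less_1_mult[of p \<theta>] by simp
  then have D: "D > 0" by (simp add: D_def)
  define g where "g = p - 4/3"
  define h where "h = \<theta> - p"
  have p: "p = g + 4/3" and th: "\<theta> = g + 4/3 + h" by (simp_all add: g_def h_def)
  have g: "g > 0" "h \<ge> 0" using assms by (simp_all add: g_def h_def)
  have "p * \<theta> * (\<theta> + 1) * (p + 1) * (4 * D - \<theta> - 1) * (4 * D - p - 1) - 16 * D^4 > 0"
  proof -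
    have "p * \<theta> * (\<theta> + 1) * (p + 1) * (4 * D - \<theta> - 1) * (4 * D - p - 1) - 16 * D^4 = (9604/243 * h + 16856/81 * h^2 + 4564/27 * h^3 + 64/3 * h^4 + 19208/243 * g + 7889/9 * g * h + 37058/27 * g * h^2 + 5069/9 * g * h^3 + 160/3 * g * h^4 + 7889/9 * g^2 + 9310/3 * g^2 * h + 7873/3 * g^2 * h^2 + 670 * g^2 * h^3 + 44 * g^2 * h^4 + 18620/9 * g^3 + 37100/9 * g^3 * h + 6440/3 * g^3 * h^2 + 337 * g^3 * h^3 + 12 * g^3 * h^4 + 18550/9 * g^4 + 2550 * g^4 * h + 791 * g^4 * h^2 + 60 * g^4 * h^3 + 1020 * g^5 + 747 * g^5 * h + 108 * g^5 * h^2 + 249 * g^6 + 84 * g^6 * h + 24 * g^7)"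
      unfolding D_def p th by algebra
    also have "\<dots> > 0" using g by (simp add: add_pos_nonneg add_nonneg_pos)
    finally show ?thesis .
  qed
  moreover have "poly (H_poly p \<theta>) 4 =
      16 * (16 * D^4 - p * \<theta> * (\<theta> + 1) * (p + 1) * (4 * D - \<theta> - 1) * (4 * D - p - 1)) / D^4"
    unfolding H_poly_def D_def[symmetric] using D by (simp add: field_simps power2_eq_square power3_eq_cube power4_eq_xxxx)
  ultimately show "poly (H_poly p \<theta>) 4 < 0" using D
    by (simp only: sixteen_diff_divide_neg zero_less_power)
qed

text \<open>The value 4/p is chosen so that the first summand p/2 of the bracket alone gives the
  product 2. The condition on \<theta> reads p\<theta> \<ge> p + 2.\<close>

lemma x0_greater_4_div:
  assumes "1 < p" "p \<le> 4/3" "1 + 2 / p \<le> \<theta>" shows "4 / p < x0 p \<theta>"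
proof (rule x0_greater)
  show "1 < p" using assms by simp
  have "3 / 2 \<le> 2 / p" using assms by (simp add: field_simps)
  then show "p \<le> \<theta>" using assms by simp
  define D where "D = p * \<theta> - 1"
  define g where "g = p - 1"
  \<comment> \<open>The slack in p\<theta> \<ge> p + 2; eliminating \<theta> in favour of
    \<open>k\<close> leaves polynomials in p and \<open>k\<close>.\<close>
  define k where "k = p * \<theta> - (p + 2)"
  have k: "k \<ge> 0" using assms by (simp add: k_def field_simps)
  have p: "p = g + 1" by (simp add: g_def)
  have th: "p * \<theta> = p + 2 + k" and D: "D = p + 1 + k" by (simp_all add: D_def k_def)
  have D0: "D > 0" using k assms by (simp add: D)
  have g: "g > 0" "g \<le> 1/3" using assms by (simp_all add: g_def)
  have "p * (p + 2 + k) * (2 * p + 2 + k) * (p + 1) * (2 * p + 2 + 3 * k) * (4 + 3 * p - p * p + 4 * k) - 16 * (p + 1 + k)^4 > 0"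
  proof -
    have "p * (p + 2 + k) * (2 * p + 2 + k) * (p + 1) * (2 * p + 2 + 3 * k) * (4 + 3 * p - p * p + 4 * k) - 16 * (p + 1 + k)^4
      = (320 + 640 * k + 428 * k^2 + 108 * k^3 + 8 * k^4 + 1216 * g + 2272 * g * k + 1464 * g * k^2 + 384 * g * k^3 + 36 * g * k^4 + 1568 * g^2 + 2512 * g^2 * k + 1323 * g^2 * k^2 + 253 * g^2 * k^3 + 12 * g^2 * k^4 + 832 * g^3 + 1064 * g^3 * k + 395 * g^3 * k^2 + 38 * g^3 * k^3 + 84 * g^4 + 68 * g^4 * k + 1 * g^4 * k^2) - g^4 * (92 * g + 64 * g * k + 11 * g * k^2 + 36 * g^2 + 12 * g^2 * k + 4 * g^3 + 3 * k^3)"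
      unfolding p by algebra
    \<comment> \<open>The negative terms carry g^4. As g \<le> 1 they are dominated by g^3 times a
      cubic in k, which the g^3 terms of the positive part absorb coefficient by
      coefficient.\<close>
    moreover have "g^4 * (92 * g + 64 * g * k + 11 * g * k^2 + 36 * g^2 + 12 * g^2 * k + 4 * g^3 + 3 * k^3)
       \<le> g^3 * (92 + 64 * k + 11 * k^2 + 36 + 12 * k + 4 + 3 * k^3)"
    proof -
      have "g * k \<le> 1 * k" "g * k^2 \<le> 1 * k^2" "g^2 * k \<le> 1 * k" "g^2 \<le> 1" "g^3 \<le> 1" "g \<le> 1"
        using g k mult_right_mono[of g 1 k] mult_right_mono[of g 1 "k^2"] mult_right_mono[of "g^2" 1 k]
          power_le_one[of g] by auto
      then have "92 * g + 64 * g * k + 11 * g * k^2 + 36 * g^2 + 12 * g^2 * k + 4 * g^3 + 3 * k^3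
        \<le> 92 + 64 * k + 11 * k^2 + 36 + 12 * k + 4 + 3 * k^3" by (simp add: mult.assoc)
      moreover have "g^4 \<le> g^3" using g by (intro power_decreasing) auto
      ultimately show ?thesis using g k by (intro mult_mono) (auto intro!: add_nonneg_nonneg)
    qed
    moreover have "(320 + 640 * k + 428 * k^2 + 108 * k^3 + 8 * k^4 + 1216 * g + 2272 * g * k + 1464 * g * k^2 + 384 * g * k^3 + 36 * g * k^4 + 1568 * g^2 + 2512 * g^2 * k + 1323 * g^2 * k^2 + 253 * g^2 * k^3 + 12 * g^2 * k^4 + 832 * g^3 + 1064 * g^3 * k + 395 * g^3 * k^2 + 38 * g^3 * k^3 + 84 * g^4 + 68 * g^4 * k + 1 * g^4 * k^2) > g^3 * (92 + 64 * k + 11 * k^2 + 36 + 12 * k + 4 + 3 * k^3)"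
    proof -
      have "(320 + 640 * k + 428 * k^2 + 108 * k^3 + 8 * k^4 + 1216 * g + 2272 * g * k + 1464 * g * k^2 + 384 * g * k^3 + 36 * g * k^4 + 1568 * g^2 + 2512 * g^2 * k + 1323 * g^2 * k^2 + 253 * g^2 * k^3 + 12 * g^2 * k^4 + 832 * g^3 + 1064 * g^3 * k + 395 * g^3 * k^2 + 38 * g^3 * k^3 + 84 * g^4 + 68 * g^4 * k + 1 * g^4 * k^2) - g^3 * (92 + 64 * k + 11 * k^2 + 36 + 12 * k + 4 + 3 * k^3) = (320 + 640 * k + 428 * k^2 + 108 * k^3 + 8 * k^4 + 1216 * g + 2272 * g * k + 1464 * g * k^2 + 384 * g * k^3 + 36 * g * k^4 + 1568 * g^2 + 2512 * g^2 * k + 1323 * g^2 * k^2 + 253 * g^2 * k^3 + 12 * g^2 * k^4 + 700 * g^3 + 988 * g^3 * k + 384 * g^3 * k^2 + 35 * g^3 * k^3 + 84 * g^4 + 68 * g^4 * k + 1 * g^4 * k^2)" by algebra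
      also have "\<dots> > 0" using g k by (simp add: add_pos_nonneg add_nonneg_pos)
      finally show ?thesis by simp
    qed
    ultimately show ?thesis by linarith
  qed
  note pos = this
  have e: "poly (H_poly p \<theta>) (4 / p) =
      16 * (16 * D^4 - p * (p * \<theta>) * (p * \<theta> + p) * (p + 1) * (4 * D - p * \<theta> - p) * (4 * D - p * p - p)) / (p^4 * D^4)"
    unfolding H_poly_def D_def[symmetric] using D0 assms(1)
    by (simp add: field_simps power2_eq_square power3_eq_cube power4_eq_xxxx)
  have r: "4 * D - p * \<theta> - p = 2 * p + 2 + 3 * k" "4 * D - p * p - p = 4 + 3 * p - p * p + 4 * k" "p * \<theta> + p = 2 * p + 2 + k"
    unfolding th D by simp_all
  show "poly (H_poly p \<theta>) (4 / p) < 0"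
    unfolding e unfolding r unfolding th unfolding D
    by (rule sixteen_diff_divide_neg[OF pos]) (use D0 assms(1) in \<open>auto simp: D\<close>)
qed

text \<open>Both cases estimate the second summand of the bracket by 0. For \<theta> \<ge> 1 + 2/p
  the root exceeds 4/p; otherwise 2(p\<theta> - 1) < p(\<theta> + 1), and the point 2(\<theta> +
  1)/(p\<theta> - 1) belonging to s = 1, which lies below the root, is already large enough.\<close>

lemma bracket_x0:
  assumes "1 < p" "p \<le> 4/3" "p \<le> \<theta>"
  shows "2 < (p / 2 + (2 - p) * (p * \<theta> - 1) / ((\<theta> + p - 2) * (\<theta> + 1))) * x0 p \<theta>"
proof -
  define D where "D = p * \<theta> - 1"
  have "p * \<theta> > 1" using assms less_1_mult[of p \<theta>] by simp
  then have D: "D > 0" by (simp add: D_def)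
  define e where "e = (2 - p) * D / ((\<theta> + p - 2) * (\<theta> + 1))"
  have e: "e \<ge> 0" using assms D by (simp add: e_def)
  show ?thesis unfolding D_def[symmetric] e_def[symmetric]
  proof (cases "1 + 2 / p \<le> \<theta>")
    case True
    have "2 \<le> (p / 2 + e) * (4 / p)" using assms e by (simp add: field_simps)
    also have "\<dots> < (p / 2 + e) * x0 p \<theta>"
      using x0_greater_4_div[OF assms(1,2) True] assms e by (intro mult_strict_left_mono) auto
    finally show "2 < (p / 2 + e) * x0 p \<theta>" .
  next
    case False
    then have "p * \<theta> < p + 2" using assms by (simp add: field_simps)
    then have "2 * D < p * (\<theta> + 1)" by (simp add: D_def algebra_simps)
    then have "2 < (p / 2) * (2 * (\<theta> + 1) / D)" using D by (simp add: field_simps)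
    also have "\<dots> \<le> (p / 2 + e) * (2 * (\<theta> + 1) / D)" using e D assms by (intro mult_right_mono) auto
    also have "\<dots> < (p / 2 + e) * x0 p \<theta>"
    proof (rule mult_strict_left_mono)
      have "poly (H_poly p \<theta>) (2 * (\<theta> + 1) * 1 / D) < 0"
        unfolding D_def H_poly_quart[OF assms(1,3)]
        using quart_factor_pos[OF assms(1,3)] quart_one[OF assms(1,3)] by (rule mult_pos_neg)
      then show "2 * (\<theta> + 1) / D < x0 p \<theta>" using x0_greater[OF assms(1,3)] by simp
    qed (use assms e in auto)
    finally show "2 < (p / 2 + e) * x0 p \<theta>" .
  qed
qed

subsection \<open>A Sobolev inequality with a small gain\<close>

text \<open>Since the i-th derivative of x_i f^2 integrates to 0, the integral of f^2 equals minus
  that of 2 x_i f times the i-th derivative of f. On the support the coordinate is at most 2 in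
  absolute value, and Young's inequality with weights 1/2 and 8 yields the factor 16.\<close>

lemma poincare:
  fixes f :: "real^'n::finite \<Rightarrow> real"
  assumes f: "has_grad f g" and supp: "\<And>x. 2 < norm x \<Longrightarrow> f x = 0"
  shows "(\<integral>x. (f x)^2 \<partial>lborel) \<le> 16 * (\<integral>x. (norm (g x))^2 \<partial>lborel)"
proof -
  obtain i :: 'n where True by simp
  have cf: "cc f" using supp by (intro ccI has_grad_continuous[OF f]) auto
  have cg: "cc g" by (rule cc_grad[OF cf f])
  have xi: "has_grad (\<lambda>x::real^'n. x $ i) (\<lambda>x. axis i 1)"
    by (rule has_gradI[OF bounded_linear.has_derivative[OF bounded_linear_vec_nth has_derivative_ident]])
      (simp_all add: inner_axis inner_commute)
  note h = has_grad_mult[OF has_grad_mult[OF f f] xi]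
  have ct: "continuous_on UNIV f" "continuous_on UNIV g" "continuous_on UNIV (\<lambda>x. g x $ i)"
    "continuous_on UNIV (\<lambda>x::real^'n. x $ i)"
    using has_grad_continuous[OF f] has_grad_continuous_grad[OF f] has_grad_continuous[OF xi]
      continuous_on_component by blast+
  have c2: "cc (\<lambda>x. f x * f x)" by (rule cc_mult[OF cf ct(1)])
  have c3: "cc (\<lambda>x. 2 * (x $ i * f x * g x $ i))"
    by (intro cc_cmult cc_mult[OF cc_mult2[OF cf ct(4)] ct(3)])
  have c4: "cc (\<lambda>x. (norm (g x))^2)" by (rule cc_norm_power[OF cg]) simp
  have "cc (\<lambda>x. (f x * f x) * x $ i)" by (rule cc_mult[OF c2 ct(4)])
  from integral_grad_zero[OF this h, of i]
  have "(\<integral>x. f x * f x + 2 * (x $ i * f x * g x $ i) \<partial>lborel) = 0"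
    by (simp add: algebra_simps)
  then have "(\<integral>x. f x * f x \<partial>lborel) + (\<integral>x. 2 * (x $ i * f x * g x $ i) \<partial>lborel) = 0"
    using Bochner_Integration.integral_add[OF cc_integrable[OF c2] cc_integrable[OF c3]] by simp
  moreover have "(\<integral>x. - (1/2) * (f x * f x) + (-8) * (norm (g x))^2 \<partial>lborel) \<le> (\<integral>x. 2 * (x $ i * f x * g x $ i) \<partial>lborel)"
  proof (rule cc_integral_mono[OF _ c3])
    show "cc (\<lambda>x. - (1/2) * (f x * f x) + (-8) * (norm (g x))^2)"
      by (intro cc_add cc_cmult c2 c4)
    fix x
    have "\<bar>x $ i * f x * g x $ i\<bar> \<le> 2 * \<bar>f x\<bar> * norm (g x)"
    proof (cases "2 < norm x")
      case False
      then have "\<bar>x $ i\<bar> \<le> 2" using component_le_norm_cart[of x i] by simp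
      then show ?thesis unfolding abs_mult
        using component_le_norm_cart[of "g x" i] by (intro mult_mono) auto
    qed (simp add: supp)
    moreover have "4 * \<bar>f x\<bar> * norm (g x) \<le> 1/2 * (f x * f x) + 8 * (norm (g x))^2"
      using zero_le_power2[of "\<bar>f x\<bar> - 4 * norm (g x)"] by (simp add: power2_eq_square algebra_simps)
    ultimately show "- (1/2) * (f x * f x) + (-8) * (norm (g x))^2 \<le> 2 * (x $ i * f x * g x $ i)" by linarith
  qed
  ultimately show ?thesis
    using cc_integrable[OF c2] cc_integrable[OF c4] by (simp add: power2_eq_square)
qed

text \<open>Splitting the shift into n + 1 equal steps and using Cauchy-Schwarz bounds the integral
  for y by (n + 1)^2 times that for y/(n + 1), which tends to the integral of the squared
  directional derivative.\<close>

lemma shift_difference_square: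
  fixes f :: "real^'n::finite \<Rightarrow> real"
  assumes cf: "cc f" and f: "has_grad f g"
  shows "(\<integral>x. (f x - f (x + y))^2 \<partial>lborel) \<le> (norm y)^2 * (\<integral>x. (norm (g x))^2 \<partial>lborel)"
proof -
  define t where "t n = inverse (real (Suc n))" for n
  have t: "0 < t n" "t n \<le> 1" for n by (auto simp: t_def field_simps)
  have cg: "cc g" by (rule cc_grad[OF cf f])
  have sh: "cc (\<lambda>x. f (x + z))" for z using cc_affine[OF cf, of 1 z] by (simp add: add.commute)
  have cd: "cc (\<lambda>x. f (x + z) - f x)" for z by (rule cc_diff[OF sh cf])
  have cd2: "cc (\<lambda>x. (f (x + z) - f x)^2)" for z using cc_norm_power[OF cd, of 2] by simp
  define D where "D z = (\<integral>x. (f (x + z) - f x)^2 \<partial>lborel)" for z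
  have le: "D y \<le> (real (Suc n))^2 * D (t n *\<^sub>R y)" for n
  proof -
    define \<delta> where "\<delta> k x = f (x + real (Suc k) *\<^sub>R t n *\<^sub>R y) - f (x + real k *\<^sub>R t n *\<^sub>R y)" for k x
    have e: "\<delta> k x = f (x + real k *\<^sub>R t n *\<^sub>R y + t n *\<^sub>R y) - f (x + real k *\<^sub>R t n *\<^sub>R y)" for k x
      by (simp add: \<delta>_def algebra_simps)
    have c: "cc (\<lambda>x. (\<delta> k x)^2)" for k
      using cc_affine[OF cd2, of 1 "real k *\<^sub>R t n *\<^sub>R y" "t n *\<^sub>R y"] by (simp add: e add.commute)
    have i: "(\<integral>x. (\<delta> k x)^2 \<partial>lborel) = D (t n *\<^sub>R y)" for k
      using cc_integral_affine[OF _ cd2, of 1 "real k *\<^sub>R t n *\<^sub>R y" "t n *\<^sub>R y"]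
      by (simp add: e D_def add.commute)
    have sumd: "(\<Sum>k<Suc n. \<delta> k x) = f (x + y) - f x" for x
    proof -
      have "(\<Sum>k<Suc n. \<delta> k x) = f (x + real (Suc n) *\<^sub>R t n *\<^sub>R y) - f (x + real 0 *\<^sub>R t n *\<^sub>R y)"
        unfolding \<delta>_def by (rule sum_lessThan_telescope)
      also have "real (Suc n) *\<^sub>R t n *\<^sub>R y = y" unfolding t_def by (simp del: of_nat_Suc)
      finally show ?thesis by simp
    qed
    have "D y \<le> (\<integral>x. (\<Sum>k<Suc n. real (Suc n) * (\<delta> k x)^2) \<partial>lborel)"
      unfolding D_def
    proof (rule integral_mono)
      show "integrable lborel (\<lambda>x. (f (x + y) - f x)\<^sup>2)" by (rule cc_integrable[OF cd2])
      show "integrable lborel (\<lambda>x. \<Sum>k<Suc n. real (Suc n) * (\<delta> k x)\<^sup>2)"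
        by (intro Bochner_Integration.integrable_sum integrable_mult_right cc_integrable[OF c])
      fix x
      show "(f (x + y) - f x)\<^sup>2 \<le> (\<Sum>k<Suc n. real (Suc n) * (\<delta> k x)\<^sup>2)"
        using sum_squared_le_sum_of_squares[of "\<lambda>k. \<delta> k x" "{..<Suc n}"]
        unfolding sumd by (simp add: sum_distrib_left mult.commute del: sum.lessThan_Suc of_nat_Suc)
    qed
    also have "\<dots> = (\<Sum>k<Suc n. real (Suc n) * D (t n *\<^sub>R y))"
      using c by (subst Bochner_Integration.integral_sum) (auto intro!: integrable_mult_right cc_integrable simp: i)
    finally show ?thesis by (simp add: power2_eq_square)
  qed
  define Q where "Q n x = (f (x + inverse (real (Suc n)) *\<^sub>R y) - f x) / inverse (real (Suc n))" for n x
  define F where "F n x = (Q n x)^2" for n x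
  note DQ = difference_quotient[OF cf f, where y=y, folded Q_def]
  obtain B M where bd: "\<And>n x. \<bar>Q n x\<bar> \<le> indicator (cball 0 B) x * M" using DQ(3) by blast
  have F: "(real (Suc n))^2 * D (t n *\<^sub>R y) = (\<integral>x. F n x \<partial>lborel)" for n
    unfolding F_def Q_def D_def by (simp add: power_divide t_def power_mult_distrib divide_inverse mult.commute)
  have lim: "(\<lambda>n. F n x) \<longlonglongrightarrow> (g x \<bullet> y)^2" for x
    unfolding F_def by (rule tendsto_power[OF DQ(2)])
  have bd2: "norm (F n x) \<le> indicator (cball 0 B) x * M^2" for n x
    using power_mono[OF bd[of n x], of 2] by (auto simp: F_def indicator_def)
  have cF: "cc (F n)" for n
  proof -
    have "cc (\<lambda>x. (norm (Q n x))^2)" by (rule cc_norm_power[OF DQ(1)]) simp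
    then show ?thesis by (simp add: F_def[abs_def])
  qed
  have ci: "cc (\<lambda>x. (g x \<bullet> y)^2)"
    by (rule cc_mono_support[OF cg]) (auto intro!: continuous_intros cc_continuous[OF cg])
  have "(\<lambda>n. \<integral>x. F n x \<partial>lborel) \<longlonglongrightarrow> (\<integral>x. (g x \<bullet> y)^2 \<partial>lborel)"
  proof (rule integral_dominated_convergence[where w="\<lambda>x. indicator (cball 0 B) x * M^2"])
    show "(\<lambda>x. (g x \<bullet> y)\<^sup>2) \<in> borel_measurable lborel" using cc_measurable[OF ci] by simp
    show "F n \<in> borel_measurable lborel" for n using cc_measurable[OF cF] by simp
    show "integrable lborel (\<lambda>x::real^'n. indicator (cball 0 B) x * M^2)" by (rule integrable_indicator_cball_mult)
  qed (use lim bd2 in auto)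
  then have "D y \<le> (\<integral>x. (g x \<bullet> y)^2 \<partial>lborel)"
    by (rule LIMSEQ_le_const) (use le F in auto)
  also have "\<dots> \<le> (\<integral>x. (norm y)^2 * (norm (g x))^2 \<partial>lborel)"
  proof (rule cc_integral_mono[OF ci])
    show "cc (\<lambda>x. (norm y)^2 * (norm (g x))^2)" by (intro cc_cmult cc_norm_power[OF cg]) simp
    show "(g x \<bullet> y)\<^sup>2 \<le> (norm y)\<^sup>2 * (norm (g x))\<^sup>2" for x
      using Cauchy_Schwarz_ineq[of "g x" y] by (simp add: power2_norm_eq_inner mult.commute)
  qed
  finally show ?thesis unfolding D_def by (simp add: power2_commute)
qed

text \<open>The quantity behind the gain of integrability: f(x)^2 is at most twice it plus twice the
  integral of f^2 over the volume of the ball, while its own integral is at most t^2 times the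
  Dirichlet integral. Small t favours the second bound, large t the first.\<close>

definition avg_sq_diff :: "(real^'n::finite \<Rightarrow> real) \<Rightarrow> real \<Rightarrow> real^'n \<Rightarrow> real" where
  "avg_sq_diff f t x = (\<integral>y. indicator (cball 0 t) y * (f x - f (x + y))^2 \<partial>lborel) / measure lborel (cball (0::real^'n) t)"

lemma avg_sq_diff_nonneg: "0 \<le> avg_sq_diff f t x"
  unfolding avg_sq_diff_def by (intro divide_nonneg_nonneg Bochner_Integration.integral_nonneg) auto

lemma square_le_avg_sq_diff:
  fixes f :: "real^'n::finite \<Rightarrow> real"
  assumes cf: "cc f" and t: "t > 0"
  shows "(f x)^2 \<le> 2 * avg_sq_diff f t x + 2 * (\<integral>x. (f x)^2 \<partial>lborel) / measure lborel (cball (0::real^'n) t)"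
proof -
  let ?V = "measure lborel (cball (0::real^'n) t)"
  let ?I = "\<lambda>y::real^'n. indicator (cball 0 t) y :: real"
  have V: "?V > 0" using content_cball_pos[OF t] by simp
  have ct: "continuous_on UNIV f" by (rule cc_continuous[OF cf])
  have sh: "cc (\<lambda>y. f (x + y))" using cc_affine[OF cf, of 1 x] by simp
  have i1: "integrable lborel (\<lambda>y. ?I y * (f x - f (x + y))^2)"
    using borel_integrable_compact[of "cball 0 t" "\<lambda>y. (f x - f (x + y))^2"]
      continuous_on_subset[OF cc_continuous[OF sh], of "cball 0 t"]
    by (simp add: continuous_intros)
  have i2: "integrable lborel (\<lambda>y. (f (x + y))^2)"
    using cc_integrable[OF cc_norm_power[OF sh, of 2]] by simp
  have i3: "integrable lborel ?I"
    by (intro integrable_real_indicator)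
       (simp_all add: emeasure_bounded_finite[OF bounded_cball, unfolded infinity_ennreal_def])
  have "(f x)^2 * ?V = (\<integral>y. (f x)^2 * ?I y \<partial>lborel)" by simp
  also have "\<dots> \<le> (\<integral>y. 2 * (?I y * (f x - f (x + y))^2) + 2 * (f (x + y))^2 \<partial>lborel)"
  proof (rule integral_mono)
    show "integrable lborel (\<lambda>y. (f x)^2 * ?I y)" using i3 by simp
    show "integrable lborel (\<lambda>y. 2 * (?I y * (f x - f (x + y))^2) + 2 * (f (x + y))^2)" using i1 i2 by simp
    fix y
    have "(f x)^2 \<le> 2 * (f x - f (x + y))^2 + 2 * (f (x + y))^2"
      using zero_le_power2[of "f x - 2 * f (x + y)"] by (simp add: power2_eq_square algebra_simps)
    then show "(f x)^2 * ?I y \<le> 2 * (?I y * (f x - f (x + y))^2) + 2 * (f (x + y))^2"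
      by (cases "y \<in> cball 0 t") (auto simp: indicator_def)
  qed
  also have "\<dots> = 2 * (\<integral>y. ?I y * (f x - f (x + y))^2 \<partial>lborel) + 2 * (\<integral>y. (f (x + y))^2 \<partial>lborel)"
    using i1 i2 by simp
  also have "(\<integral>y. (f (x + y))^2 \<partial>lborel) = (\<integral>x. (f x)^2 \<partial>lborel)"
    using cc_integral_affine[OF _ cc_norm_power[OF cf, of 2], of 1 x] by simp
  finally show ?thesis using V by (simp add: avg_sq_diff_def field_simps)
qed

text \<open>Fubini, and \<open>shift_difference_square\<close> for each y in the ball. The double
  integrand lives on a product of two balls, because |y| \<le> t moves the support of f by at most
  t.\<close>

lemma integral_avg_sq_diff:
  fixes f :: "real^'n::finite \<Rightarrow> real"
  assumes cf: "cc f" and f: "has_grad f g" and t: "t > 0"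
  shows "integrable lborel (avg_sq_diff f t)"
    and "(\<integral>x. avg_sq_diff f t x \<partial>lborel) \<le> t^2 * (\<integral>x. (norm (g x))^2 \<partial>lborel)"
proof -
  let ?V = "measure lborel (cball (0::real^'n) t)"
  let ?I = "\<lambda>y::real^'n. indicator (cball 0 t) y :: real"
  let ?G = "\<integral>x. (norm (g x))^2 \<partial>lborel"
  have V: "?V > 0" using content_cball_pos[OF t] by simp
  obtain B where B: "\<forall>x. B < norm x \<longrightarrow> f x = 0" using cf by (auto simp: cc_def)
  define h where "h = (\<lambda>(x, y). ?I y * (f x - f (x + y))^2)"
  have ct: "continuous_on UNIV f" by (rule cc_continuous[OF cf])
  have "continuous_on UNIV (\<lambda>z::(real^'n) \<times> (real^'n). (f (fst z) - f (fst z + snd z))^2)"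
    by (intro continuous_intros continuous_on_compose2[OF ct]) auto
  then have "integrable lborel (\<lambda>z::(real^'n) \<times> (real^'n). indicator (cball 0 (\<bar>B\<bar> + t) \<times> cball 0 t) z *\<^sub>R (f (fst z) - f (fst z + snd z))^2)"
    by (intro borel_integrable_compact compact_Times) (auto intro: continuous_on_subset)
  moreover have "(\<lambda>z. indicator (cball 0 (\<bar>B\<bar> + t) \<times> cball 0 t) z *\<^sub>R (f (fst z) - f (fst z + snd z))^2) = h"
  proof (rule ext, clarify)
    fix x y :: "real^'n"
    show "indicator (cball 0 (\<bar>B\<bar> + t) \<times> cball 0 t) (x, y) *\<^sub>R (f (fst (x, y)) - f (fst (x, y) + snd (x, y)))^2 = h (x, y)"
    proof (cases "norm y \<le> t \<and> \<not> norm x \<le> \<bar>B\<bar> + t")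
      case True
      have "norm x \<le> norm (x + y) + norm y" using norm_triangle_ineq4[of "x + y" y] by simp
      then have "f x = 0" "f (x + y) = 0" using True B t by auto
      then show ?thesis by (simp add: h_def)
    qed (auto simp: h_def indicator_def)
  qed
  ultimately have hi: "integrable (lborel \<Otimes>\<^sub>M lborel) h" by (simp add: lborel_prod)
  then have hi': "integrable (lborel \<Otimes>\<^sub>M lborel) (case_prod (\<lambda>x y. h (x, y)))" by simp
  have A: "avg_sq_diff f t x = (\<integral>y. h (x, y) \<partial>lborel) / ?V" for x
    by (simp add: avg_sq_diff_def h_def)
  have ih: "integrable lborel (\<lambda>x. \<integral>y. h (x, y) \<partial>lborel)"
    by (rule lborel_pair.integrable_fst[OF hi'])
  then show "integrable lborel (avg_sq_diff f t)" unfolding A[abs_def] by simp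
  have "(\<integral>x. avg_sq_diff f t x \<partial>lborel) = (\<integral>y. (\<integral>x. h (x, y) \<partial>lborel) \<partial>lborel) / ?V"
    unfolding A using ih lborel_pair.Fubini_integral[OF hi'] by simp
  also have "(\<integral>y. (\<integral>x. h (x, y) \<partial>lborel) \<partial>lborel) \<le> (\<integral>y. t^2 * ?G * ?I y \<partial>lborel)"
  proof (rule integral_mono)
    show "integrable lborel (\<lambda>y. \<integral>x. h (x, y) \<partial>lborel)" by (rule lborel_pair.integrable_snd[OF hi'])
    show "integrable lborel (\<lambda>y::real^'n. t^2 * ?G * ?I y)"
      by (intro integrable_mult_right integrable_real_indicator)
        (simp_all add: emeasure_bounded_finite[OF bounded_cball, unfolded infinity_ennreal_def])
    fix y :: "real^'n"
    have G: "?G \<ge> 0" by (intro Bochner_Integration.integral_nonneg) auto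
    show "(\<integral>x. h (x, y) \<partial>lborel) \<le> t^2 * ?G * ?I y"
    proof (cases "norm y \<le> t")
      case True
      then have "(\<integral>x. h (x, y) \<partial>lborel) \<le> (norm y)^2 * ?G"
        using shift_difference_square[OF cf f, of y] by (simp add: h_def)
      also have "\<dots> \<le> t^2 * ?G" using True G by (intro mult_right_mono power_mono) auto
      finally show ?thesis using True by simp
    qed (simp add: h_def)
  qed
  also have "(\<integral>y. t^2 * ?G * ?I y \<partial>lborel) = t^2 * ?G * ?V" by simp
  finally show "(\<integral>x. avg_sq_diff f t x \<partial>lborel) \<le> t^2 * ?G" using V by (simp add: divide_right_mono)
qed


lemma dyadic_interval:
  fixes y :: real
  assumes "2 \<le> y" "y < 2^(J + 1)"
  shows "\<exists>j<J. 2^(j + 1) \<le> y \<and> y < 2^(j + 2)"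
  using assms
proof (induction J)
  case (Suc J)
  show ?case
  proof (cases "y < 2^(J + 1)")
    case True then show ?thesis using Suc less_SucI by blast
  next
    case False then show ?thesis using Suc.prems by (intro exI[of _ J]) auto
  qed
qed auto

text \<open>A point where \<open>2^(j + 1) \<le> \<bar>f\<bar> < 2^(j + 2)\<close> is charged to the mean square difference of \<open>f\<close> over balls so
  small that the mean square of \<open>f\<close> itself contributes at most half of \<open>f\<^sup>2\<close>; the resulting series over
  \<open>j\<close> is geometric.\<close>

lemma nash_unit:
  "\<exists>C>0. \<forall>(f::real^'n::finite \<Rightarrow> real) g. cc f \<longrightarrow> has_grad f g \<longrightarrow> (\<integral>x. (f x)^2 \<partial>lborel) \<le> 1 \<longrightarrow>
    (\<integral>x. (norm (g x))^2 \<partial>lborel) \<le> 1 \<longrightarrow> (\<integral>x. \<bar>f x\<bar> powr (2 + 2 / real CARD('n)) \<partial>lborel) \<le> C"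
proof -
  define N where "N = CARD('n)"
  have N: "N > 0" by (simp add: N_def)
  \<comment> \<open>Half of the critical gain 4/N. Balls of volume 4^-j have squared radius of order
    2^(-4j/N), so the factor 2^(je) leaves a convergent geometric series for every e < 4/N.\<close>
  define e where "e = 2 / real N"
  have e: "e > 0" using N by (simp add: e_def)
  define \<omega> where "\<omega> = unit_ball_vol (real N)"
  have w: "\<omega> > 0" by (simp add: \<omega>_def)
  have V: "measure lborel (cball (0::real^'n) r) = \<omega> * r^N" if "r \<ge> 0" for r
    using content_cball[OF that, of "0::real^'n"] by (simp add: \<omega>_def N_def)
  \<comment> \<open>The radius of the ball of volume 4^-j.\<close>
  define t where "t j = ((1/4)^j / \<omega>) powr (1 / real N)" for j :: nat
  have t: "t j > 0" for j using w by (simp add: t_def)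
  have tN: "t j ^ N = (1/4)^j / \<omega>" for j
    using N w by (simp add: t_def powr_powr flip: powr_realpow)
  have t2: "(t j)^2 = ((1/4)^j / \<omega>) powr e" for j
    using w by (simp add: t_def powr_powr e_def flip: powr_realpow)
  define q where "q = (1/2::real) powr e"
  have q: "0 < q" "q < 1" using e using powr_less_mono2[of e "1/2" 1] by (auto simp: q_def)
  define K where "K = 4 * (4 / \<omega>) powr e"
  have K: "K > 0" using w by (simp add: K_def)
  define k where "k j = 4 * (2^(j + 2)) powr e" for j :: nat
  have kt: "k j * (t j)^2 = K * q^j" for j
  proof -
    have "(2^(j + 2) :: real) * ((1/4)^j / \<omega>) = 4 / \<omega> * (1/2)^j"
      using power_mult_distrib[of "2::real" 2 j] by (simp add: power_add field_simps)
    then have "(2^(j + 2) * ((1/4)^j / \<omega>)) powr e = (4 / \<omega> * (1/2)^j) powr e" by (simp only:)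
    moreover have "(2^(j + 2) * ((1/4)^j / \<omega>)) powr e = (2^(j + 2)) powr e * ((1/4)^j / \<omega>) powr e"
      by (rule powr_mult)
    ultimately have "(2^(j + 2)) powr e * ((1/4)^j / \<omega>) powr e = (4 / \<omega> * (1/2)^j) powr e" by (simp only:)
    also have "\<dots> = (4 / \<omega>) powr e * ((1/2)^j) powr e" by (rule powr_mult)
    also have "((1/2::real)^j) powr e = q^j"
      using q by (simp add: q_def powr_powr mult.commute flip: powr_realpow)
    finally show ?thesis by (simp add: k_def K_def t2)
  qed
  define C where "C = 2 powr e + K / (1 - q)"
  have "C > 0" using K q by (simp add: C_def add_pos_pos)
  moreover have "(\<integral>x. \<bar>f x\<bar> powr (2 + e) \<partial>lborel) \<le> C"
    if cf: "cc f" and g: "has_grad f g" and F1: "(\<integral>x. (f x)^2 \<partial>lborel) \<le> 1" and G1: "(\<integral>x. (norm (g x))^2 \<partial>lborel) \<le> 1"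
    for f :: "real^'n \<Rightarrow> real" and g
  proof -
    obtain M where M: "\<And>x. \<bar>f x\<bar> \<le> M" using cc_bounded[OF cf] by (metis real_norm_def)
    obtain J where "M < 2^J" using real_arch_pow[of 2 M] by auto
    also have "(2::real)^J \<le> 2^(J + 1)" by (rule power_increasing) auto
    finally have "M < 2^(J + 1)" .
    then have J: "\<bar>f x\<bar> < 2^(J + 1)" for x using M[of x] by simp
    have cp: "cc (\<lambda>x. \<bar>f x\<bar> powr (2 + e))"
      by (rule cc_mono_support[OF cf]) (use e in \<open>auto intro!: continuous_intros continuous_on_powr' cc_continuous[OF cf]\<close>)
    have c2: "cc (\<lambda>x. (f x)^2)" using cc_norm_power[OF cf, of 2] by simp
    note ia = integral_avg_sq_diff[OF cf g t]
    have pw: "\<bar>f x\<bar> powr (2 + e) \<le> 2 powr e * (f x)^2 + (\<Sum>j<J. k j * avg_sq_diff f (t j) x)" for x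
    proof (cases "\<bar>f x\<bar> < 2")
      case True
      have "\<bar>f x\<bar> powr (2 + e) = \<bar>f x\<bar> powr e * (f x)^2" by (simp add: powr_add mult.commute)
      also have "\<dots> \<le> 2 powr e * (f x)^2" using True e by (intro mult_right_mono powr_mono2) auto
      finally show ?thesis using avg_sq_diff_nonneg[of f _ x]
        by (smt (verit) k_def mult_nonneg_nonneg powr_ge_zero sum_nonneg)
    next
      case False
      then obtain j where j: "j < J" "2^(j + 1) \<le> \<bar>f x\<bar>" "\<bar>f x\<bar> < 2^(j + 2)"
        using dyadic_interval[of "\<bar>f x\<bar>" J] J[of x] by auto
      have "(2^(j + 1))^2 \<le> (f x)^2" using power_mono[OF j(2), of 2] by simp
      then have f4: "4 * 4^j \<le> (f x)^2" by (simp add: power2_eq_square power_add flip: power_mult_distrib)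
      have "measure lborel (cball (0::real^'n) (t j)) = (1/4)^j"
        using V[of "t j"] t[of j] w by (simp add: tN)
      then have "2 * (\<integral>x. (f x)^2 \<partial>lborel) / measure lborel (cball (0::real^'n) (t j)) \<le> 2 * 4^j"
        using F1 by (simp add: power_divide)
      then have "(f x)^2 \<le> 4 * avg_sq_diff f (t j) x"
        using square_le_avg_sq_diff[OF cf t, of x j] f4 by linarith
      then have "\<bar>f x\<bar> powr e * (f x)^2 \<le> (2^(j + 2)) powr e * (4 * avg_sq_diff f (t j) x)"
        using j e by (intro mult_mono powr_mono2) auto
      also have "\<dots> = k j * avg_sq_diff f (t j) x" by (simp add: k_def)
      also have "\<dots> \<le> (\<Sum>j<J. k j * avg_sq_diff f (t j) x)"
        using j(1) by (intro member_le_sum) (auto simp: k_def avg_sq_diff_nonneg)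
      finally show ?thesis by (simp add: powr_add mult.commute add_increasing)
    qed
    have "(\<integral>x. \<bar>f x\<bar> powr (2 + e) \<partial>lborel) \<le> (\<integral>x. 2 powr e * (f x)^2 + (\<Sum>j<J. k j * avg_sq_diff f (t j) x) \<partial>lborel)"
      using pw by (intro integral_mono cc_integrable[OF cp] Bochner_Integration.integrable_add
          Bochner_Integration.integrable_sum integrable_mult_right cc_integrable[OF c2] ia(1))
    also have "\<dots> = 2 powr e * (\<integral>x. (f x)^2 \<partial>lborel) + (\<Sum>j<J. k j * (\<integral>x. avg_sq_diff f (t j) x \<partial>lborel))"
      using ia(1) cc_integrable[OF c2]
      by (subst Bochner_Integration.integral_add) (auto simp: Bochner_Integration.integral_sum)
    also have "\<dots> \<le> 2 powr e * 1 + (\<Sum>j<J. K * q^j)"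
    proof (intro add_mono mult_left_mono sum_mono F1)
      fix j
      have "k j * (\<integral>x. avg_sq_diff f (t j) x \<partial>lborel) \<le> k j * ((t j)^2 * 1)"
        using ia(2)[of j] mult_left_mono[OF G1, of "(t j)^2"] by (intro mult_left_mono) (auto simp: k_def)
      then show "k j * (\<integral>x. avg_sq_diff f (t j) x \<partial>lborel) \<le> K * q^j" by (simp add: kt)
    qed auto
    also have "(\<Sum>j<J. K * q^j) \<le> K / (1 - q)"
    proof -
      have "(\<Sum>j<J. q^j) = (1 - q^J) / (1 - q)" using q by (simp add: sum_gp_strict)
      also have "\<dots> \<le> 1 / (1 - q)" using q by (intro divide_right_mono) auto
      finally show ?thesis using K by (simp add: sum_distrib_left[symmetric] mult_left_mono[of _ "1/(1-q)" K, simplified])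
    qed
    finally show ?thesis by (simp add: C_def)
  qed
  ultimately show ?thesis unfolding e_def N_def by blast
qed

text \<open>The normalized bound applied to c f. The Poincare inequality controls the L2 norm by the
  gradient, so c = 1/sqrt(16 M) normalizes both at once; this is why the support is confined to the
  ball of radius 2.\<close>

lemma sobolev_gain:
  "\<exists>C>0. \<forall>(f::real^'n::finite \<Rightarrow> real) g M. has_grad f g \<longrightarrow> (\<forall>x. 2 < norm x \<longrightarrow> f x = 0) \<longrightarrow> M > 0 \<longrightarrow>
    (\<integral>x. (norm (g x))^2 \<partial>lborel) \<le> M \<longrightarrow>
    (\<integral>x. \<bar>f x\<bar> powr (2 + 2 / real CARD('n)) \<partial>lborel) \<le> C * M powr (1 + 1 / real CARD('n))"
proof -
  obtain C where C: "C > 0" "\<And>(f::real^'n \<Rightarrow> real) g. cc f \<Longrightarrow> has_grad f g \<Longrightarrow> (\<integral>x. (f x)^2 \<partial>lborel) \<le> 1 \<Longrightarrow>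
    (\<integral>x. (norm (g x))^2 \<partial>lborel) \<le> 1 \<Longrightarrow> (\<integral>x. \<bar>f x\<bar> powr (2 + 2 / real CARD('n)) \<partial>lborel) \<le> C"
    using nash_unit by blast
  define k where "k = 1 + 1 / real CARD('n)"
  have k2: "2 + 2 / real CARD('n) = 2 * k" by (simp add: k_def)
  have "(\<integral>x. \<bar>f x\<bar> powr (2 * k) \<partial>lborel) \<le> C * 16 powr k * M powr k"
    if g: "has_grad f g" and s: "\<forall>x. 2 < norm x \<longrightarrow> f x = 0" and M: "M > 0" and G: "(\<integral>x. (norm (g x))^2 \<partial>lborel) \<le> M"
    for f :: "real^'n \<Rightarrow> real" and g M
  proof -
    define c where "c = 1 / sqrt (16 * M)"
    have c: "c > 0" "c^2 = 1 / (16 * M)" using M by (auto simp: c_def power_divide)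
    have cf: "cc f" using s by (intro ccI[OF has_grad_continuous[OF g]]) auto
    have "(\<integral>x. (f x)^2 \<partial>lborel) \<le> 16 * M" using poincare[OF g] s G by force
    then have 1: "(\<integral>x. (c * f x)^2 \<partial>lborel) \<le> 1" using M by (simp add: power_mult_distrib c)
    have 2: "(\<integral>x. (norm (c *\<^sub>R g x))^2 \<partial>lborel) \<le> 1" using M G by (simp add: power_mult_distrib c)
    have "(\<integral>x. \<bar>c * f x\<bar> powr (2 * k) \<partial>lborel) \<le> C"
      using C(2)[OF cc_cmult[OF cf] has_grad_cmult[OF g] 1 2] by (simp add: k2)
    moreover have "\<bar>c * f x\<bar> powr (2 * k) = c powr (2 * k) * \<bar>f x\<bar> powr (2 * k)" for x
      using c by (simp add: abs_mult powr_mult)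
    moreover have "c powr (2 * k) = 1 / (16 powr k * M powr k)"
    proof -
      have "c powr (2 * k) = (c powr 2) powr k" by (simp add: powr_powr)
      also have "c powr 2 = 1 / (16 * M)" using c by (simp add: powr_numeral)
      finally show ?thesis using M by (simp add: powr_divide powr_mult)
    qed
    ultimately have "1 / (16 powr k * M powr k) * (\<integral>x. \<bar>f x\<bar> powr (2 * k) \<partial>lborel) \<le> C" by simp
    then have "(16 powr k * M powr k) * (1 / (16 powr k * M powr k) * (\<integral>x. \<bar>f x\<bar> powr (2 * k) \<partial>lborel)) \<le> (16 powr k * M powr k) * C"
      by (rule mult_left_mono) simp
    then show ?thesis using M by (simp add: mult_ac)
  qed
  then show ?thesis using C(1) unfolding k2 k_def[symmetric]
    by (intro exI[of _ "C * 16 powr k"]) auto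
qed

subsection \<open>The mean value inequality for subharmonic functions\<close>

text \<open>Powers of the positive part serve as truncations throughout: the square is C1, the cube
  and the fourth power are C2.\<close>

lemma DERIV_max0_power:
  "((\<lambda>s::real. (max 0 s)^(n + 2)) has_real_derivative real (n + 2) * (max 0 s)^(n + 1)) (at s)"
proof (cases s "0::real" rule: linorder_cases)
  case less
  have "((\<lambda>s::real. 0) has_real_derivative 0) (at s)" by simp
  then show ?thesis
    by (rule has_field_derivative_transform_within_open[where S="{..<0}", THEN DERIV_cong]) (use less in auto)
next
  case greater
  have "((\<lambda>s::real. s^(n + 2)) has_real_derivative real (n + 2) * s^(n + 1)) (at s)"
    using DERIV_pow[of "n + 2" s] by simp
  then show ?thesis
    by (rule has_field_derivative_transform_within_open[where S="{0<..}", THEN DERIV_cong]) (use greater in auto)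
next
  case equal
  have "((\<lambda>h. (max 0 h)^(n + 2) / h) \<longlongrightarrow> 0) (at (0::real))"
  proof (rule Lim_null_comparison)
    show "\<forall>\<^sub>F h in at (0::real). norm ((max 0 h)^(n + 2) / h) \<le> \<bar>h\<bar>^(n + 1)"
    proof (rule always_eventually, rule allI)
      fix h :: real
      show "norm ((max 0 h)^(n + 2) / h) \<le> \<bar>h\<bar>^(n + 1)"
      proof (cases "h > 0")
        case False
        then have "norm ((max 0 h)^(n + 2) / h) = 0" by simp
        also have "0 \<le> \<bar>h\<bar>^(n + 1)" by (rule zero_le_power) simp
        finally show ?thesis .
      qed (simp add: max_def)
    qed
    have "((\<lambda>h::real. \<bar>h\<bar>^(n + 1)) \<longlongrightarrow> \<bar>0\<bar>^(n + 1)) (at 0)" by (intro tendsto_intros)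
    then show "((\<lambda>h::real. \<bar>h\<bar>^(n + 1)) \<longlongrightarrow> 0) (at 0)" by simp
  qed
  then show ?thesis unfolding DERIV_def equal by simp
qed

lemma DERIV_max0_cube:
  "((\<lambda>s::real. (max 0 s)^3) has_real_derivative 3 * (max 0 s)^2) (at s)"
  using DERIV_max0_power[of 1 s] by (simp add: numeral_2_eq_2 numeral_3_eq_3)

lemma cc_integral_cbox:
  fixes f :: "'a::euclidean_space \<Rightarrow> real"
  assumes "cc f" "\<And>x. x \<notin> cbox a b \<Longrightarrow> f x = 0"
  shows "integral\<^sup>L lborel f = integral (cbox a b) f"
proof -
  have e: "(\<lambda>x. if x \<in> cbox a b then f x else 0) = f" using assms(2) by auto
  have "integral\<^sup>L lborel f = integral UNIV f" using integral_lborel[OF cc_integrable[OF assms(1)]] by simp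
  also have "\<dots> = integral (cbox a b) f"
    using integral_restrict_UNIV[of "cbox a b" f] unfolding e .
  finally show ?thesis .
qed

text \<open>Squaring the positive part makes the vector field \<open>bump y *\<^sub>R y\<close>
  explicitly integrable: its potential is a multiple of the cube of the same positive part.\<close>

definition bump :: "real^'n::finite \<Rightarrow> real" where
  "bump y = (max 0 (1 - (norm y)^2))^2"

lemma continuous_bump: "continuous_on UNIV bump"
  unfolding bump_def by (intro continuous_intros)

lemma bump_outside: "1 < norm y \<Longrightarrow> bump y = 0"
proof -
  assume "1 < norm y"
  then have "1 < (norm y)^2" by (simp add: one_less_power)
  then show ?thesis by (simp add: bump_def)
qed

lemma cc_bump: "cc bump"
  by (rule ccI[OF continuous_bump bump_outside])

lemma bump_nonneg: "0 \<le> bump y" by (simp add: bump_def)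

lemma bump_le_1: "bump y \<le> 1"
  unfolding bump_def by (intro power_le_one) auto

lemma integral_bump_pos: "0 < integral\<^sup>L lborel (bump :: real^'n::finite \<Rightarrow> real)"
  by (rule cc_integral_pos[OF cc_bump bump_nonneg, of 0]) (simp add: bump_def)

lemma bump_potential:
  "has_grad (\<lambda>y::real^'n::finite. 1/6 * (max 0 (1 - (norm y)^2))^3) (\<lambda>y. - (bump y *\<^sub>R y))"
proof -
  have 1: "has_grad (\<lambda>y::real^'n. 1 + (-1) * (norm y)^2) (\<lambda>y. 0 + (-1) *\<^sub>R (2 *\<^sub>R y))"
    using has_grad_add[OF has_grad_const has_grad_cmult[OF C2_fun_has_grad[OF C2_fun_norm2(1)]], of 1 "-1"]
    by (simp add: C2_fun_norm2(2))
  have "has_grad (\<lambda>y::real^'n. (max 0 (1 + (-1) * (norm y)^2))^3)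
      (\<lambda>y. (3 * (max 0 (1 + (-1) * (norm y)^2))^2) *\<^sub>R (0 + (-1) *\<^sub>R (2 *\<^sub>R y)))"
    by (rule has_grad_compose[OF 1, of UNIV "\<lambda>s. (max 0 s)^3" "\<lambda>s. 3 * (max 0 s)^2"])
      (auto intro!: continuous_intros DERIV_max0_cube)
  from has_grad_cmult[OF this, of "1/6"] show ?thesis by (simp add: bump_def)
qed

text \<open>The average over dilates of \<^const>\<open>bump\<close> is nondecreasing in the radius, since \<open>bump y *\<^sub>R y\<close> is minus the
  gradient of a nonnegative potential.\<close>

lemma subharmonic_mean_value:
  fixes z :: "real^'n::finite \<Rightarrow> real"
  assumes z: "C2_fun z" and sub: "\<And>x. 0 \<le> laplacian z x" and t: "t > 0"
  shows "z c * integral\<^sup>L lborel (bump :: real^'n \<Rightarrow> real) \<le> (\<integral>y. z (c + t *\<^sub>R y) * bump y \<partial>lborel)"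
proof -
  \<comment> \<open>A box around the support of \<open>bump\<close>, so that differentiation under
    the integral sign takes place over a compact set.\<close>
  define a b :: "real^'n" where "a = (\<chi> i. -1)" and "b = (\<chi> i. 1)"
  have out: "bump y = 0" if "y \<notin> cbox a b" for y
  proof (rule bump_outside, rule ccontr)
    assume "\<not> 1 < norm y"
    then have "\<bar>y $ i\<bar> \<le> 1" for i using component_le_norm_cart[of y i] by simp
    then have "y \<in> cbox a b" by (auto simp: a_def b_def mem_box_cart abs_le_iff minus_le_iff)
    then show False using that by simp
  qed
  have cz: "continuous_on UNIV z" "continuous_on UNIV (grad z)"
    using C2_fun_continuous[OF z] C2_fun_continuous_grad[OF z] .
  have zc: "continuous_on UNIV (\<lambda>y. z (c + s *\<^sub>R y))" "continuous_on UNIV (\<lambda>y. grad z (c + s *\<^sub>R y))" for s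
    by (intro continuous_intros continuous_on_compose2[OF cz(1)] continuous_on_compose2[OF cz(2)]; auto)+
  define A where "A s = (\<integral>y. z (c + s *\<^sub>R y) * bump y \<partial>lborel)" for s
  define A' where "A' s = (\<integral>y. (grad z (c + s *\<^sub>R y) \<bullet> y) * bump y \<partial>lborel)" for s
  have cA: "cc (\<lambda>y. z (c + s *\<^sub>R y) * bump y)" "cc (\<lambda>y. (grad z (c + s *\<^sub>R y) \<bullet> y) * bump y)" for s
    by (intro cc_mult2[OF cc_bump] continuous_intros zc)+
  have A: "A s = integral (cbox a b) (\<lambda>y. z (c + s *\<^sub>R y) * bump y)" for s
    unfolding A_def by (rule cc_integral_cbox[OF cA(1)]) (simp add: out)
  have A': "A' s = integral (cbox a b) (\<lambda>y. (grad z (c + s *\<^sub>R y) \<bullet> y) * bump y)" for s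
    unfolding A'_def by (rule cc_integral_cbox[OF cA(2)]) (simp add: out)
  have der: "(A has_real_derivative A' s) (at s)" for s
    unfolding A[abs_def] A'
  proof (rule leibniz_rule_field_derivative[where U=UNIV])
    fix s y
    show "((\<lambda>s. z (c + s *\<^sub>R y) * bump y) has_real_derivative (grad z (c + s *\<^sub>R y) \<bullet> y) * bump y) (at s)"
      by (rule DERIV_cmult_right[OF has_grad_line[OF C2_fun_has_grad[OF z]]])
    show "(\<lambda>y. z (c + s *\<^sub>R y) * bump y) integrable_on cbox a b"
      by (rule integrable_continuous) (rule continuous_on_subset[OF cc_continuous[OF cA(1)]], simp)
    have "continuous_on (UNIV \<times> cbox a b) (\<lambda>q. (grad z (c + fst q *\<^sub>R snd q) \<bullet> snd q) * bump (snd q))"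
      by (intro continuous_intros continuous_on_compose2[OF cz(2)] continuous_on_compose2[OF continuous_bump]) auto
    then show "continuous_on (UNIV \<times> cbox a b) (\<lambda>(s, y). (grad z (c + s *\<^sub>R y) \<bullet> y) * bump y)"
      by (simp add: case_prod_beta)
  qed auto
  have nonneg: "0 \<le> A' s" if s: "s > 0" for s
  proof -
    let ?P = "\<lambda>y::real^'n. 1/6 * (max 0 (1 - (norm y)^2))^3"
    note zs = C2_fun_affine[OF z, of c s]
    have cP: "cc ?P"
    proof (rule cc_mono_support[OF cc_bump])
      show "continuous_on UNIV ?P" by (intro continuous_intros)
      show "?P y = 0" if "bump y = 0" for y using that by (simp add: bump_def)
    qed
    have "0 \<le> (\<integral>y. ?P y * laplacian (\<lambda>y. z (c + s *\<^sub>R y)) y \<partial>lborel)"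
      unfolding zs(2) using sub by (intro Bochner_Integration.integral_nonneg mult_nonneg_nonneg) auto
    also have "\<dots> = - (\<integral>y. - (bump y *\<^sub>R y) \<bullet> grad (\<lambda>y. z (c + s *\<^sub>R y)) y \<partial>lborel)"
      by (rule green[OF zs(1) bump_potential]) (use cP in simp)
    also have "\<dots> = s * A' s"
      unfolding zs(3) A'_def by (simp add: inner_commute mult.assoc mult.commute)
    finally show ?thesis using s by (simp add: zero_le_mult_iff)
  qed
  have "A 0 \<le> A t"
  proof (rule ccontr)
    assume "\<not> A 0 \<le> A t"
    moreover obtain s where "0 < s" "s < t" "A t - A 0 = (t - 0) * A' s"
      using MVT2[OF t, of A A'] der by blast
    moreover have "0 \<le> t * A' s" using nonneg[OF \<open>0 < s\<close>] t by simp
    ultimately show False by simp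
  qed
  then show ?thesis by (simp add: A_def)
qed

subsection \<open>Stability and Caccioppoli estimates\<close>

lemma continuous_on_pos_powr:
  fixes f :: "'a::topological_space \<Rightarrow> real"
  assumes "continuous_on UNIV f" "\<And>x. 0 < f x"
  shows "continuous_on UNIV (\<lambda>x. f x powr s)"
  by (rule continuous_on_powr[OF assms(1) continuous_on_const]) (use assms(2) less_imp_neq in fastforce)

lemma has_grad_powr:
  assumes "has_grad f f'" "\<And>x. 0 < f x"
  shows "has_grad (\<lambda>x. f x powr s) (\<lambda>x. (s * f x powr (s - 1)) *\<^sub>R f' x)"
proof (rule has_grad_compose[OF assms(1), of "{0<..}" "\<lambda>y. y powr s" "\<lambda>y. s * y powr (s - 1)"])
  show "f x \<in> {0<..}" for x using assms(2) by simp
  show "((\<lambda>y. y powr s) has_real_derivative s * y powr (s - 1)) (at y)" if "y \<in> {0<..}" for y :: real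
    using that by (intro has_real_derivative_powr) simp
  show "continuous_on {0<..} (\<lambda>y::real. s * y powr (s - 1))"
    by (intro continuous_intros) auto
qed

text \<open>Testing with \<phi>^2/\<xi>. With a = (\<phi>/\<xi>) grad \<xi> the integrand becomes 2
  \<phi>'.a - a.a, which is at most |\<phi>'|^2 because |\<phi>' - a|^2 is nonnegative.\<close>

lemma picone:
  fixes \<xi> :: "real^'n::finite \<Rightarrow> real"
  assumes xi: "C2_fun \<xi>" "\<And>x. 0 < \<xi> x" and phi: "has_grad \<phi> \<phi>'" "cc \<phi>"
  shows "(\<integral>x. - laplacian \<xi> x / \<xi> x * (\<phi> x)^2 \<partial>lborel) \<le> (\<integral>x. (norm (\<phi>' x))^2 \<partial>lborel)"
proof -
  note gx = C2_fun_has_grad[OF xi(1)]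
  note cx = C2_fun_continuous[OF xi(1)] C2_fun_continuous_grad[OF xi(1)] C2_fun_continuous_laplacian[OF xi(1)]
  have xnz: "\<xi> x \<noteq> 0" for x using xi(2)[of x] by simp
  note cp = has_grad_continuous[OF phi(1)] has_grad_continuous_grad[OF phi(1)]
  have cp': "cc \<phi>'" by (rule cc_grad[OF phi(2,1)])
  define \<psi> where "\<psi> x = \<phi> x * \<phi> x * \<xi> x powr (-1)" for x
  define \<psi>' where "\<psi>' x = (\<phi> x * \<phi> x) *\<^sub>R (((-1) * \<xi> x powr (-1 - 1)) *\<^sub>R grad \<xi> x)
      + \<xi> x powr (-1) *\<^sub>R (\<phi> x *\<^sub>R \<phi>' x + \<phi> x *\<^sub>R \<phi>' x)" for x
  have hg: "has_grad \<psi> \<psi>'"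
    unfolding \<psi>_def[abs_def] \<psi>'_def[abs_def]
    by (rule has_grad_mult[OF has_grad_mult[OF phi(1) phi(1)] has_grad_powr[OF gx xi(2)]])
  have cc\<psi>: "cc \<psi>"
    by (rule cc_mono_support[OF phi(2)  has_grad_continuous[OF hg]]) (simp add: \<psi>_def)
  have c1: "cc (\<lambda>x. \<psi>' x \<bullet> grad \<xi> x)"
    by (rule cc_mono_support[OF cc_grad[OF cc\<psi> hg]])
      (auto intro!: continuous_intros has_grad_continuous_grad[OF hg] cx)
  have "(\<integral>x. - laplacian \<xi> x / \<xi> x * (\<phi> x)^2 \<partial>lborel) = - (\<integral>x. \<psi> x * laplacian \<xi> x \<partial>lborel)"
    by (simp add: \<psi>_def powr_minus_divide xi(2) less_imp_le power2_eq_square field_simps flip: Bochner_Integration.integral_minus)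
  also have "\<dots> = (\<integral>x. \<psi>' x \<bullet> grad \<xi> x \<partial>lborel)"
    using green[OF xi(1) hg] cc\<psi> by simp
  also have "\<dots> \<le> (\<integral>x. (norm (\<phi>' x))^2 \<partial>lborel)"
  proof (rule cc_integral_mono[OF c1])
    show "cc (\<lambda>x. (norm (\<phi>' x))^2)" by (rule cc_norm_power[OF cp']) simp
    fix x
    define a where "a = (\<phi> x / \<xi> x) *\<^sub>R grad \<xi> x"
    have e1: "\<xi> x powr (-1) = 1 / \<xi> x" "\<xi> x powr (-1 - 1) = 1 / (\<xi> x)^2"
      using xi(2)[of x] by (auto simp: powr_minus_divide powr_numeral)
    have "\<psi>' x \<bullet> grad \<xi> x = 2 * (\<phi>' x \<bullet> a) - a \<bullet> a"
      unfolding \<psi>'_def e1 a_def inner_add_left inner_scaleR_left inner_scaleR_right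
      using xi(2)[of x] by (simp add: power2_eq_square field_simps)
    moreover have "0 \<le> (\<phi>' x - a) \<bullet> (\<phi>' x - a)" by simp
    ultimately show "\<psi>' x \<bullet> grad \<xi> x \<le> (norm (\<phi>' x))^2"
      by (simp add: power2_norm_eq_inner inner_diff_left inner_diff_right inner_commute)
  qed
  finally show ?thesis .
qed

text \<open>Stability enters only through this pointwise inequality, which is preserved by rescaling.\<close>

definition stable_weight :: "(real^'n::finite \<Rightarrow> real) \<Rightarrow> bool" where
  "stable_weight W \<longleftrightarrow> continuous_on UNIV W \<and> (\<exists>\<xi> \<zeta>. C2_fun \<xi> \<and> C2_fun \<zeta> \<and> (\<forall>x. 0 < \<xi> x \<and> 0 < \<zeta> x) \<and>
    (\<forall>x. 2 * W x \<le> - laplacian \<xi> x / \<xi> x - laplacian \<zeta> x / \<zeta> x))"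

text \<open>Picone's inequality for \<xi> and for \<zeta>, with one and the same test function,
  added up.\<close>

lemma stable_weightD:
  assumes W: "stable_weight W" and phi: "has_grad \<phi> \<phi>'" "cc \<phi>"
  shows "(\<integral>x. W x * (\<phi> x)^2 \<partial>lborel) \<le> (\<integral>x. (norm (\<phi>' x))^2 \<partial>lborel)"
proof -
  obtain \<xi> \<zeta> where x: "C2_fun \<xi>" "\<And>x. 0 < \<xi> x" and z: "C2_fun \<zeta>" "\<And>x. 0 < \<zeta> x"
    and le: "\<And>x. 2 * W x \<le> - laplacian \<xi> x / \<xi> x - laplacian \<zeta> x / \<zeta> x" and W: "continuous_on UNIV W"
    using W unfolding stable_weight_def by blast
  have nz: "\<xi> x \<noteq> 0" "\<zeta> x \<noteq> 0" for x using x(2)[of x] z(2)[of x] by auto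
  have c2: "cc (\<lambda>x. (\<phi> x)^2)" using cc_norm_power[OF phi(2), of 2] by simp
  have c: "cc (\<lambda>x. - laplacian \<xi> x / \<xi> x * (\<phi> x)^2)" "cc (\<lambda>x. - laplacian \<zeta> x / \<zeta> x * (\<phi> x)^2)"
    by (intro cc_mult2[OF c2] continuous_intros C2_fun_continuous_laplacian C2_fun_continuous x z; simp add: nz)+
  have "(\<integral>x. 2 * (W x * (\<phi> x)^2) \<partial>lborel)
      \<le> (\<integral>x. - laplacian \<xi> x / \<xi> x * (\<phi> x)^2 + - laplacian \<zeta> x / \<zeta> x * (\<phi> x)^2 \<partial>lborel)"
  proof (rule cc_integral_mono)
    show "cc (\<lambda>x. 2 * (W x * (\<phi> x)^2))" by (intro cc_cmult cc_mult2[OF c2] W)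
    show "2 * (W y * (\<phi> y)^2) \<le> - laplacian \<xi> y / \<xi> y * (\<phi> y)^2 + - laplacian \<zeta> y / \<zeta> y * (\<phi> y)^2" for y
      using mult_right_mono[OF le[of y], of "(\<phi> y)^2"] by (simp add: algebra_simps)
  qed (intro cc_add c)
  also have "\<dots> \<le> 2 * (\<integral>x. (norm (\<phi>' x))^2 \<partial>lborel)"
    using picone[OF x phi] picone[OF z phi] Bochner_Integration.integral_add[OF cc_integrable[OF c(1)] cc_integrable[OF c(2)]]
    by simp
  finally show ?thesis by simp
qed

definition grad_powr_mult :: "real \<Rightarrow> (real^'n::finite \<Rightarrow> real) \<Rightarrow> (real^'n \<Rightarrow> real) \<Rightarrow> (real^'n \<Rightarrow> real^'n) \<Rightarrow> real^'n \<Rightarrow> real^'n" where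
  "grad_powr_mult k f \<eta> \<eta>' x = f x powr k *\<^sub>R \<eta>' x + \<eta> x *\<^sub>R ((k * f x powr (k - 1)) *\<^sub>R grad f x)"

lemma has_grad_powr_mult:
  assumes "C2_fun f" "\<And>x. 0 < f x" "has_grad \<eta> \<eta>'"
  shows "has_grad (\<lambda>x. f x powr k * \<eta> x) (grad_powr_mult k f \<eta> \<eta>')"
  using has_grad_mult[OF has_grad_powr[OF C2_fun_has_grad[OF assms(1)] assms(2)] assms(3)]
  unfolding grad_powr_mult_def[abs_def] .

text \<open>Testing the equation for \<open>f\<close> with \<open>f\<^bsup>2k-1\<^esup> \<eta>\<^sup>2\<close>.\<close>

lemma caccioppoli:
  fixes f :: "real^'n::finite \<Rightarrow> real"
  assumes f: "C2_fun f" "\<And>x. 0 < f x" and h: "has_grad \<eta> \<eta>'" "cc \<eta>"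
    and k: "0 < \<epsilon>" "\<epsilon> < 2 * k - 1"
  shows "(\<integral>x. (norm (grad_powr_mult k f \<eta> \<eta>' x))^2 \<partial>lborel) \<le>
    (k^2 + k * \<epsilon>) / (2 * k - 1 - \<epsilon>) * (\<integral>x. - laplacian f x * f x powr (2 * k - 1) * (\<eta> x)^2 \<partial>lborel)
    + ((k^2 + k * \<epsilon>) / (2 * k - 1 - \<epsilon>) / \<epsilon> + 1 + k / \<epsilon>) * (\<integral>x. f x powr (2 * k) * (norm (\<eta>' x))^2 \<partial>lborel)"
proof -
  note gf = C2_fun_has_grad[OF f(1)]
  note cf = C2_fun_continuous[OF f(1)] C2_fun_continuous_grad[OF f(1)] C2_fun_continuous_laplacian[OF f(1)]
  note cpw = continuous_on_pos_powr[OF cf(1) f(2)]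
  note ch = has_grad_continuous[OF h(1)] has_grad_continuous_grad[OF h(1)]
  have cch': "cc \<eta>'" by (rule cc_grad[OF h(2,1)])
  have kpos: "k > 0" using k by simp
  define G where "G x = f x powr (2 * k - 2) * (norm (grad f x))^2 * (\<eta> x)^2" for x
  define B where "B x = f x powr (2 * k) * (norm (\<eta>' x))^2" for x
  define F where "F x = - laplacian f x * f x powr (2 * k - 1) * (\<eta> x)^2" for x
  define M where "M x = f x powr (2 * k - 1) * \<eta> x * (\<eta>' x \<bullet> grad f x)" for x
  have h2: "cc (\<lambda>x. (\<eta> x)^2)" using cc_norm_power[OF h(2), of 2] by simp
  have cG: "cc G" unfolding G_def[abs_def] by (intro cc_mult2[OF h2] continuous_intros cpw cf)
  have cB: "cc B" unfolding B_def[abs_def] by (intro cc_mult2 cc_norm_power[OF cch'] cpw) simp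
  have cF: "cc F" unfolding F_def[abs_def] by (intro cc_mult2[OF h2] continuous_intros cpw cf)
  have cM: "cc M" unfolding M_def[abs_def]
    by (intro cc_mult[OF cc_mult2[OF h(2)]] continuous_intros cpw cf ch)
  \<comment> \<open>Young's inequality splits the cross term between the gradient term
    \<open>G\<close> and the cutoff term \<open>B\<close>; the weight \<open>\<epsilon>\<close> is
    what the strict quartic condition has to spare.\<close>
  have Mle: "2 * \<bar>M x\<bar> \<le> \<epsilon> * G x + 1 / \<epsilon> * B x" for x
  proof -
    define a where "a = f x powr (k - 1) * norm (grad f x) * \<bar>\<eta> x\<bar>"
    define b where "b = f x powr k * norm (\<eta>' x)"
    have a2: "a^2 = G x"
      unfolding a_def G_def power_mult_distrib by (simp add: powr_powr f(2) less_imp_le power2_eq_square flip: powr_add)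
    have b2: "b^2 = B x"
      unfolding b_def B_def power_mult_distrib by (simp add: power2_eq_square flip: powr_add)
    have "f x powr (2 * k - 1) = f x powr (k - 1) * f x powr k" by (simp flip: powr_add)
    then have "\<bar>M x\<bar> = f x powr (k - 1) * f x powr k * \<bar>\<eta> x\<bar> * \<bar>\<eta>' x \<bullet> grad f x\<bar>"
      by (simp add: M_def abs_mult)
    also have "\<dots> \<le> f x powr (k - 1) * f x powr k * \<bar>\<eta> x\<bar> * (norm (\<eta>' x) * norm (grad f x))"
      by (intro mult_left_mono Cauchy_Schwarz_ineq2) auto
    also have "\<dots> = a * b" by (simp add: a_def b_def)
    finally have "2 * \<bar>M x\<bar> \<le> 2 * (a * b)" by simp
    also have "2 * (a * b) \<le> \<epsilon> * a^2 + 1 / \<epsilon> * b^2"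
    proof -
      have "0 \<le> (\<epsilon> * a - b)^2 / \<epsilon>" using k by simp
      also have "\<dots> = \<epsilon> * a^2 + 1 / \<epsilon> * b^2 - 2 * (a * b)" using k by (simp add: field_simps power2_eq_square)
      finally show ?thesis by simp
    qed
    finally show ?thesis unfolding a2 b2 .
  qed
  define iG iB iF iM where "iG = integral\<^sup>L lborel G" and "iB = integral\<^sup>L lborel B"
    and "iF = integral\<^sup>L lborel F" and "iM = integral\<^sup>L lborel M"
  have absM: "- (\<epsilon> * iG + 1 / \<epsilon> * iB) \<le> 2 * iM" "2 * iM \<le> \<epsilon> * iG + 1 / \<epsilon> * iB"
  proof -
    have s: "integral\<^sup>L lborel (\<lambda>x. \<epsilon> * G x + 1 / \<epsilon> * B x) = \<epsilon> * iG + 1 / \<epsilon> * iB"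
      unfolding iG_def iB_def using cc_integrable[OF cG] cc_integrable[OF cB] by simp
    have "integral\<^sup>L lborel (\<lambda>x. 2 * M x) \<le> integral\<^sup>L lborel (\<lambda>x. \<epsilon> * G x + 1 / \<epsilon> * B x)"
      using Mle by (intro cc_integral_mono cc_add cc_cmult cG cB cM) (smt (verit))
    then show "2 * iM \<le> \<epsilon> * iG + 1 / \<epsilon> * iB" unfolding s iM_def by simp
    have "integral\<^sup>L lborel (\<lambda>x. (-2) * M x) \<le> integral\<^sup>L lborel (\<lambda>x. \<epsilon> * G x + 1 / \<epsilon> * B x)"
      using Mle by (intro cc_integral_mono cc_add cc_cmult cG cB cM) (smt (verit))
    then show "- (\<epsilon> * iG + 1 / \<epsilon> * iB) \<le> 2 * iM" unfolding s iM_def by simp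
  qed
  have first: "iF = (2 * k - 1) * iG + 2 * iM"
  proof -
    define \<psi> where "\<psi> x = f x powr (2 * k - 1) * (\<eta> x * \<eta> x)" for x
    define \<psi>' where "\<psi>' x = f x powr (2 * k - 1) *\<^sub>R (\<eta> x *\<^sub>R \<eta>' x + \<eta> x *\<^sub>R \<eta>' x)
        + (\<eta> x * \<eta> x) *\<^sub>R (((2 * k - 1) * f x powr (2 * k - 1 - 1)) *\<^sub>R grad f x)" for x
    have hg: "has_grad \<psi> \<psi>'"
      unfolding \<psi>_def[abs_def] \<psi>'_def[abs_def]
      by (rule has_grad_mult[OF has_grad_powr[OF gf f(2)] has_grad_mult[OF h(1) h(1)]])
    have c: "cc \<psi>" by (rule cc_mono_support[OF h(2) has_grad_continuous[OF hg]]) (simp add: \<psi>_def)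
    have "iF = - (\<integral>x. \<psi> x * laplacian f x \<partial>lborel)"
      by (simp add: iF_def F_def[abs_def] \<psi>_def power2_eq_square mult_ac flip: Bochner_Integration.integral_minus)
    also have "\<dots> = (\<integral>x. \<psi>' x \<bullet> grad f x \<partial>lborel)" using green[OF f(1) hg] c by simp
    also have "(\<lambda>x. \<psi>' x \<bullet> grad f x) = (\<lambda>x. (2 * k - 1) * G x + 2 * M x)"
      unfolding \<psi>'_def G_def M_def inner_add_left inner_scaleR_left power2_norm_eq_inner
      by (rule ext) (simp add: power2_eq_square algebra_simps)
    also have "integral\<^sup>L lborel \<dots> = (2 * k - 1) * iG + 2 * iM"
      unfolding iG_def iM_def using cc_integrable[OF cG] cc_integrable[OF cM] by simp
    finally show ?thesis .
  qed
  \<comment> \<open>Expanding the square brings in the same \<open>G\<close>, \<open>M\<close> and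
    \<open>B\<close>, so \<open>G\<close> can be eliminated with the tested equation. As \<epsilon>
    tends to 0 the constant in front of \<open>F\<close> tends to k^2/(2k - 1).\<close>
  have second: "(\<integral>x. (norm (grad_powr_mult k f \<eta> \<eta>' x))^2 \<partial>lborel) = k^2 * iG + k * (2 * iM) + iB"
  proof -
    have "(norm (grad_powr_mult k f \<eta> \<eta>' x))^2 = k^2 * G x + (k * 2) * M x + B x" for x
    proof -
      have e: "f x powr (2 * k - 1) = f x powr k * f x powr (k - 1)" "f x powr (2 * k - 2) = f x powr (k - 1) * f x powr (k - 1)"
        "f x powr (2 * k) = f x powr k * f x powr k"
        by (simp_all flip: powr_add)
      show ?thesis
        unfolding grad_powr_mult_def G_def B_def M_def e power2_norm_eq_inner
        by (simp add: inner_add_left inner_add_right inner_commute power2_eq_square algebra_simps)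
    qed
    then show ?thesis
      unfolding iG_def iM_def iB_def using cc_integrable[OF cG] cc_integrable[OF cM] cc_integrable[OF cB] by simp
  qed
  define d where "d = 2 * k - 1 - \<epsilon>"
  have d: "d > 0" using k by (simp add: d_def)
  have "d * iG \<le> iF + 1 / \<epsilon> * iB" using first absM(1) by (simp add: d_def algebra_simps)
  then have "(k^2 + k * \<epsilon>) / d * (d * iG) \<le> (k^2 + k * \<epsilon>) / d * (iF + 1 / \<epsilon> * iB)"
    using d kpos k by (intro mult_left_mono) auto
  then have 1: "(k^2 + k * \<epsilon>) * iG \<le> (k^2 + k * \<epsilon>) / d * (iF + 1 / \<epsilon> * iB)" using d by simp
  have "k^2 * iG + k * (2 * iM) + iB \<le> (k^2 + k * \<epsilon>) * iG + (1 + k / \<epsilon>) * iB"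
    using mult_left_mono[OF absM(2), of k] kpos by (simp add: algebra_simps)
  also have "\<dots> \<le> (k^2 + k * \<epsilon>) / d * (iF + 1 / \<epsilon> * iB) + (1 + k / \<epsilon>) * iB" using 1 by simp
  also have "\<dots> = (k^2 + k * \<epsilon>) / d * iF + ((k^2 + k * \<epsilon>) / d / \<epsilon> + 1 + k / \<epsilon>) * iB"
  proof -
    have "X * (iF + 1 / \<epsilon> * iB) + (1 + k / \<epsilon>) * iB = X * iF + (X / \<epsilon> + 1 + k / \<epsilon>) * iB" for X
      by (simp add: algebra_simps)
    then show ?thesis .
  qed
  finally show ?thesis unfolding second d_def iF_def iB_def F_def B_def .
qed

text \<open>Measuring Q in units of t with a t^c = b t^(-c) = sqrt(a b) makes the two factors equal.
  What remains is P^(1-c) Y^c + P^c Y^(1-c) \<le> P + Y, which holds because P^c - Y^c and P^(1-c) -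
  Y^(1-c) never have opposite signs. The weight \<mu> is 1/t.\<close>

lemma young_pair:
  fixes a b c :: real
  assumes "0 < a" "0 < b" "a * b < 1" "0 < c" "c \<le> 1"
  shows "\<exists>\<gamma> \<mu>. 0 < \<gamma> \<and> \<gamma> < 1 \<and> 0 < \<mu> \<and> (\<forall>P Q. 0 < P \<longrightarrow> 0 < Q \<longrightarrow>
    a * (P powr (1 - c) * Q powr c) + \<mu> * b * (P powr c * Q powr (1 - c)) \<le> \<gamma> * (P + \<mu> * Q))"
proof -
  define \<gamma> where "\<gamma> = sqrt (a * b)"
  define t where "t = sqrt (b / a) powr (1 / c)"
  have g: "0 < \<gamma>" "\<gamma> < 1" using assms real_sqrt_less_mono[of "a * b" 1] by (auto simp: \<gamma>_def)
  have t: "t > 0" using assms by (simp add: t_def)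
  have tc: "t powr c = sqrt (b / a)" using assms by (simp add: t_def powr_powr)
  have at: "a * t powr c = \<gamma>"
  proof -
    have "(a * sqrt (b / a))^2 = a * b" using assms by (simp add: power_mult_distrib) (simp add: power2_eq_square)
    then show ?thesis unfolding tc \<gamma>_def using assms by (intro real_sqrt_unique[symmetric]) auto
  qed
  have bt: "b = \<gamma> * t powr c"
  proof -
    have "\<gamma> * t powr c = sqrt ((a * b) * (b / a))" unfolding tc \<gamma>_def by (simp only: real_sqrt_mult)
    also have "(a * b) * (b / a) = b^2" using assms by (simp add: power2_eq_square)
    finally show ?thesis using assms by simp
  qed
  have "a * (P powr (1 - c) * Q powr c) + 1 / t * b * (P powr c * Q powr (1 - c)) \<le> \<gamma> * (P + 1 / t * Q)"
    if P: "0 < P" and Q: "0 < Q" for P Q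
  proof -
    define Y where "Y = Q / t"
    have Y: "Y > 0" "Q = t * Y" using Q t by (auto simp: Y_def)
    have e1: "a * (P powr (1 - c) * Q powr c) = \<gamma> * (P powr (1 - c) * Y powr c)"
      unfolding at[symmetric] Y(2) using t Y by (simp add: powr_mult)
    have "t powr c * t powr (1 - c) = t" using t by (simp flip: powr_add)
    then have e2: "1 / t * b * (P powr c * Q powr (1 - c)) = \<gamma> * (P powr c * Y powr (1 - c))"
      unfolding Y(2) bt using t Y by (simp add: powr_mult field_simps)
    have "0 \<le> (P powr c - Y powr c) * (P powr (1 - c) - Y powr (1 - c))"
    proof (cases "P \<le> Y")
      case True
      then have "P powr c \<le> Y powr c" "P powr (1 - c) \<le> Y powr (1 - c)"
        using assms P by (auto intro!: powr_mono2)
      then show ?thesis by (simp add: mult_nonpos_nonpos)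
    next
      case False
      then have "Y powr c \<le> P powr c" "Y powr (1 - c) \<le> P powr (1 - c)"
        using assms Y by (auto intro!: powr_mono2)
      then show ?thesis by simp
    qed
    moreover have "P powr c * P powr (1 - c) = P" "Y powr c * Y powr (1 - c) = Y"
      using P Y by (simp_all flip: powr_add)
    ultimately have "P powr (1 - c) * Y powr c + P powr c * Y powr (1 - c) \<le> P + Y" by (simp add: algebra_simps)
    from mult_left_mono[OF this, of \<gamma>] g have "\<gamma> * (P powr (1 - c) * Y powr c) + \<gamma> * (P powr c * Y powr (1 - c)) \<le> \<gamma> * (P + Y)"
      by (simp add: algebra_simps)
    then show ?thesis unfolding e1 e2 by (simp add: Y_def)
  qed
  then show ?thesis using g t by (intro exI[of _ \<gamma>] exI[of _ "1 / t"]) auto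
qed

subsection \<open>Cutoff functions and a priori bounds\<close>

definition is_cutoff :: "real \<Rightarrow> (real^'n::finite \<Rightarrow> real) \<Rightarrow> bool" where
  "is_cutoff r \<omega> \<longleftrightarrow> C2_fun \<omega> \<and> (\<forall>x. 0 \<le> \<omega> x \<and> \<omega> x \<le> 1) \<and> (\<forall>x. norm x \<le> r \<longrightarrow> \<omega> x = 1) \<and> (\<forall>x. 2 * r \<le> norm x \<longrightarrow> \<omega> x = 0)"

lemma is_cutoffD:
  assumes "is_cutoff r \<omega>"
  shows "C2_fun \<omega>" "0 \<le> \<omega> x" "\<omega> x \<le> 1" "norm x \<le> r \<Longrightarrow> \<omega> x = 1" "2 * r \<le> norm x \<Longrightarrow> \<omega> x = 0"
  using assms by (auto simp: is_cutoff_def)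

lemma DERIV_max0_square: "((\<lambda>s::real. (max 0 s)^2) has_real_derivative 2 * max 0 s) (at s)"
  using DERIV_max0_power[of 0 s] by (simp add: numeral_2_eq_2)

lemma C2_fun_max0_cube:
  assumes "C2_fun f" shows "C2_fun (\<lambda>x. (max 0 (f x))^3)"
proof -
  have d: "((\<lambda>s::real. 3 * (max 0 s)^2) has_real_derivative 3 * (2 * max 0 s)) (at s)" for s
    by (rule DERIV_cmult[OF DERIV_max0_square])
  have c: "continuous_on UNIV (\<lambda>s::real. 3 * (2 * max 0 s))" by (intro continuous_intros)
  show ?thesis
    by (rule C2_fun_compose(1)[OF assms UNIV_I DERIV_max0_cube d c])
qed

text \<open>Nested cubes of positive parts suffice: \<open>g\<close> is 1 inside radius r and
  nonpositive outside radius 2r, and both truncations preserve the class C2.\<close>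

lemma cutoff_exists:
  assumes "r > 0" obtains \<omega> :: "real^'n::finite \<Rightarrow> real" where "is_cutoff r \<omega>"
proof -
  define f where "f x = 1 / r^2 * (norm x)^2 + (-1)" for x :: "real^'n"
  define g where "g x = (-1) * (max 0 (f x))^3 + 1" for x
  define \<omega> where "\<omega> x = (max 0 (g x))^3" for x
  have "C2_fun f" unfolding f_def[abs_def]
    by (intro C2_fun_add(1) C2_fun_cmult(1) C2_fun_norm2(1) C2_fun_const)
  then have "C2_fun g" unfolding g_def[abs_def]
    by (intro C2_fun_add(1) C2_fun_cmult(1) C2_fun_max0_cube C2_fun_const)
  then have "C2_fun \<omega>" unfolding \<omega>_def[abs_def] by (rule C2_fun_max0_cube)
  moreover have "0 \<le> \<omega> x \<and> \<omega> x \<le> 1" for x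
    unfolding \<omega>_def g_def by (auto intro!: power_le_one)
  moreover have "\<omega> x = 1" if "norm x \<le> r" for x
  proof -
    have "(norm x)^2 \<le> r^2" using that by (intro power_mono) auto
    then have "f x \<le> 0" using assms by (simp add: f_def)
    then show ?thesis by (simp add: \<omega>_def g_def)
  qed
  moreover have "\<omega> x = 0" if "2 * r \<le> norm x" for x
  proof -
    have "(2 * r)^2 \<le> (norm x)^2" using that assms by (intro power_mono) auto
    then have "4 * r^2 \<le> (norm x)^2" by (simp add: power_mult_distrib)
    then have "2 * r^2 \<le> (norm x)^2" using zero_le_power2[of r] by linarith
    then have "1 \<le> f x" using assms by (simp add: f_def field_simps)
    then have "1 \<le> (max 0 (f x))^3" by (intro one_le_power) simp
    then show ?thesis by (simp add: \<omega>_def g_def)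
  qed
  ultimately show ?thesis using that unfolding is_cutoff_def by blast
qed

lemma cutoff_cc: "is_cutoff r \<omega> \<Longrightarrow> cc \<omega>"
  by (rule ccI[of _ "2 * r"]) (auto intro: C2_fun_continuous is_cutoffD(1) is_cutoffD(5) less_imp_le)

text \<open>A high power of a cutoff has derivatives controlled by slightly lower powers of the
  cutoff itself. This lets error terms be absorbed into integrals weighted by
  \<open>\<omega> x ^ m\<close>.\<close>

lemma cutoff_power:
  fixes \<omega> :: "real^'n::finite \<Rightarrow> real"
  assumes c: "is_cutoff r \<omega>" and m: "m \<ge> 2"
  shows "C2_fun (\<lambda>x. \<omega> x ^ m)" "cc (\<lambda>x. \<omega> x ^ m)"
    "norm x < r \<or> 2 * r < norm x \<Longrightarrow> grad (\<lambda>x. \<omega> x ^ m) x = 0 \<and> laplacian (\<lambda>x. \<omega> x ^ m) x = 0"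
    "\<exists>C>0. \<forall>x. \<bar>laplacian (\<lambda>x. \<omega> x ^ m) x\<bar> \<le> C * \<omega> x ^ (m - 2) \<and> (norm (grad (\<lambda>x. \<omega> x ^ m) x))^2 \<le> C * \<omega> x ^ (2 * m - 2)"
proof -
  note d = is_cutoffD[OF c]
  have d1: "((\<lambda>y::real. real m * y^(m - 1)) has_real_derivative real m * (real (m - 1) * y^(m - 2))) (at y)" for y
    using DERIV_cmult[OF DERIV_pow[of "m - 1" y], of "real m"] by (simp add: numeral_2_eq_2)
  have d0: "((\<lambda>y::real. y^m) has_real_derivative real m * y^(m - 1)) (at y)" for y
    using DERIV_pow[of m y] by simp
  have "continuous_on UNIV (\<lambda>y::real. real m * (real (m - 1) * y^(m - 2)))" by (intro continuous_intros)
  note C = C2_fun_compose[OF d(1) UNIV_I d0 d1 this]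
  have C': "C2_fun (\<lambda>x. \<omega> x ^ m)"
    "laplacian (\<lambda>x. \<omega> x ^ m) = (\<lambda>x. real m * (real (m - 1) * \<omega> x^(m - 2)) * (norm (grad \<omega> x))^2 + real m * \<omega> x^(m - 1) * laplacian \<omega> x)"
    "grad (\<lambda>x. \<omega> x ^ m) = (\<lambda>x. (real m * \<omega> x^(m - 1)) *\<^sub>R grad \<omega> x)"
    by (fact C)+
  show C2: "C2_fun (\<lambda>x. \<omega> x ^ m)" by (rule C')
  show cp: "cc (\<lambda>x. \<omega> x ^ m)"
    by (rule cc_mono_support[OF cutoff_cc[OF c] C2_fun_continuous[OF C2]]) (use m in auto)
  show "grad (\<lambda>x. \<omega> x ^ m) x = 0 \<and> laplacian (\<lambda>x. \<omega> x ^ m) x = 0" if "norm x < r \<or> 2 * r < norm x"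
    using that
  proof
    assume x: "norm x < r"
    have o: "open {x::real^'n. norm x < r}" by (intro open_Collect_less continuous_intros)
    show ?thesis
      using grad_zero_open[OF C2_fun_has_grad[OF C2] o, of x 1] laplacian_zero_open[OF C2 o, of x 1] x d(4) by auto
  next
    assume x: "2 * r < norm x"
    have o: "open {x::real^'n. 2 * r < norm x}" by (intro open_Collect_less continuous_intros)
    show ?thesis
      using grad_zero_open[OF C2_fun_has_grad[OF C2] o, of x 0] laplacian_zero_open[OF C2 o, of x 0] x d(5) m by auto
  qed
  have ccg: "cc (grad \<omega>)" by (rule cc_grad[OF cutoff_cc[OF c] C2_fun_has_grad[OF d(1)]])
  obtain M1 where M1: "M1 > 0" "\<And>x. norm (grad \<omega> x) \<le> M1" using cc_bounded[OF ccg] by auto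
  have ccl: "cc (laplacian \<omega>)"
  proof (rule ccI[of _ "2 * r"])
    show "continuous_on UNIV (laplacian \<omega>)" by (rule C2_fun_continuous_laplacian[OF d(1)])
    fix x :: "real^'n" assume x: "2 * r < norm x"
    have o: "open {x::real^'n. 2 * r < norm x}" by (intro open_Collect_less continuous_intros)
    show "laplacian \<omega> x = 0" using laplacian_zero_open[OF d(1) o, of x 0] x d(5) by auto
  qed
  obtain M2 where M2: "M2 > 0" "\<And>x. \<bar>laplacian \<omega> x\<bar> \<le> M2" using cc_bounded[OF ccl] by auto
  define K where "K = real m * (real m * M1^2) + real m * M2 + (real m)^2 * M1^2"
  have K: "K > 0" using m M1 M2 by (simp add: K_def add_pos_pos)
  have "\<bar>laplacian (\<lambda>x. \<omega> x ^ m) x\<bar> \<le> K * \<omega> x ^ (m - 2) \<and> (norm (grad (\<lambda>x. \<omega> x ^ m) x))^2 \<le> K * \<omega> x ^ (2 * m - 2)" for x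
  proof
    have g2: "(norm (grad \<omega> x))^2 \<le> M1^2" using M1(2)[of x] by (intro power_mono) auto
    have pos: "\<omega> x ^ j \<ge> 0" for j using d(2)[of x] by simp
    have le: "\<omega> x ^ (m - 1) \<le> \<omega> x ^ (m - 2)" using d(2,3)[of x] m by (intro power_decreasing) auto
    have "\<bar>laplacian (\<lambda>x. \<omega> x ^ m) x\<bar> \<le> real m * (real (m - 1) * \<omega> x^(m - 2)) * (norm (grad \<omega> x))^2 + real m * \<omega> x^(m - 1) * \<bar>laplacian \<omega> x\<bar>"
      unfolding C'(2) using pos by (intro order_trans[OF abs_triangle_ineq]) (simp add: abs_mult)
    also have "\<dots> \<le> real m * (real m * \<omega> x^(m - 2)) * M1^2 + real m * \<omega> x^(m - 2) * M2"
      using pos le g2 M2 by (intro add_mono mult_mono) (auto intro!: mult_nonneg_nonneg)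
    also have "\<dots> \<le> K * \<omega> x ^ (m - 2)"
    proof -
      have "K * \<omega> x ^ (m - 2) = real m * (real m * \<omega> x^(m - 2)) * M1^2 + real m * \<omega> x^(m - 2) * M2 + (real m)^2 * M1^2 * \<omega> x^(m - 2)"
        by (simp add: K_def algebra_simps)
      then show ?thesis using pos[of "m - 2"] by simp
    qed
    finally show "\<bar>laplacian (\<lambda>x. \<omega> x ^ m) x\<bar> \<le> K * \<omega> x ^ (m - 2)" .
    have "(norm (grad (\<lambda>x. \<omega> x ^ m) x))^2 = (real m)^2 * (norm (grad \<omega> x))^2 * \<omega> x ^ (2 * m - 2)"
      unfolding C'(3) using pos by (simp add: power_mult_distrib power_mult[symmetric] mult.commute right_diff_distrib')
    also have "\<dots> \<le> (real m)^2 * M1^2 * \<omega> x ^ (2 * m - 2)"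
      using g2 pos by (intro mult_right_mono mult_left_mono) auto
    also have "\<dots> \<le> K * \<omega> x ^ (2 * m - 2)"
      using pos M1 M2 by (intro mult_right_mono) (auto simp: K_def)
    finally show "(norm (grad (\<lambda>x. \<omega> x ^ m) x))^2 \<le> K * \<omega> x ^ (2 * m - 2)" .
  qed
  then show "\<exists>C>0. \<forall>x. \<bar>laplacian (\<lambda>x. \<omega> x ^ m) x\<bar> \<le> C * \<omega> x ^ (m - 2) \<and> (norm (grad (\<lambda>x. \<omega> x ^ m) x))^2 \<le> C * \<omega> x ^ (2 * m - 2)"
    using K by blast
qed

section \<open>Absorption by Young's inequality and the a priori bounds\<close>

lemma young_const:
  fixes c d q :: real
  assumes "c > 0" "d > 0" "q > 1"
  shows "\<exists>K>0. \<forall>t\<ge>0. c * t \<le> d * t powr q + K"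
proof -
  define t0 where "t0 = (c / d) powr (1 / (q - 1))"
  have t0: "t0 > 0" using assms by (simp add: t0_def)
  have "c * t \<le> d * t powr q + c * t0" if "t \<ge> 0" for t
  proof (cases "t \<le> t0")
    case True
    then have "c * t \<le> c * t0" using assms by simp
    moreover have "0 \<le> d * t powr q" using assms by simp
    ultimately show ?thesis by linarith
  next
    case False
    then have t: "t > 0" using t0 by simp
    have "c / d = t0 powr (q - 1)" using assms by (simp add: t0_def powr_powr)
    also have "\<dots> \<le> t powr (q - 1)" using False t0 assms by (intro powr_mono2) auto
    finally have "c \<le> d * t powr (q - 1)" using assms by (simp add: field_simps)
    then have "c * t \<le> d * t powr (q - 1) * t" using t by simp
    also have "t powr (q - 1) * t = t powr q" using t powr_add[of t "q - 1" 1] by simp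
    then have "d * t powr (q - 1) * t = d * t powr q" by simp
    finally have "c * t \<le> d * t powr q" .
    moreover have "0 < c * t0" using assms t0 by simp
    ultimately show ?thesis by linarith
  qed
  then show ?thesis using assms t0 by (intro exI[of _ "c * t0"]) auto
qed

text \<open>The condition m/q \<le> m - 2 makes \<omega>^(m-2) at most \<omega>^(m/q), so the
  left-hand side is at most c t with t^q = w^q \<omega>^m.\<close>

lemma weighted_young:
  fixes w \<omega> :: real
  assumes "\<And>t. 0 \<le> t \<Longrightarrow> c * t \<le> d * t powr q + K" "c > 0" "K > 0" "d > 0" "q > 1"
    and "0 < w" "0 \<le> \<omega>" "\<omega> \<le> 1" "3 \<le> m" "real m / q \<le> real (m - 2)"
  shows "c * (w * \<omega> ^ (m - 2)) \<le> d * (w powr q * \<omega> ^ m) + K"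
proof (cases "\<omega> = 0")
  case False
  then have pos: "\<omega> > 0" using assms by simp
  have "\<omega> ^ (m - 2) = \<omega> powr real (m - 2)" using pos by (simp add: powr_realpow)
  also have "\<dots> \<le> \<omega> powr (real m / q)" using pos assms by (intro powr_mono') auto
  finally have "c * (w * \<omega> ^ (m - 2)) \<le> c * (w * \<omega> powr (real m / q))" using assms by simp
  also have "\<dots> \<le> d * (w * \<omega> powr (real m / q)) powr q + K" using assms(1,6) by simp
  also have "(w * \<omega> powr (real m / q)) powr q = w powr q * \<omega> ^ m"
    using assms pos by (simp add: powr_mult powr_powr powr_realpow)
  finally show ?thesis .
next
  case True
  have "0 < m - 2" "0 < m" using assms by auto
  then show ?thesis using True assms by (simp add: zero_power)
qed

text \<open>The Laplacian of \<omega>^m lives where r \<le> |x| \<le> 2r; since r \<ge> 1 the weight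
  is at least A there. A second cutoff, equal to 1 on that annulus, turns the additive constant of
  Young's inequality into an integrable function.\<close>

lemma cutoff_young:
  fixes \<omega> :: "real^'n::finite \<Rightarrow> real"
  assumes c: "is_cutoff r \<omega>" and r: "r \<ge> 1" and q: "q > 1" and A: "A > 0" "\<alpha> \<ge> 0"
    and m: "3 \<le> m" "real m / q \<le> real (m - 2)"
  shows "\<exists>K>0. \<forall>\<rho> f. continuous_on UNIV \<rho> \<longrightarrow> (\<forall>x. A * norm x powr \<alpha> \<le> \<rho> x) \<longrightarrow> C2_fun f \<longrightarrow> (\<forall>x. 0 < f x) \<longrightarrow>
    - (\<integral>x. f x * laplacian (\<lambda>x. \<omega> x ^ m) x \<partial>lborel) \<le> 1/2 * (\<integral>x. \<rho> x * f x powr q * \<omega> x ^ m \<partial>lborel) + K"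
proof -
  note d = is_cutoffD[OF c]
  have m2: "m \<ge> 2" using m by simp
  note cp = cutoff_power[OF c m2]
  obtain C where C: "C > 0" "\<And>x. \<bar>laplacian (\<lambda>x. \<omega> x ^ m) x\<bar> \<le> C * \<omega> x ^ (m - 2)" using cp(4) by blast
  obtain K where K: "K > 0" "\<And>t. 0 \<le> t \<Longrightarrow> C * t \<le> A / 2 * t powr q + K"
    using young_const[of C "A/2" q] C A q by auto
  obtain \<omega>2 :: "real^'n \<Rightarrow> real" where c2: "is_cutoff (2 * r) \<omega>2" using cutoff_exists[of "2 * r"] r by auto
  note e = is_cutoffD[OF c2]
  define V where "V = integral\<^sup>L lborel \<omega>2"
  have V: "V > 0" unfolding V_def
    by (rule cc_integral_pos[OF cutoff_cc[OF c2] e(2), of 0]) (use e(4)[of 0] r in simp)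
  have "- (\<integral>x. f x * laplacian (\<lambda>x. \<omega> x ^ m) x \<partial>lborel) \<le> 1/2 * (\<integral>x. \<rho> x * f x powr q * \<omega> x ^ m \<partial>lborel) + K * V"
    if rho: "continuous_on UNIV \<rho>" "\<And>x. A * norm x powr \<alpha> \<le> \<rho> x" and f: "C2_fun f" "\<And>x. 0 < f x" for \<rho> f
  proof -
    have cl: "cc (laplacian (\<lambda>x. \<omega> x ^ m))"
      by (rule ccI[of _ "2 * r"]) (use cp(3) in \<open>auto intro: C2_fun_continuous_laplacian[OF cp(1)]\<close>)
    have c1: "cc (\<lambda>x. f x * laplacian (\<lambda>x. \<omega> x ^ m) x)" by (rule cc_mult2[OF cl C2_fun_continuous[OF f(1)]])
    have c3: "cc (\<lambda>x. \<rho> x * f x powr q * \<omega> x ^ m)"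
      by (intro cc_mult2[OF cp(2)] continuous_intros rho continuous_on_pos_powr C2_fun_continuous f)
    have rho0: "0 \<le> \<rho> x" for x using rho(2)[of x] A by (meson mult_nonneg_nonneg order_trans powr_ge_zero less_imp_le)
    have "(\<integral>x. (-1) * (f x * laplacian (\<lambda>x. \<omega> x ^ m) x) \<partial>lborel) \<le> (\<integral>x. 1/2 * (\<rho> x * f x powr q * \<omega> x ^ m) + K * \<omega>2 x \<partial>lborel)"
    proof (rule cc_integral_mono)
      fix x
      have nn: "0 \<le> \<rho> x * f x powr q * \<omega> x ^ m" using rho0 d(2) by simp
      show "(-1) * (f x * laplacian (\<lambda>x. \<omega> x ^ m) x) \<le> 1/2 * (\<rho> x * f x powr q * \<omega> x ^ m) + K * \<omega>2 x"
      proof (cases "norm x < r \<or> 2 * r < norm x")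
        case True
        then have "laplacian (\<lambda>x. \<omega> x ^ m) x = 0" using cp(3) by blast
        then show ?thesis using nn K e(2) by simp
      next
        case False
        then have "A * 1 \<le> A * norm x powr \<alpha>" using A r by (intro mult_left_mono ge_one_powr_ge_zero) auto
        then have rA: "A \<le> \<rho> x" using rho(2)[of x] by simp
        have "(-1) * (f x * laplacian (\<lambda>x. \<omega> x ^ m) x) \<le> f x * \<bar>laplacian (\<lambda>x. \<omega> x ^ m) x\<bar>"
          using f(2)[of x] mult_left_mono[of "- laplacian (\<lambda>x. \<omega> x ^ m) x" "\<bar>laplacian (\<lambda>x. \<omega> x ^ m) x\<bar>" "f x"] by simp
        also have "\<dots> \<le> f x * (C * \<omega> x ^ (m - 2))" using C(2) f(2)[of x] by (intro mult_left_mono) auto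
        also have "\<dots> = C * (f x * \<omega> x ^ (m - 2))" by simp
        also have "\<dots> \<le> A / 2 * (f x powr q * \<omega> x ^ m) + K"
          using K C A q f(2) d(2,3) m by (intro weighted_young[where q=q]) auto
        also have "A / 2 * (f x powr q * \<omega> x ^ m) \<le> \<rho> x / 2 * (f x powr q * \<omega> x ^ m)"
          using rA d(2) by (intro mult_right_mono) auto
        finally show ?thesis using e(4)[of x] False by simp
      qed
    qed (intro cc_cmult cc_add c1 c3 cutoff_cc[OF c2])+
    also have "\<dots> = 1/2 * (\<integral>x. \<rho> x * f x powr q * \<omega> x ^ m \<partial>lborel) + K * V"
      unfolding V_def using cc_integrable[OF c3] cc_integrable[OF cutoff_cc[OF c2]] by simp
    finally show ?thesis by simp
  qed
  then show ?thesis using K V by (intro exI[of _ "K * V"]) auto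
qed

text \<open>Only the part \<open>A \<bar>x\<bar>\<^sup>\<alpha>\<close> of the lower bound on the weight is kept, so that the class is closed under the
  rescaling below.\<close>

definition weighted_solution :: "real \<Rightarrow> real \<Rightarrow> real \<Rightarrow> real \<Rightarrow> (real^'n::finite \<Rightarrow> real) \<Rightarrow> (real^'n \<Rightarrow> real) \<Rightarrow> (real^'n \<Rightarrow> real) \<Rightarrow> bool" where
  "weighted_solution p \<theta> \<alpha> A \<rho> u v \<longleftrightarrow> continuous_on UNIV \<rho> \<and> (\<forall>x. A * norm x powr \<alpha> \<le> \<rho> x) \<and> classical_solution \<rho> p \<theta> u v"

lemma weighted_solutionD:
  assumes "weighted_solution p \<theta> \<alpha> A \<rho> u v"
  shows "continuous_on UNIV \<rho>" "A * norm x powr \<alpha> \<le> \<rho> x" "C2_fun u" "C2_fun v" "0 < u x" "0 < v x"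
    "laplacian u x = - (\<rho> x * v x powr p)" "laplacian v x = - (\<rho> x * u x powr \<theta>)"
proof -
  have "- laplacian u x = \<rho> x * v x powr p" "- laplacian v x = \<rho> x * u x powr \<theta>"
    using assms by (auto simp: weighted_solution_def classical_solution_def)
  then show "laplacian u x = - (\<rho> x * v x powr p)" "laplacian v x = - (\<rho> x * u x powr \<theta>)" by linarith+
qed (use assms in \<open>auto simp: weighted_solution_def classical_solution_def\<close>)

lemma weighted_solution_nonneg: "weighted_solution p \<theta> \<alpha> A \<rho> u v \<Longrightarrow> A > 0 \<Longrightarrow> 0 \<le> \<rho> x"
  using weighted_solutionD(2)[of p \<theta> \<alpha> A \<rho> u v x] by (meson mult_nonneg_nonneg order_trans powr_ge_zero less_imp_le)

lemma green_swap:
  assumes "C2_fun f" "C2_fun g" "cc g"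
  shows "(\<integral>x. g x * laplacian f x \<partial>lborel) = (\<integral>x. f x * laplacian g x \<partial>lborel)"
  using green[OF assms(1) C2_fun_has_grad[OF assms(2)]] green[OF assms(2) C2_fun_has_grad[OF assms(1)]] assms(3)
  by (simp add: inner_commute)

text \<open>Green's formula moves the Laplacian onto the cutoff, so the integral of \<rho> v^p is at
  most half that of \<rho> u^\<theta> plus a constant, and conversely; the two bounds close up. The
  condition on m is m/p \<le> m - 2, and \<open>C\<close> does not depend on the solution.\<close>

lemma apriori:
  fixes \<omega> :: "real^'n::finite \<Rightarrow> real"
  assumes p: "1 < p" "p \<le> \<theta>" and A: "A > 0" "\<alpha> \<ge> 0" and c: "is_cutoff r \<omega>" and r: "r \<ge> 1"
    and m: "3 \<le> m" "2 * p \<le> real m * (p - 1)"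
  shows "\<exists>C>0. \<forall>\<rho> u v. weighted_solution p \<theta> \<alpha> A \<rho> u v \<longrightarrow>
    (\<integral>x. \<rho> x * v x powr p * \<omega> x ^ m \<partial>lborel) \<le> C \<and> (\<integral>x. \<rho> x * u x powr \<theta> * \<omega> x ^ m \<partial>lborel) \<le> C"
proof -
  have "real m / p \<le> real m - 2" using p m by (simp add: field_simps)
  then have mp: "real m / p \<le> real (m - 2)" using m by simp
  moreover have "real m / \<theta> \<le> real m / p" using p by (intro divide_left_mono) auto
  ultimately have mt: "real m / \<theta> \<le> real (m - 2)" by linarith
  have m2: "m \<ge> 2" using m by simp
  note cp = cutoff_power[OF c m2]
  obtain K1 where K1: "K1 > 0" "\<And>\<rho> f. continuous_on UNIV \<rho> \<Longrightarrow> (\<And>x. A * norm x powr \<alpha> \<le> \<rho> x) \<Longrightarrow> C2_fun f \<Longrightarrow> (\<And>x. 0 < f x) \<Longrightarrow>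
    - (\<integral>x. f x * laplacian (\<lambda>x. \<omega> x ^ m) x \<partial>lborel) \<le> 1/2 * (\<integral>x. \<rho> x * f x powr p * \<omega> x ^ m \<partial>lborel) + K1"
    using cutoff_young[OF c r p(1) A m(1) mp] by blast
  have th: "1 < \<theta>" using p by simp
  obtain K2 where K2: "K2 > 0" "\<And>\<rho> f. continuous_on UNIV \<rho> \<Longrightarrow> (\<And>x. A * norm x powr \<alpha> \<le> \<rho> x) \<Longrightarrow> C2_fun f \<Longrightarrow> (\<And>x. 0 < f x) \<Longrightarrow>
    - (\<integral>x. f x * laplacian (\<lambda>x. \<omega> x ^ m) x \<partial>lborel) \<le> 1/2 * (\<integral>x. \<rho> x * f x powr \<theta> * \<omega> x ^ m \<partial>lborel) + K2"
    using cutoff_young[OF c r th A m(1) mt] by blast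
  have "(\<integral>x. \<rho> x * v x powr p * \<omega> x ^ m \<partial>lborel) \<le> 2 * (K1 + K2) \<and> (\<integral>x. \<rho> x * u x powr \<theta> * \<omega> x ^ m \<partial>lborel) \<le> 2 * (K1 + K2)"
    if a: "weighted_solution p \<theta> \<alpha> A \<rho> u v" for \<rho> u v
  proof -
    note d = weighted_solutionD[OF a]
    have I: "(\<integral>x. \<rho> x * v x powr p * \<omega> x ^ m \<partial>lborel) = - (\<integral>x. u x * laplacian (\<lambda>x. \<omega> x ^ m) x \<partial>lborel)"
      unfolding green_swap[OF d(3) cp(1,2), symmetric] d(7) by (simp add: mult_ac flip: Bochner_Integration.integral_minus)
    have J: "(\<integral>x. \<rho> x * u x powr \<theta> * \<omega> x ^ m \<partial>lborel) = - (\<integral>x. v x * laplacian (\<lambda>x. \<omega> x ^ m) x \<partial>lborel)"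
      unfolding green_swap[OF d(4) cp(1,2), symmetric] d(8) by (simp add: mult_ac flip: Bochner_Integration.integral_minus)
    have "(\<integral>x. \<rho> x * v x powr p * \<omega> x ^ m \<partial>lborel) \<le> 1/2 * (\<integral>x. \<rho> x * u x powr \<theta> * \<omega> x ^ m \<partial>lborel) + K2"
      unfolding I by (rule K2(2)[OF d(1,2,3,5)])
    moreover have "(\<integral>x. \<rho> x * u x powr \<theta> * \<omega> x ^ m \<partial>lborel) \<le> 1/2 * (\<integral>x. \<rho> x * v x powr p * \<omega> x ^ m \<partial>lborel) + K1"
      unfolding J by (rule K1(2)[OF d(1,2,4,6)])
    ultimately show ?thesis using K1(1) K2(1) by auto
  qed
  then show ?thesis using K1(1) K2(1) by (intro exI[of _ "2 * (K1 + K2)"]) auto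
qed

text \<open>The geometric mean of the two coefficients p \<rho> v^(p-1) and \<theta> \<rho>
  u^(\<theta>-1) of the linearized system.\<close>

definition linearized_weight :: "real \<Rightarrow> real \<Rightarrow> (real^'n::finite \<Rightarrow> real) \<Rightarrow> (real^'n \<Rightarrow> real) \<Rightarrow> (real^'n \<Rightarrow> real) \<Rightarrow> real^'n \<Rightarrow> real" where
  "linearized_weight p \<theta> \<rho> u v x = sqrt (p * \<theta>) * (\<rho> x * u x powr ((\<theta> - 1) / 2) * v x powr ((p - 1) / 2))"

text \<open>The two quotients are \<rho> a and \<rho> b, where a and b contain \<zeta>/\<xi> and its
  inverse. The unknown ratio cancels in a b, and a + b \<ge> 2 sqrt(a b).\<close>

lemma stable_weight_linearized:
  assumes a: "weighted_solution p \<theta> \<alpha> A \<rho> u v" and A: "A > 0" and p: "1 < p" "p \<le> \<theta>"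
    and st: "stable_classical_solution \<rho> p \<theta> u v"
  shows "stable_weight (linearized_weight p \<theta> \<rho> u v)"
proof -
  note d = weighted_solutionD[OF a]
  have "continuous_on UNIV (linearized_weight p \<theta> \<rho> u v)"
    unfolding linearized_weight_def[abs_def]
    by (intro continuous_intros d(1) continuous_on_pos_powr C2_fun_continuous d)
  moreover obtain \<xi> \<zeta> where x: "C2_fun \<xi>" "C2_fun \<zeta>" "\<And>x. 0 < \<xi> x" "\<And>x. 0 < \<zeta> x"
    "\<And>x. - laplacian \<xi> x = p * \<rho> x * v x powr (p - 1) * \<zeta> x"
    "\<And>x. - laplacian \<zeta> x = \<theta> * \<rho> x * u x powr (\<theta> - 1) * \<xi> x"
    using st unfolding stable_classical_solution_def by blast
  moreover have "2 * linearized_weight p \<theta> \<rho> u v y \<le> - laplacian \<xi> y / \<xi> y - laplacian \<zeta> y / \<zeta> y" for y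
  proof -
    define a where "a = p * v y powr (p - 1) * (\<zeta> y / \<xi> y)"
    define b where "b = \<theta> * u y powr (\<theta> - 1) * (\<xi> y / \<zeta> y)"
    define w where "w = sqrt (p * \<theta>) * (u y powr ((\<theta> - 1) / 2) * v y powr ((p - 1) / 2))"
    have ab: "a \<ge> 0" "b \<ge> 0" using p x(3,4)[of y] by (auto simp: a_def b_def)
    have "w^2 = p * \<theta> * (u y powr (\<theta> - 1) * v y powr (p - 1))"
      using p unfolding w_def power_mult_distrib by (simp add: power2_eq_square flip: powr_add)
    also have "\<dots> = a * b" using x(3,4)[of y] by (simp add: a_def b_def)
    finally have "(2 * w)^2 \<le> (a + b)^2"
      using zero_le_power2[of "a - b"] by (simp add: power2_eq_square algebra_simps)
    then have "2 * w \<le> a + b" by (rule power2_le_imp_le) (use ab in simp)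
    then have "\<rho> y * (2 * w) \<le> \<rho> y * (a + b)" using weighted_solution_nonneg[OF a A] by (intro mult_left_mono) auto
    moreover have "- laplacian \<xi> y / \<xi> y = \<rho> y * a" "- laplacian \<zeta> y / \<zeta> y = \<rho> y * b"
      unfolding x by (simp_all add: a_def b_def)
    ultimately show ?thesis by (simp add: linearized_weight_def w_def algebra_simps)
  qed
  ultimately show ?thesis unfolding stable_weight_def by blast
qed

text \<open>Write P = u^(2q), Q = v^(2s), and W0 for the stability weight without its constant.
  Stability bounds the integrals of W0 P and W0 Q by gradient integrals, and the tested equations
  bound these, up to cutoff terms, by the integrals of W0 P^(1-c) Q^c and W0 P^c Q^(1-c), which
  \<open>young_pair\<close> absorbs. The requirement (p + 1)/4 \<le> s is c \<le> 1.\<close>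

lemma energy:
  fixes p \<theta> l s A \<alpha> :: real
  assumes p: "1 < p" "p \<le> \<theta>" and l: "l > 0" and A: "A > 0"
    and s: "quart p \<theta> s < 0" "1/2 < s" "(p + 1) / 4 \<le> s"
  shows "\<exists>C>0. \<forall>(\<rho>::real^'n::finite \<Rightarrow> real) u v \<eta> \<eta>'. weighted_solution p \<theta> \<alpha> A \<rho> u v \<longrightarrow> stable_weight (linearized_weight p \<theta> \<rho> u v) \<longrightarrow>
    (\<forall>x. u x \<le> l * v x powr ((p + 1) / (\<theta> + 1))) \<longrightarrow> has_grad \<eta> \<eta>' \<longrightarrow> cc \<eta> \<longrightarrow>
    (\<integral>x. \<rho> x * u x powr ((\<theta> - 1) / 2) * v x powr ((p - 1) / 2 + 2 * s) * (\<eta> x)^2 \<partial>lborel)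
      \<le> C * (\<integral>x. v x powr (2 * s) * (norm (\<eta>' x))^2 \<partial>lborel) \<and>
    (\<integral>x. (norm (grad_powr_mult s v \<eta> \<eta>' x))^2 \<partial>lborel) \<le> C * (\<integral>x. v x powr (2 * s) * (norm (\<eta>' x))^2 \<partial>lborel)"
proof -
  define \<kappa> where "\<kappa> = (\<theta> + 1) / (p + 1)"
  define q where "q = \<kappa> * s"
  define S where "S = sqrt (p * \<theta>)"
  define c where "c = (p + 1) / (4 * s)"
  have k: "\<kappa> \<ge> 1" using p by (simp add: \<kappa>_def)
  have q: "q \<ge> s" using k s mult_right_mono[of 1 \<kappa> s] by (simp add: q_def)
  have pt: "p * \<theta> > 1" using p less_1_mult[of p \<theta>] by simp
  have S: "S > 0" "S^2 = p * \<theta>" using pt by (auto simp: S_def)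
  have c: "0 < c" "c \<le> 1" using s p by (auto simp: c_def field_simps)
  have pos: "2 * q - 1 > 0" "2 * s - 1 > 0" "q > 0" "s > 0" using s q by auto
  define a0 where "a0 \<epsilon> = (q^2 + q * \<epsilon>) / (2 * q - 1 - \<epsilon>)" for \<epsilon>
  define b0 where "b0 \<epsilon> = (s^2 + s * \<epsilon>) / (2 * s - 1 - \<epsilon>)" for \<epsilon>
  \<comment> \<open>The limit is q^2 s^2/((2q - 1)(2s - 1) p\<theta>), below 1 by the quartic
    condition; strictness leaves room for a positive \<epsilon>.\<close>
  have "((\<lambda>\<epsilon>. a0 \<epsilon> / S * (b0 \<epsilon> / S)) \<longlongrightarrow> (q^2 + q * 0) / (2 * q - 1 - 0) / S * ((s^2 + s * 0) / (2 * s - 1 - 0) / S)) (at_right 0)"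
    unfolding a0_def b0_def using pos S by (intro tendsto_intros) auto
  moreover have "(q^2 + q * 0) / (2 * q - 1 - 0) / S * ((s^2 + s * 0) / (2 * s - 1 - 0) / S) < 1"
  proof -
    have "q^2 * s^2 < S^2 * ((2 * s - 1) * (2 * q - 1))"
      using s(1) unfolding quart_def S(2) q_def \<kappa>_def[symmetric] by (simp add: power2_eq_square power4_eq_xxxx algebra_simps)
    moreover have "S^2 * ((2 * s - 1) * (2 * q - 1)) > 0" using pos S(1) by simp
    ultimately have "q^2 * s^2 / (S^2 * ((2 * s - 1) * (2 * q - 1))) < 1" by simp
    then show ?thesis by (simp add: power2_eq_square field_simps)
  qed
  ultimately have "eventually (\<lambda>\<epsilon>. a0 \<epsilon> / S * (b0 \<epsilon> / S) < 1) (at_right 0)" by (rule order_tendstoD(2))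
  moreover have "eventually (\<lambda>\<epsilon>::real. \<epsilon> < 2 * s - 1) (at_right 0)"
    by (rule order_tendstoD(2)[OF tendsto_ident_at pos(2)])
  moreover have "eventually (\<lambda>\<epsilon>::real. 0 < \<epsilon>) (at_right 0)" by (rule eventually_at_right_less)
  ultimately have "eventually (\<lambda>\<epsilon>. a0 \<epsilon> / S * (b0 \<epsilon> / S) < 1 \<and> \<epsilon> < 2 * s - 1 \<and> 0 < \<epsilon>) (at_right 0)"
    by eventually_elim auto
  then obtain \<epsilon> where e: "a0 \<epsilon> / S * (b0 \<epsilon> / S) < 1" "\<epsilon> < 2 * s - 1" "0 < \<epsilon>"
    using eventually_happens'[of "at_right (0::real)"] by auto
  have eq: "\<epsilon> < 2 * q - 1" using e q by simp
  define a where "a = a0 \<epsilon>"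
  define b where "b = b0 \<epsilon>"
  have ab: "a > 0" "b > 0" using pos e eq by (auto simp: a_def b_def a0_def b0_def intro!: divide_pos_pos add_pos_pos)
  define Cu where "Cu = a / \<epsilon> + 1 + q / \<epsilon>"
  define Cv where "Cv = b / \<epsilon> + 1 + s / \<epsilon>"
  have CC: "Cu > 0" "Cv > 0" using ab e pos by (auto simp: Cu_def Cv_def intro!: add_pos_pos)
  obtain \<gamma> \<mu> where g: "0 < \<gamma>" "\<gamma> < 1" "0 < \<mu>" and yp: "\<And>P Q. 0 < P \<Longrightarrow> 0 < Q \<Longrightarrow>
    a / S * (P powr (1 - c) * Q powr c) + \<mu> * (b / S) * (P powr c * Q powr (1 - c)) \<le> \<gamma> * (P + \<mu> * Q)"
    using young_pair[of "a / S" "b / S" c] ab S c e(1) unfolding a_def b_def by auto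
  define L where "L = (Cu * l powr (2 * q) + \<mu> * Cv) / S"
  have L: "L > 0" unfolding L_def using CC g S l by (intro divide_pos_pos add_pos_pos mult_pos_pos) auto
  define C1 where "C1 = L / (1 - \<gamma>) / \<mu>"
  define C2 where "C2 = b * (S * (\<gamma> * (L / (1 - \<gamma>))) / (\<mu> * b)) + Cv"
  have C12: "C1 > 0" "C2 > 0" using L g CC ab S by (auto simp: C1_def C2_def intro!: add_pos_pos)
  have main: "(\<integral>x. \<rho> x * u x powr ((\<theta> - 1) / 2) * v x powr ((p - 1) / 2 + 2 * s) * (\<eta> x)^2 \<partial>lborel)
      \<le> C1 * (\<integral>x. v x powr (2 * s) * (norm (\<eta>' x))^2 \<partial>lborel) \<and>
    (\<integral>x. (norm (grad_powr_mult s v \<eta> \<eta>' x))^2 \<partial>lborel) \<le> C2 * (\<integral>x. v x powr (2 * s) * (norm (\<eta>' x))^2 \<partial>lborel)"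
    if ad: "weighted_solution p \<theta> \<alpha> A \<rho> u v" and W: "stable_weight (linearized_weight p \<theta> \<rho> u v)"
      and comp: "\<forall>x. u x \<le> l * v x powr ((p + 1) / (\<theta> + 1))" and h: "has_grad \<eta> \<eta>'" "cc \<eta>"
    for \<rho> u v \<eta> :: "real^'n \<Rightarrow> real" and \<eta>'
  proof -
    note d = weighted_solutionD[OF ad]
    note cu = C2_fun_continuous[OF d(3)] and cv = C2_fun_continuous[OF d(4)]
    note pu = continuous_on_pos_powr[OF cu d(5)] and pv = continuous_on_pos_powr[OF cv d(6)]
    have h2: "cc (\<lambda>x. (\<eta> x)^2)" using cc_norm_power[OF h(2), of 2] by simp
    have h2': "cc (\<lambda>x. (norm (\<eta>' x))^2)" by (rule cc_norm_power[OF cc_grad[OF h(2,1)]]) simp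
    define W0 where "W0 x = \<rho> x * u x powr ((\<theta> - 1) / 2) * v x powr ((p - 1) / 2)" for x
    define P where "P x = u x powr (2 * q)" for x
    define Q where "Q x = v x powr (2 * s)" for x
    have PQ: "P x > 0" "Q x > 0" for x using d(5,6)[of x] by (simp_all add: P_def Q_def)
    have W0: "W0 x \<ge> 0" for x using weighted_solution_nonneg[OF ad A] by (simp add: W0_def)
    have cW: "continuous_on UNIV W0" "continuous_on UNIV P" "continuous_on UNIV Q"
      unfolding W0_def[abs_def] P_def[abs_def] Q_def[abs_def] by (intro continuous_intros d(1) pu pv)+
    have qs: "2 * q * c = (\<theta> + 1) / 2" "2 * s * c = (p + 1) / 2"
    proof -
      have "2 * (t / w * s) * (w / (4 * s)) = t / 2" if "w \<noteq> 0" for t w using that pos(4) by simp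
      from this[of "p + 1" "\<theta> + 1"] show "2 * q * c = (\<theta> + 1) / 2" using p by (simp add: q_def \<kappa>_def c_def)
      show "2 * s * c = (p + 1) / 2" using pos(4) by (simp add: c_def)
    qed
    have i1: "W0 x * (P x powr (1 - c) * Q x powr c) = \<rho> x * v x powr p * u x powr (2 * q - 1)" for x
    proof -
      have "P x powr (1 - c) = u x powr (2 * q - (\<theta> + 1) / 2)" "Q x powr c = v x powr ((p + 1) / 2)"
        unfolding P_def Q_def powr_powr qs(1)[symmetric] qs(2)[symmetric] by (simp_all add: algebra_simps)
      moreover have "u x powr ((\<theta> - 1) / 2) * u x powr (2 * q - (\<theta> + 1) / 2) = u x powr (2 * q - 1)"
        "v x powr ((p - 1) / 2) * v x powr ((p + 1) / 2) = v x powr p"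
        unfolding powr_add[symmetric] by (rule arg_cong2[where f="(powr)", OF refl], simp add: field_simps)+
      ultimately show ?thesis unfolding W0_def by (simp add: mult_ac) (metis mult.assoc mult.left_commute)
    qed
    have i2: "W0 x * (P x powr c * Q x powr (1 - c)) = \<rho> x * u x powr \<theta> * v x powr (2 * s - 1)" for x
    proof -
      have "P x powr c = u x powr ((\<theta> + 1) / 2)" "Q x powr (1 - c) = v x powr (2 * s - (p + 1) / 2)"
        unfolding P_def Q_def powr_powr qs(1)[symmetric] qs(2)[symmetric] by (simp_all add: algebra_simps)
      moreover have "u x powr ((\<theta> - 1) / 2) * u x powr ((\<theta> + 1) / 2) = u x powr \<theta>"
        "v x powr ((p - 1) / 2) * v x powr (2 * s - (p + 1) / 2) = v x powr (2 * s - 1)"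
        unfolding powr_add[symmetric] by (rule arg_cong2[where f="(powr)", OF refl], simp add: field_simps)+
      ultimately show ?thesis unfolding W0_def by (simp add: mult_ac)
    qed
    define X where "X x = W0 x * P x * (\<eta> x)^2" for x
    define Y where "Y x = W0 x * Q x * (\<eta> x)^2" for x
    define I where "I x = \<rho> x * v x powr p * u x powr (2 * q - 1) * (\<eta> x)^2" for x
    define J where "J x = \<rho> x * u x powr \<theta> * v x powr (2 * s - 1) * (\<eta> x)^2" for x
    define KP where "KP x = P x * (norm (\<eta>' x))^2" for x
    define KQ where "KQ x = Q x * (norm (\<eta>' x))^2" for x
    have cX: "cc X" unfolding X_def[abs_def] by (intro cc_mult2[OF h2] continuous_intros cW)
    have cY: "cc Y" unfolding Y_def[abs_def] by (intro cc_mult2[OF h2] continuous_intros cW)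
    have cI: "cc I" unfolding I_def[abs_def] by (intro cc_mult2[OF h2] continuous_intros d(1) pu pv)
    have cJ: "cc J" unfolding J_def[abs_def] by (intro cc_mult2[OF h2] continuous_intros d(1) pu pv)
    have cKP: "cc KP" unfolding KP_def[abs_def] by (intro cc_mult2[OF h2'] cW)
    have cKQ: "cc KQ" unfolding KQ_def[abs_def] by (intro cc_mult2[OF h2'] cW)
    define iX iY iI iJ iP iQ where "iX = integral\<^sup>L lborel X" and "iY = integral\<^sup>L lborel Y" and "iI = integral\<^sup>L lborel I"
      and "iJ = integral\<^sup>L lborel J" and "iP = integral\<^sup>L lborel KP" and "iQ = integral\<^sup>L lborel KQ"
    note int = cc_integrable[OF cX] cc_integrable[OF cY] cc_integrable[OF cI] cc_integrable[OF cJ] cc_integrable[OF cKP] cc_integrable[OF cKQ]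
    have cacu: "(\<integral>x. (norm (grad_powr_mult q u \<eta> \<eta>' x))^2 \<partial>lborel) \<le> a * iI + Cu * iP"
      using caccioppoli[OF d(3,5) h e(3) eq]
      by (simp add: d(7) a_def a0_def Cu_def iI_def I_def[abs_def] iP_def KP_def[abs_def] P_def)
    have cacv: "(\<integral>x. (norm (grad_powr_mult s v \<eta> \<eta>' x))^2 \<partial>lborel) \<le> b * iJ + Cv * iQ"
      using caccioppoli[OF d(4,6) h e(3,2)]
      by (simp add: d(8) b_def b0_def Cv_def iJ_def J_def[abs_def] iQ_def KQ_def[abs_def] Q_def)
    have stu: "S * iX \<le> (\<integral>x. (norm (grad_powr_mult q u \<eta> \<eta>' x))^2 \<partial>lborel)"
    proof -
      have "cc (\<lambda>x. u x powr q * \<eta> x)" by (intro cc_mult2[OF h(2)] pu)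
      note stable_weightD[OF W has_grad_powr_mult[OF d(3,5) h(1)] this]
      moreover have "linearized_weight p \<theta> \<rho> u v x * (u x powr q * \<eta> x)^2 = S * X x" for x
        unfolding linearized_weight_def S_def X_def W0_def P_def
        by (simp add: power_mult_distrib power2_eq_square flip: powr_add)
      ultimately show ?thesis by (simp add: iX_def)
    qed
    have stv: "S * iY \<le> (\<integral>x. (norm (grad_powr_mult s v \<eta> \<eta>' x))^2 \<partial>lborel)"
    proof -
      have "cc (\<lambda>x. v x powr s * \<eta> x)" by (intro cc_mult2[OF h(2)] pv)
      note stable_weightD[OF W has_grad_powr_mult[OF d(4,6) h(1)] this]
      moreover have "linearized_weight p \<theta> \<rho> u v x * (v x powr s * \<eta> x)^2 = S * Y x" for x
        unfolding linearized_weight_def S_def Y_def W0_def Q_def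
        by (simp add: power_mult_distrib power2_eq_square flip: powr_add)
      ultimately show ?thesis by (simp add: iY_def)
    qed
    \<comment> \<open>The pointwise comparison enters here: q is chosen so that (p + 1)/(\<theta> +
      1) times 2q is 2s, and the cutoff term of u becomes one of v.\<close>
    have PleQ: "P x \<le> l powr (2 * q) * Q x" for x
    proof -
      have "P x \<le> (l * v x powr ((p + 1) / (\<theta> + 1))) powr (2 * q)"
        unfolding P_def using comp d(5)[of x] pos by (intro powr_mono2) auto
      also have "\<dots> = l powr (2 * q) * v x powr ((p + 1) / (\<theta> + 1) * (2 * q))" using l by (simp add: powr_mult powr_powr)
      also have "(p + 1) / (\<theta> + 1) * (2 * q) = 2 * s" using p by (simp add: q_def \<kappa>_def)
      finally show ?thesis by (simp add: Q_def)
    qed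
    have iPQ: "iP \<le> l powr (2 * q) * iQ"
    proof -
      have "iP \<le> (\<integral>x. l powr (2 * q) * KQ x \<partial>lborel)" unfolding iP_def
      proof (rule cc_integral_mono[OF cKP])
        show "KP x \<le> l powr (2 * q) * KQ x" for x
          using mult_right_mono[OF PleQ[of x], of "(norm (\<eta>' x))^2"] by (simp add: KP_def KQ_def mult.assoc)
      qed (intro cc_cmult cKQ)
      then show ?thesis by (simp add: iQ_def)
    qed
    have pw: "a / S * I x + \<mu> * (b / S) * J x \<le> \<gamma> * (X x + \<mu> * Y x)" for x
    proof -
      have "W0 x * (\<eta> x)^2 * (a / S * (P x powr (1 - c) * Q x powr c) + \<mu> * (b / S) * (P x powr c * Q x powr (1 - c)))
          \<le> W0 x * (\<eta> x)^2 * (\<gamma> * (P x + \<mu> * Q x))"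
        using W0 by (intro mult_left_mono yp PQ) auto
      moreover have "I x = (\<eta> x)^2 * (W0 x * (P x powr (1 - c) * Q x powr c))" "J x = (\<eta> x)^2 * (W0 x * (P x powr c * Q x powr (1 - c)))"
        unfolding i1 i2 by (simp_all add: I_def J_def)
      ultimately show ?thesis by (simp add: X_def Y_def algebra_simps)
    qed
    have pwi: "a / S * iI + \<mu> * (b / S) * iJ \<le> \<gamma> * (iX + \<mu> * iY)"
    proof -
      have "(\<integral>x. a / S * I x + \<mu> * (b / S) * J x \<partial>lborel) \<le> (\<integral>x. \<gamma> * (X x + \<mu> * Y x) \<partial>lborel)"
        by (intro cc_integral_mono cc_add cc_cmult cI cJ cX cY pw)
      then show ?thesis using int by (simp add: iI_def iJ_def iX_def iY_def)
    qed
    have nn: "0 \<le> iX" "0 \<le> iI" "0 \<le> iQ" "0 \<le> iY"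
      unfolding iX_def iI_def iQ_def iY_def X_def I_def KQ_def Y_def
      using W0 PQ weighted_solution_nonneg[OF ad A] by (auto intro!: Bochner_Integration.integral_nonneg mult_nonneg_nonneg less_imp_le[OF PQ(1)] less_imp_le[OF PQ(2)])
    have "iX + \<mu> * iY \<le> (a * iI + Cu * iP) / S + \<mu> * ((b * iJ + Cv * iQ) / S)"
      using order_trans[OF stu cacu] order_trans[OF stv cacv] S g by (intro add_mono mult_left_mono) (auto simp: field_simps)
    also have "\<dots> = (a / S * iI + \<mu> * (b / S) * iJ) + (Cu * iP + \<mu> * Cv * iQ) / S" using S by (simp add: field_simps)
    also have "\<dots> \<le> \<gamma> * (iX + \<mu> * iY) + L * iQ"
    proof (rule add_mono[OF pwi])
      have "Cu * iP + \<mu> * Cv * iQ \<le> Cu * (l powr (2 * q) * iQ) + \<mu> * Cv * iQ" using iPQ CC by simp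
      then have "(Cu * iP + \<mu> * Cv * iQ) / S \<le> (Cu * (l powr (2 * q) * iQ) + \<mu> * Cv * iQ) / S"
        using S(1) by (intro divide_right_mono) auto
      also have "\<dots> = L * iQ" by (simp add: L_def algebra_simps add_divide_distrib)
      finally show "(Cu * iP + \<mu> * Cv * iQ) / S \<le> L * iQ" .
    qed
    \<comment> \<open>The absorption: \<gamma> < 1 lets the interpolated terms move to the
      left.\<close>
    finally have "(1 - \<gamma>) * (iX + \<mu> * iY) \<le> L * iQ" by (simp add: algebra_simps)
    then have XY: "iX + \<mu> * iY \<le> L / (1 - \<gamma>) * iQ" using g by (simp add: field_simps)
    then have "\<mu> * iY \<le> L / (1 - \<gamma>) * iQ" using nn by simp
    then have Y1: "iY \<le> C1 * iQ" using g by (simp add: C1_def field_simps)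
    \<comment> \<open>Dropping the nonnegative \<open>iI\<close> from the interpolation bound
      isolates \<open>iJ\<close>, which the gradient of v^s \<eta> still needs.\<close>
    have "0 \<le> a / S * iI" using ab S nn by simp
    moreover have "\<gamma> * (iX + \<mu> * iY) \<le> \<gamma> * (L / (1 - \<gamma>) * iQ)" using XY g by (intro mult_left_mono) auto
    ultimately have "\<mu> * (b / S) * iJ \<le> \<gamma> * (L / (1 - \<gamma>)) * iQ" using pwi by simp
    then have "iJ \<le> S * (\<gamma> * (L / (1 - \<gamma>))) / (\<mu> * b) * iQ"
      using g ab S by (simp add: field_simps)
    then have "b * iJ \<le> b * (S * (\<gamma> * (L / (1 - \<gamma>))) / (\<mu> * b) * iQ)" using ab by (intro mult_left_mono) auto
    then have Y2: "(\<integral>x. (norm (grad_powr_mult s v \<eta> \<eta>' x))^2 \<partial>lborel) \<le> C2 * iQ"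
      using cacv by (simp add: C2_def algebra_simps)
    have Yeq: "(\<lambda>x. \<rho> x * u x powr ((\<theta> - 1) / 2) * v x powr ((p - 1) / 2 + 2 * s) * (\<eta> x)^2) = Y"
      by (rule ext) (simp add: Y_def W0_def Q_def powr_add mult.assoc)
    show ?thesis unfolding Yeq using Y1 Y2 by (simp add: iY_def iQ_def KQ_def[abs_def] Q_def)
  qed
  show ?thesis
  proof (intro exI[of _ "C1 + C2"] conjI allI impI)
    fix \<rho> u v \<eta> :: "real^'n \<Rightarrow> real" and \<eta>'
    assume as: "weighted_solution p \<theta> \<alpha> A \<rho> u v" "stable_weight (linearized_weight p \<theta> \<rho> u v)"
      "\<forall>x. u x \<le> l * v x powr ((p + 1) / (\<theta> + 1))" "has_grad \<eta> \<eta>'" "cc \<eta>"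
    define iQ where "iQ = (\<integral>x. v x powr (2 * s) * (norm (\<eta>' x))^2 \<partial>lborel)"
    have "0 \<le> iQ" unfolding iQ_def by (intro Bochner_Integration.integral_nonneg) auto
    then have "C1 * iQ \<le> (C1 + C2) * iQ" "C2 * iQ \<le> (C1 + C2) * iQ" using C12 by (auto intro: mult_right_mono)
    then show "(\<integral>x. \<rho> x * u x powr ((\<theta> - 1) / 2) * v x powr ((p - 1) / 2 + 2 * s) * (\<eta> x)^2 \<partial>lborel)
        \<le> (C1 + C2) * (\<integral>x. v x powr (2 * s) * (norm (\<eta>' x))^2 \<partial>lborel)"
      "(\<integral>x. (norm (grad_powr_mult s v \<eta> \<eta>' x))^2 \<partial>lborel) \<le> (C1 + C2) * (\<integral>x. v x powr (2 * s) * (norm (\<eta>' x))^2 \<partial>lborel)"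
      using main[OF as] unfolding iQ_def by linarith+
  qed (use C12 in simp)
qed

subsection \<open>Rescaling and comparison of the components\<close>

definition rescale :: "real \<Rightarrow> real \<Rightarrow> (real^'n::finite \<Rightarrow> real) \<Rightarrow> real^'n \<Rightarrow> real" where
  "rescale e R f x = R powr e * f (R *\<^sub>R x)"

lemma C2_fun_rescale:
  assumes "C2_fun f"
  shows "C2_fun (rescale e R f)" "laplacian (rescale e R f) x = R powr e * (R^2 * laplacian f (R *\<^sub>R x))"
proof -
  have a: "C2_fun (\<lambda>x. f (R *\<^sub>R x))" "laplacian (\<lambda>x. f (R *\<^sub>R x)) = (\<lambda>x. R^2 * laplacian f (R *\<^sub>R x))"
    using C2_fun_affine[OF assms, of 0 R] by simp_all
  show "C2_fun (rescale e R f)" "laplacian (rescale e R f) x = R powr e * (R^2 * laplacian f (R *\<^sub>R x))"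
    unfolding rescale_def[abs_def] using C2_fun_cmult[OF a(1), of "R powr e"] a(2) by simp_all
qed

text \<open>Because the class is invariant under this rescaling, the estimates are only needed at unit scale, with
  constants that do not depend on the solution.\<close>

lemma weighted_solution_rescale:
  assumes a: "weighted_solution p \<theta> \<alpha> A \<rho> u v" and R: "R > 0" and A: "A > 0" and E: "E * (p * \<theta> - 1) = 2 + \<alpha>"
  shows "weighted_solution p \<theta> \<alpha> A (rescale (- \<alpha>) R \<rho>) (rescale (E * (p + 1)) R u) (rescale (E * (\<theta> + 1)) R v)"
proof -
  note d = weighted_solutionD[OF a]
  have R2: "R^2 = R powr 2" using R by (simp add: powr_numeral)
  \<comment> \<open>Both identities are E(p\<theta> - 1) = 2 + \<alpha> rewritten; each says that
    one equation keeps its form under the dilation.\<close>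
  have e1: "E * (p + 1) + 2 = - \<alpha> + E * (\<theta> + 1) * p" and e2: "E * (\<theta> + 1) + 2 = - \<alpha> + E * (p + 1) * \<theta>"
    using E by (simp_all add: algebra_simps)
  have l1: "- laplacian (rescale (E * (p + 1)) R u) x = rescale (- \<alpha>) R \<rho> x * rescale (E * (\<theta> + 1)) R v x powr p" for x
  proof -
    have "- laplacian (rescale (E * (p + 1)) R u) x = R powr (E * (p + 1) + 2) * (\<rho> (R *\<^sub>R x) * v (R *\<^sub>R x) powr p)"
      unfolding C2_fun_rescale[OF d(3)] d(7) R2 powr_add by simp
    also have "\<dots> = rescale (- \<alpha>) R \<rho> x * rescale (E * (\<theta> + 1)) R v x powr p"
      unfolding e1 powr_add rescale_def by (simp add: powr_mult powr_powr)
    finally show ?thesis .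
  qed
  have l2: "- laplacian (rescale (E * (\<theta> + 1)) R v) x = rescale (- \<alpha>) R \<rho> x * rescale (E * (p + 1)) R u x powr \<theta>" for x
  proof -
    have "- laplacian (rescale (E * (\<theta> + 1)) R v) x = R powr (E * (\<theta> + 1) + 2) * (\<rho> (R *\<^sub>R x) * u (R *\<^sub>R x) powr \<theta>)"
      unfolding C2_fun_rescale[OF d(4)] d(8) R2 powr_add by simp
    also have "\<dots> = rescale (- \<alpha>) R \<rho> x * rescale (E * (p + 1)) R u x powr \<theta>"
      unfolding e2 powr_add rescale_def by (simp add: powr_mult powr_powr)
    finally show ?thesis .
  qed
  have "A * norm x powr \<alpha> \<le> rescale (- \<alpha>) R \<rho> x" for x
  proof -
    have "A * norm x powr \<alpha> = R powr (- \<alpha>) * (A * norm (R *\<^sub>R x) powr \<alpha>)"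
      using R by (simp add: powr_mult powr_minus field_simps)
    also have "\<dots> \<le> R powr (- \<alpha>) * \<rho> (R *\<^sub>R x)" by (intro mult_left_mono d(2)) simp
    finally show ?thesis by (simp add: rescale_def)
  qed
  moreover have "continuous_on UNIV (rescale (- \<alpha>) R \<rho>)"
    unfolding rescale_def[abs_def] by (intro continuous_intros continuous_on_compose2[OF d(1)]) auto
  ultimately show ?thesis
    unfolding weighted_solution_def classical_solution_def
    using C2_fun_rescale(1)[OF d(3)] C2_fun_rescale(1)[OF d(4)] l1 l2 d(5,6) R by (auto simp: rescale_def)
qed

lemma stable_weight_rescale:
  assumes "stable_weight W" "R > 0" shows "stable_weight (\<lambda>x. R^2 * W (R *\<^sub>R x))"
proof -
  obtain \<xi> \<zeta> where x: "C2_fun \<xi>" "C2_fun \<zeta>" "\<And>x. 0 < \<xi> x" "\<And>x. 0 < \<zeta> x"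
    and le: "\<And>x. 2 * W x \<le> - laplacian \<xi> x / \<xi> x - laplacian \<zeta> x / \<zeta> x" and W: "continuous_on UNIV W"
    using assms(1) unfolding stable_weight_def by blast
  have "continuous_on UNIV (\<lambda>x. R^2 * W (R *\<^sub>R x))"
    by (intro continuous_intros continuous_on_compose2[OF W]) auto
  moreover have "2 * (R^2 * W (R *\<^sub>R y)) \<le> - laplacian (rescale 0 R \<xi>) y / rescale 0 R \<xi> y - laplacian (rescale 0 R \<zeta>) y / rescale 0 R \<zeta> y" for y
    using mult_left_mono[OF le[of "R *\<^sub>R y"], of "R^2"] assms(2)
    by (simp add: C2_fun_rescale x rescale_def algebra_simps)
  ultimately show ?thesis
    unfolding stable_weight_def using C2_fun_rescale(1)[OF x(1)] C2_fun_rescale(1)[OF x(2)] x(3,4) assms(2)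
    by (intro conjI exI[of _ "rescale 0 R \<xi>"] exI[of _ "rescale 0 R \<zeta>"]) (auto simp: rescale_def)
qed

text \<open>The exponents add up to 2, the scaling of a potential in a second-order
  inequality.\<close>

lemma linearized_weight_rescale:
  assumes R: "R > 0" and E: "E * (p * \<theta> - 1) = 2 + \<alpha>"
  shows "linearized_weight p \<theta> (rescale (- \<alpha>) R \<rho>) (rescale (E * (p + 1)) R u) (rescale (E * (\<theta> + 1)) R v) = (\<lambda>x. R^2 * linearized_weight p \<theta> \<rho> u v (R *\<^sub>R x))"
proof
  fix x
  have "- \<alpha> + E * (p + 1) * ((\<theta> - 1) / 2) + E * (\<theta> + 1) * ((p - 1) / 2) = 2"
    using E by (simp add: field_simps)
  then have "R powr (- \<alpha>) * R powr (E * (p + 1) * ((\<theta> - 1) / 2)) * R powr (E * (\<theta> + 1) * ((p - 1) / 2)) = R^2"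
    using R by (simp add: powr_numeral flip: powr_add)
  then show "linearized_weight p \<theta> (rescale (- \<alpha>) R \<rho>) (rescale (E * (p + 1)) R u) (rescale (E * (\<theta> + 1)) R v) x = R^2 * linearized_weight p \<theta> \<rho> u v (R *\<^sub>R x)"
    unfolding linearized_weight_def rescale_def by (simp add: powr_mult powr_powr mult_ac)
qed

text \<open>From means of w^q at scale T to averages of w around any fixed centre. For large T the
  ball of radius T/2 about c lies inside the ball of radius T about 0, and w \<le> e1 + e1^(1-q) w^q
  plays the part of Hoelder's inequality.\<close>

lemma avg_bump_small:
  fixes w :: "real^'n::finite \<Rightarrow> real" and c :: "real^'n"
  assumes w: "continuous_on UNIV w" "\<And>x. 0 < w x" and q: "q > 1" and om: "is_cutoff 1 \<omega>" and m: "m \<ge> 2"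
    and b: "\<beta> > 0" "K > 0" and dec: "\<And>T. T > 0 \<Longrightarrow> (\<integral>x. w (T *\<^sub>R x) powr q * \<omega> x ^ m \<partial>lborel) \<le> K * T powr (- \<beta>)"
    and e: "e > 0"
  shows "\<exists>t>0. (\<integral>y. w (c + t *\<^sub>R y) * bump y \<partial>lborel) \<le> e"
proof -
  note d = is_cutoffD[OF om] and cp = cutoff_power[OF om m]
  define V where "V = (\<integral>x. \<omega> x ^ m \<partial>lborel)"
  have V: "V > 0" unfolding V_def
    by (rule cc_integral_pos[OF cp(2), of 0]) (use d(2) d(4)[of 0] in auto)
  define N where "N = CARD('n)"
  define e1 where "e1 = e / (2 * 2^N * V)"
  have e1: "e1 > 0" using e V by (simp add: e1_def)
  have "((\<lambda>T. e1 powr (1 - q) * (K * T powr (- \<beta>))) \<longlongrightarrow> e1 powr (1 - q) * (K * 0)) at_top"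
    by (intro tendsto_intros tendsto_neg_powr filterlim_ident) (use b in auto)
  then have "eventually (\<lambda>T. e1 powr (1 - q) * (K * T powr (- \<beta>)) < e1 * V) at_top"
    using e1 V by (intro order_tendstoD(2)) auto
  moreover have "eventually (\<lambda>T::real. T \<ge> 1 + 2 * norm c) at_top" by (rule eventually_ge_at_top)
  ultimately have "eventually (\<lambda>T. e1 powr (1 - q) * (K * T powr (- \<beta>)) < e1 * V \<and> T \<ge> 1 + 2 * norm c) at_top"
    by eventually_elim auto
  then obtain T where T: "e1 powr (1 - q) * (K * T powr (- \<beta>)) < e1 * V" "T \<ge> 1 + 2 * norm c"
    using eventually_happens'[of "at_top :: real filter"] by auto
  have T0: "T > 0" using T(2) norm_ge_zero[of c] by linarith
  define t where "t = T / 2"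
  \<comment> \<open>The centre in the new variable: c + t (a + 2 z) = T z, and |a| \<le> 1 by the
    choice of T.\<close>
  define a where "a = (- 2 / T) *\<^sub>R c"
  have na: "norm a \<le> 1" using T T0 by (simp add: a_def)
  have wT: "continuous_on UNIV (\<lambda>x. w (T *\<^sub>R x))" "continuous_on UNIV (\<lambda>y. w (c + t *\<^sub>R y))"
    by (intro continuous_on_compose2[OF w(1)] continuous_intros; auto)+
  have c1: "cc (\<lambda>y. w (c + t *\<^sub>R y) * bump y)" by (rule cc_mult2[OF cc_bump wT(2)])
  have c2: "cc (\<lambda>x. w (T *\<^sub>R x) powr q * \<omega> x ^ m)"
    using w(2) by (intro cc_mult2[OF cp(2)] continuous_on_pos_powr wT) auto
  have aff: "c + t *\<^sub>R (a + 2 *\<^sub>R z) = T *\<^sub>R z" for z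
    using T0 by (simp add: t_def a_def algebra_simps)
  have "(\<integral>y. w (c + t *\<^sub>R y) * bump y \<partial>lborel) / 2^N = (\<integral>z. w (T *\<^sub>R z) * bump (a + 2 *\<^sub>R z) \<partial>lborel)"
    using cc_integral_affine[OF _ c1, of 2 a] unfolding aff N_def by simp
  also have "\<dots> \<le> (\<integral>z. e1 * \<omega> z ^ m + e1 powr (1 - q) * (w (T *\<^sub>R z) powr q * \<omega> z ^ m) \<partial>lborel)"
  proof (rule cc_integral_mono)
    show "cc (\<lambda>z. w (T *\<^sub>R z) * bump (a + 2 *\<^sub>R z))"
      using cc_affine[OF c1, of 2 a] unfolding aff by simp
    show "cc (\<lambda>z. e1 * \<omega> z ^ m + e1 powr (1 - q) * (w (T *\<^sub>R z) powr q * \<omega> z ^ m))"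
      by (intro cc_add cc_cmult cp(2) c2)
    fix z
    let ?w = "w (T *\<^sub>R z)"
    have wpos: "?w > 0" by (rule w(2))
    have bl: "bump (a + 2 *\<^sub>R z) \<le> \<omega> z ^ m"
    proof (cases "norm z \<le> 1")
      case True then show ?thesis using d(4)[OF True] bump_le_1 by simp
    next
      case False
      have "norm (2 *\<^sub>R z) \<le> norm (a + 2 *\<^sub>R z) + norm a"
        using norm_triangle_ineq4[of "a + 2 *\<^sub>R z" a] by simp
      then have "1 < norm (a + 2 *\<^sub>R z)" using False na by simp
      then have "bump (a + 2 *\<^sub>R z) = 0" by (rule bump_outside)
      then show ?thesis using d(2)[of z] by simp
    qed
    have "?w \<le> e1 + e1 powr (1 - q) * ?w powr q"
    proof (cases "?w \<le> e1")
      case True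
      moreover have "0 \<le> e1 powr (1 - q) * ?w powr q" by simp
      ultimately show ?thesis by linarith
    next
      case False
      have "?w = ?w powr (1 - q) * ?w powr q" using wpos by (simp flip: powr_add)
      also have "\<dots> \<le> e1 powr (1 - q) * ?w powr q"
        using False e1 q by (intro mult_right_mono powr_mono2') auto
      finally show ?thesis using e1 by linarith
    qed
    then have "?w * \<omega> z ^ m \<le> (e1 + e1 powr (1 - q) * ?w powr q) * \<omega> z ^ m" using d(2) by (intro mult_right_mono) auto
    moreover have "?w * bump (a + 2 *\<^sub>R z) \<le> ?w * \<omega> z ^ m" using bl wpos by (intro mult_left_mono) auto
    ultimately show "?w * bump (a + 2 *\<^sub>R z) \<le> e1 * \<omega> z ^ m + e1 powr (1 - q) * (?w powr q * \<omega> z ^ m)"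
      by (simp add: algebra_simps)
  qed
  also have "\<dots> = e1 * V + e1 powr (1 - q) * (\<integral>z. w (T *\<^sub>R z) powr q * \<omega> z ^ m \<partial>lborel)"
    unfolding V_def using cc_integrable[OF cp(2)] cc_integrable[OF c2] by simp
  also have "\<dots> \<le> e1 * V + e1 powr (1 - q) * (K * T powr (- \<beta>))"
    using dec[OF T0] by (intro add_left_mono mult_left_mono) auto
  also have "\<dots> \<le> 2 * (e1 * V)" using T(1) by linarith
  also have "\<dots> = e / 2^N" using V by (simp add: e1_def)
  finally have "(\<integral>y. w (c + t *\<^sub>R y) * bump y \<partial>lborel) \<le> e" by (simp add: divide_le_cancel)
  then show ?thesis using T0 by (intro exI[of _ t]) (simp add: t_def)
qed

text \<open>The convex function \<open>(1 + t\<^sub>+\<^sup>4)\<^bsup>1/4\<^esup> - 1\<close> turns \<open>f\<close> into a subharmonic function of class \<open>C\<^sup>2\<close>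
  that vanishes exactly where \<open>f \<le> 0\<close> and still grows at most linearly.\<close>

lemma subharmonic_pos_part_zero:
  fixes f w :: "real^'n::finite \<Rightarrow> real"
  assumes f: "C2_fun f" and sub: "\<And>x. 0 < f x \<Longrightarrow> 0 \<le> laplacian f x"
    and w: "continuous_on UNIV w" "\<And>x. 0 \<le> w x" "\<And>x. f x \<le> w x"
    and small: "\<And>c e. e > 0 \<Longrightarrow> \<exists>t>0. (\<integral>y. w (c + t *\<^sub>R y) * bump y \<partial>lborel) \<le> e"
  shows "f c \<le> 0"
proof -
  define Y where "Y x = (max 0 (f x))^4" for x
  define h :: "real \<Rightarrow> real" where "h y = (1 + y) powr (1/4)" for y
  define h' :: "real \<Rightarrow> real" where "h' y = 1/4 * (1 + y) powr (-3/4)" for y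
  define h'' :: "real \<Rightarrow> real" where "h'' y = 1/4 * (-3/4 * (1 + y) powr (-7/4))" for y
  define z where "z x = h (Y x) + (-1)" for x
  have d4: "((\<lambda>s::real. (max 0 s)^4) has_real_derivative 4 * (max 0 s)^3) (at s)" for s
    using DERIV_max0_power[of 2 s] by (simp add: eval_nat_numeral)
  have d3: "((\<lambda>s::real. 4 * (max 0 s)^3) has_real_derivative 4 * (3 * (max 0 s)^2)) (at s)" for s
    by (rule DERIV_cmult[OF DERIV_max0_cube])
  have c2: "continuous_on UNIV (\<lambda>s::real. 4 * (3 * (max 0 s)^2))" by (intro continuous_intros)
  note CY = C2_fun_compose[OF f UNIV_I d4 d3 c2]
  have Y0: "Y x \<in> {0..}" for x by (simp add: Y_def)
  have dh: "(h has_real_derivative h' y) (at y)" if "y \<in> {0..}" for y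
    unfolding h_def[abs_def] h'_def
    by (rule DERIV_cong[OF DERIV_chain2[OF has_real_derivative_powr]]) (use that in \<open>auto intro!: derivative_eq_intros\<close>)
  have dh': "(h' has_real_derivative h'' y) (at y)" if "y \<in> {0..}" for y
    unfolding h'_def[abs_def] h''_def
    by (rule DERIV_cmult, rule DERIV_cong[OF DERIV_chain2[OF has_real_derivative_powr]]) (use that in \<open>auto intro!: derivative_eq_intros\<close>)
  have ch: "continuous_on {0..} h''" unfolding h''_def[abs_def] by (intro continuous_intros) auto
  note CZ = C2_fun_compose[OF CY(1)[folded Y_def] Y0 dh dh' ch]
  have z2: "C2_fun z"
    unfolding z_def[abs_def] by (rule C2_fun_add(1)[OF CZ(1) C2_fun_const])
  have lh: "laplacian (\<lambda>x. h (Y x)) = (\<lambda>x. h'' (Y x) * (norm (grad Y x))^2 + h' (Y x) * laplacian Y x)"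
    by (rule CZ(2))
  have "laplacian (\<lambda>x::real^'n. - 1) x = 0" for x
    by (rule laplacian_zero_open[OF C2_fun_const open_UNIV UNIV_I]) simp
  moreover have "laplacian z = (\<lambda>x. laplacian (\<lambda>x. h (Y x)) x + laplacian (\<lambda>x. - 1) x)"
    unfolding z_def[abs_def] by (rule C2_fun_add(2)[OF CZ(1) C2_fun_const])
  ultimately have lz: "laplacian z x = h'' (Y x) * (norm (grad Y x))^2 + h' (Y x) * laplacian Y x" for x
    using lh by simp
  have sub: "0 \<le> laplacian z x" for x
  proof -
    let ?P = "max 0 (f x)"
    let ?n = "(norm (grad f x))^2"
    have gY: "(norm (grad Y x))^2 = 16 * ?P^6 * ?n"
      using CY(3) by (simp add: Y_def[abs_def] power_mult_distrib power_mult[symmetric])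
    have lY: "laplacian Y x = 12 * ?P^2 * ?n + 4 * ?P^3 * laplacian f x"
      using CY(2) by (simp add: Y_def[abs_def])
    have pf: "0 \<le> ?P^3 * laplacian f x" using sub[of x] by (cases "f x > 0") (auto simp: max_def)
    define M where "M = (1 + Y x) powr (-7/4)"
    have M: "(1 + Y x) powr (-3/4) = M * (1 + Y x)"
    proof -
      have "(1 + Y x) powr (-7/4 + 1) = M * (1 + Y x) powr 1" unfolding M_def by (rule powr_add)
      then show ?thesis using Y0[of x] by simp
    qed
    \<comment> \<open>The terms with |grad f|^2 combine to 3 M P^2 (1 + Y - P^4), and Y = P^4 leaves
      exactly 1: this is the convexity of (1 + t^4)^(1/4).\<close>
    have "laplacian z x = 3 * M * ?P^2 * ?n * (1 + Y x - ?P^4) + M * (1 + Y x) * (?P^3 * laplacian f x)"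
      unfolding lz h'_def h''_def gY lY M M_def[symmetric] by (simp add: field_simps eval_nat_numeral)
    also have "1 + Y x - ?P^4 = 1" by (simp add: Y_def)
    also have "0 \<le> 3 * M * ?P^2 * ?n * 1 + M * (1 + Y x) * (?P^3 * laplacian f x)"
    proof (rule add_nonneg_nonneg)
      show "0 \<le> 3 * M * ?P^2 * ?n * 1" by (simp add: M_def)
      show "0 \<le> M * (1 + Y x) * (?P^3 * laplacian f x)"
        using Y0[of x] by (intro mult_nonneg_nonneg[OF _ pf]) (simp add: M_def)
    qed
    finally show ?thesis .
  qed
  \<comment> \<open>(1 + P^4)^(1/4) \<le> 1 + P keeps the truncation below \<open>w\<close>, so the
    averages of \<open>w\<close> control those of \<open>z\<close>.\<close>
  have zw: "z x \<le> w x" for x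
  proof -
    let ?P = "max 0 (f x)"
    have "1 + Y x \<le> (1 + ?P)^4" unfolding Y_def
      by (simp add: eval_nat_numeral algebra_simps)
    then have "h (Y x) \<le> ((1 + ?P)^4) powr (1/4)" unfolding h_def using Y0[of x] by (intro powr_mono2) auto
    also have "(1 + ?P)^4 = (1 + ?P) powr 4" by (simp add: powr_numeral)
    also have "((1 + ?P) powr 4) powr (1/4) = 1 + ?P" unfolding powr_powr by simp
    finally show ?thesis using w(2,3)[of x] by (simp add: z_def max_def split: if_splits)
  qed
  define B where "B = integral\<^sup>L lborel (bump :: real^'n \<Rightarrow> real)"
  have B: "B > 0" unfolding B_def by (rule integral_bump_pos)
  have "z c * B \<le> e" if e: "e > 0" for e
  proof -
    obtain t where t: "t > 0" "(\<integral>y. w (c + t *\<^sub>R y) * bump y \<partial>lborel) \<le> e" using small[OF e] by blast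
    have k: "continuous_on UNIV (\<lambda>y. z (c + t *\<^sub>R y))" "continuous_on UNIV (\<lambda>y. w (c + t *\<^sub>R y))"
      by (intro continuous_on_compose2[OF w(1)] continuous_on_compose2[OF C2_fun_continuous[OF z2]] continuous_intros; auto)+
    have "z c * B \<le> (\<integral>y. z (c + t *\<^sub>R y) * bump y \<partial>lborel)"
      unfolding B_def by (rule subharmonic_mean_value[OF z2 sub t(1)])
    also have "\<dots> \<le> (\<integral>y. w (c + t *\<^sub>R y) * bump y \<partial>lborel)"
      by (intro cc_integral_mono cc_mult2[OF cc_bump] k mult_right_mono zw bump_nonneg)
    finally show ?thesis using t(2) by simp
  qed
  then have "z c * B \<le> 0" by (rule field_le_epsilon[of _ 0, simplified])
  then have "z c \<le> 0" using B by (simp add: mult_le_0_iff)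
  then have "h (Y c) \<le> 1" by (simp add: z_def)
  have "Y c \<le> 0"
  proof (rule ccontr)
    assume "\<not> Y c \<le> 0"
    then have "(1::real) powr (1/4) < (1 + Y c) powr (1/4)" by (intro powr_less_mono2) auto
    then show False using \<open>h (Y c) \<le> 1\<close> by (simp add: h_def)
  qed
  then have "(max 0 (f c))^4 = 0" using Y0[of c] by (simp add: Y_def)
  then show ?thesis by (simp add: max_def split: if_splits)
qed

text \<open>The a priori bound for the solution rescaled by T, undone. Here \<rho> \<ge> A on the
  whole space lets \<rho> be dropped also near the origin.\<close>

lemma decay:
  fixes \<omega> u v :: "real^'n::finite \<Rightarrow> real"
  assumes p: "1 < p" "p \<le> \<theta>" and A: "A > 0" "\<alpha> \<ge> 0" and E: "E * (p * \<theta> - 1) = 2 + \<alpha>"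
    and ad: "weighted_solution p \<theta> \<alpha> A \<rho> u v" and rA: "\<And>x. A \<le> \<rho> x"
    and om: "is_cutoff 1 \<omega>" and m: "3 \<le> m" "2 * p \<le> real m * (p - 1)"
  shows "\<exists>K>0. \<forall>T>0. (\<integral>x. u (T *\<^sub>R x) powr \<theta> * \<omega> x ^ m \<partial>lborel) \<le> K * T powr (- (E * (\<theta> + 1) + 2)) \<and>
    (\<integral>x. v (T *\<^sub>R x) powr p * \<omega> x ^ m \<partial>lborel) \<le> K * T powr (- (E * (p + 1) + 2))"
proof -
  have m2: "m \<ge> 2" using m by simp
  note d = weighted_solutionD[OF ad] and cp = cutoff_power[OF om m2] and om_nn = is_cutoffD(2)[OF om]
  obtain C where C: "C > 0" "\<And>\<rho> u v. weighted_solution p \<theta> \<alpha> A \<rho> u v \<Longrightarrow>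
    (\<integral>x. \<rho> x * v x powr p * \<omega> x ^ m \<partial>lborel) \<le> C \<and> (\<integral>x. \<rho> x * u x powr \<theta> * \<omega> x ^ m \<partial>lborel) \<le> C"
    using apriori[OF p A om _ m] by auto
  have gen: "(\<integral>x. f (T *\<^sub>R x) powr q * \<omega> x ^ m \<partial>lborel) \<le> C / A * T powr (- b)"
    if T: "T > 0" and le: "(\<integral>x. rescale (- \<alpha>) T \<rho> x * rescale e T f x powr q * \<omega> x ^ m \<partial>lborel) \<le> C"
      and eb: "- \<alpha> + e * q = b" and f: "continuous_on UNIV f" "\<And>x. 0 < f x"
    for f :: "real^'n \<Rightarrow> real" and T q e b
  proof -
    have k: "continuous_on UNIV (\<lambda>x. f (T *\<^sub>R x))" "continuous_on UNIV (\<lambda>x. \<rho> (T *\<^sub>R x))"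
      by (intro continuous_on_compose2[OF f(1)] continuous_on_compose2[OF d(1)] continuous_intros; auto)+
    have kp: "continuous_on UNIV (\<lambda>x. f (T *\<^sub>R x) powr q)" using f(2) by (intro continuous_on_pos_powr k) auto
    have eq: "rescale (- \<alpha>) T \<rho> x * rescale e T f x powr q * \<omega> x ^ m = T powr b * (\<rho> (T *\<^sub>R x) * (f (T *\<^sub>R x) powr q * \<omega> x ^ m))" for x
    proof -
      have "T powr b = T powr (- \<alpha>) * T powr (e * q)" unfolding eb[symmetric] by (rule powr_add)
      then show ?thesis by (simp add: rescale_def powr_mult powr_powr)
    qed
    have c1: "cc (\<lambda>x. f (T *\<^sub>R x) powr q * \<omega> x ^ m)" by (rule cc_mult2[OF cp(2) kp])
    have c2: "cc (\<lambda>x. T powr b * (\<rho> (T *\<^sub>R x) * (f (T *\<^sub>R x) powr q * \<omega> x ^ m)))" by (intro cc_cmult cc_mult2[OF c1 k(2)])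
    have "T powr b * A * (\<integral>x. f (T *\<^sub>R x) powr q * \<omega> x ^ m \<partial>lborel) = (\<integral>x. T powr b * A * (f (T *\<^sub>R x) powr q * \<omega> x ^ m) \<partial>lborel)"
      by simp
    also have "\<dots> \<le> (\<integral>x. T powr b * (\<rho> (T *\<^sub>R x) * (f (T *\<^sub>R x) powr q * \<omega> x ^ m)) \<partial>lborel)"
    proof (rule cc_integral_mono[OF cc_cmult[OF c1] c2])
      fix x
      have "0 \<le> f (T *\<^sub>R x) powr q * \<omega> x ^ m" using om_nn by simp
      then have "A * (f (T *\<^sub>R x) powr q * \<omega> x ^ m) \<le> \<rho> (T *\<^sub>R x) * (f (T *\<^sub>R x) powr q * \<omega> x ^ m)"
        by (intro mult_right_mono rA)
      then have "T powr b * (A * (f (T *\<^sub>R x) powr q * \<omega> x ^ m)) \<le> T powr b * (\<rho> (T *\<^sub>R x) * (f (T *\<^sub>R x) powr q * \<omega> x ^ m))"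
        by (rule mult_left_mono) simp
      then show "T powr b * A * (f (T *\<^sub>R x) powr q * \<omega> x ^ m) \<le> T powr b * (\<rho> (T *\<^sub>R x) * (f (T *\<^sub>R x) powr q * \<omega> x ^ m))"
        by (simp only: mult.assoc)
    qed
    also have "\<dots> \<le> C" using le unfolding eq .
    finally show ?thesis using T A by (simp add: powr_minus field_simps)
  qed
  have "(\<integral>x. u (T *\<^sub>R x) powr \<theta> * \<omega> x ^ m \<partial>lborel) \<le> C / A * T powr (- (E * (\<theta> + 1) + 2)) \<and>
    (\<integral>x. v (T *\<^sub>R x) powr p * \<omega> x ^ m \<partial>lborel) \<le> C / A * T powr (- (E * (p + 1) + 2))" if T: "T > 0" for T
  proof -
    note c = C(2)[OF weighted_solution_rescale[OF ad T A(1) E]]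
    have "- \<alpha> + E * (p + 1) * \<theta> = E * (\<theta> + 1) + 2" "- \<alpha> + E * (\<theta> + 1) * p = E * (p + 1) + 2"
      using E by (simp_all add: algebra_simps)
    then show ?thesis
      using gen[OF T conjunct2[OF c] _ C2_fun_continuous[OF d(3)] d(5)] gen[OF T conjunct1[OF c] _ C2_fun_continuous[OF d(4)] d(6)]
      by blast
  qed
  then show ?thesis using C A by (intro exI[of _ "C / A"]) auto
qed

lemma exists_exponent:
  assumes "1 < p" shows "\<exists>m::nat. 3 \<le> m \<and> 2 * p \<le> real m * (p - 1)"
proof -
  obtain n :: nat where n: "2 * p / (p - 1) \<le> real n" using real_arch_simple by blast
  have "2 * p / (p - 1) \<le> real (max n 3)" using n by simp
  then show ?thesis using assms by (intro exI[of _ "max n 3"]) (simp add: pos_divide_le_eq del: of_nat_max)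
qed

lemma averages_small:
  fixes u v :: "real^'n::finite \<Rightarrow> real"
  assumes p: "1 < p" "p \<le> \<theta>" and A: "A > 0" "\<alpha> \<ge> 0"
    and ad: "weighted_solution p \<theta> \<alpha> A \<rho> u v" and rA: "\<And>x. A \<le> \<rho> x" and e: "e > 0"
  shows "\<exists>t>0. (\<integral>y. u (c + t *\<^sub>R y) * bump y \<partial>lborel) \<le> e" "\<exists>t>0. (\<integral>y. v (c + t *\<^sub>R y) * bump y \<partial>lborel) \<le> e"
proof -
  obtain m :: nat where m: "3 \<le> m" "2 * p \<le> real m * (p - 1)" using exists_exponent[OF p(1)] by blast
  obtain \<omega> :: "real^'n \<Rightarrow> real" where om: "is_cutoff 1 \<omega>" using cutoff_exists[of 1] by auto
  have pt: "p * \<theta> - 1 > 0" using p less_1_mult[of p \<theta>] by simp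
  define E where "E = (2 + \<alpha>) / (p * \<theta> - 1)"
  have E: "E * (p * \<theta> - 1) = 2 + \<alpha>" "E > 0" using pt A by (auto simp: E_def)
  note d = weighted_solutionD[OF ad]
  obtain K where K: "K > 0" "\<And>T. T > 0 \<Longrightarrow> (\<integral>x. u (T *\<^sub>R x) powr \<theta> * \<omega> x ^ m \<partial>lborel) \<le> K * T powr (- (E * (\<theta> + 1) + 2))"
    "\<And>T. T > 0 \<Longrightarrow> (\<integral>x. v (T *\<^sub>R x) powr p * \<omega> x ^ m \<partial>lborel) \<le> K * T powr (- (E * (p + 1) + 2))"
    using decay[OF p A E(1) ad rA om m] by auto
  have m2: "2 \<le> m" using m by simp
  have b: "E * (\<theta> + 1) + 2 > 0" "E * (p + 1) + 2 > 0" using E p by (auto intro!: add_pos_pos mult_pos_pos)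
  show "\<exists>t>0. (\<integral>y. u (c + t *\<^sub>R y) * bump y \<partial>lborel) \<le> e"
    by (rule avg_bump_small[OF C2_fun_continuous[OF d(3)] d(5) _ om m2 b(1) K(1,2) e]) (use p in auto)
  show "\<exists>t>0. (\<integral>y. v (c + t *\<^sub>R y) * bump y \<partial>lborel) \<le> e"
    by (rule avg_bump_small[OF C2_fun_continuous[OF d(4)] d(6) _ om m2 b(2) K(1,3) e]) (use p in auto)
qed

text \<open>The function f = u - l v^\<sigma> lies below u, whose averages are small. Where f > 0,
  concavity of the power (\<sigma> \<le> 1) gives the gradient term the right sign, and \<sigma>
  l^(\<theta>+1) = 1 is chosen so that v^p = l \<sigma> v^(\<sigma>-1) (l v^\<sigma>)^\<theta>,
  which is at most l \<sigma> v^(\<sigma>-1) u^\<theta>.\<close>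

lemma comparison_u:
  fixes u v :: "real^'n::finite \<Rightarrow> real"
  assumes p: "1 < p" "p \<le> \<theta>" and A: "A > 0" "\<alpha> \<ge> 0"
    and ad: "weighted_solution p \<theta> \<alpha> A \<rho> u v" and rA: "\<And>x. A \<le> \<rho> x"
  shows "u x \<le> ((p + 1) / (\<theta> + 1)) powr (- 1 / (\<theta> + 1)) * v x powr ((p + 1) / (\<theta> + 1))"
proof -
  note d = weighted_solutionD[OF ad]
  define \<sigma> where "\<sigma> = (p + 1) / (\<theta> + 1)"
  define l where "l = \<sigma> powr (- 1 / (\<theta> + 1))"
  have s: "0 < \<sigma>" "\<sigma> \<le> 1" "\<sigma> * (\<theta> + 1) = p + 1" using p by (auto simp: \<sigma>_def)
  have "l powr (\<theta> + 1) = \<sigma> powr (- 1)" using p by (simp add: l_def powr_powr)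
  then have l: "l > 0" "\<sigma> * l powr (\<theta> + 1) = 1"
    using s by (auto simp: l_def powr_minus)
  have h1: "((\<lambda>y. y powr \<sigma>) has_real_derivative \<sigma> * y powr (\<sigma> - 1)) (at y)" if "y \<in> {0<..}" for y :: real
    using that by (intro has_real_derivative_powr) simp
  have h2: "((\<lambda>y. \<sigma> * y powr (\<sigma> - 1)) has_real_derivative \<sigma> * ((\<sigma> - 1) * y powr (\<sigma> - 1 - 1))) (at y)" if "y \<in> {0<..}" for y :: real
    using that by (intro DERIV_cmult has_real_derivative_powr) simp
  have h3: "continuous_on {0<..} (\<lambda>y::real. \<sigma> * ((\<sigma> - 1) * y powr (\<sigma> - 1 - 1)))" by (intro continuous_intros) auto
  have vS: "v x \<in> {0<..}" for x using d(6) by simp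
  note C = C2_fun_compose[OF d(4) vS h1 h2 h3]
  define f where "f x = u x + (- l) * v x powr \<sigma>" for x
  have f2: "C2_fun f" unfolding f_def[abs_def] by (intro C2_fun_add(1) C2_fun_cmult(1) d(3) C(1))
  have lf: "laplacian f x = laplacian u x + (- l) * (\<sigma> * ((\<sigma> - 1) * v x powr (\<sigma> - 1 - 1)) * (norm (grad v x))^2 + \<sigma> * v x powr (\<sigma> - 1) * laplacian v x)" for x
  proof -
    have "laplacian f = (\<lambda>x. laplacian u x + laplacian (\<lambda>x. (- l) * v x powr \<sigma>) x)"
      unfolding f_def[abs_def] by (rule C2_fun_add(2)[OF d(3) C2_fun_cmult(1)[OF C(1)]])
    moreover have "laplacian (\<lambda>x. (- l) * v x powr \<sigma>) = (\<lambda>x. (- l) * laplacian (\<lambda>x. v x powr \<sigma>) x)"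
      by (rule C2_fun_cmult(2)[OF C(1)])
    ultimately show ?thesis using C(2) by simp
  qed
  have "f x \<le> 0" for x
  proof (rule subharmonic_pos_part_zero[OF f2 _ C2_fun_continuous[OF d(3)]])
    show "0 \<le> u x" for x using d(5)[of x] by simp
    show "f x \<le> u x" for x using l d(6)[of x] by (simp add: f_def)
    show "\<exists>t>0. (\<integral>y. u (c + t *\<^sub>R y) * bump y \<partial>lborel) \<le> e" if "e > 0" for c e
      by (rule averages_small(1)[OF p A ad rA that])
    fix x assume "0 < f x"
    then have ul: "l * v x powr \<sigma> \<le> u x" by (simp add: f_def)
    have vp: "v x > 0" by (rule d(6))
    have "l powr \<theta> * v x powr (\<sigma> * \<theta>) = (l * v x powr \<sigma>) powr \<theta>" by (simp add: powr_mult powr_powr)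
    also have "\<dots> \<le> u x powr \<theta>" using ul l p by (intro powr_mono2) auto
    finally have ut: "l powr \<theta> * v x powr (\<sigma> * \<theta>) \<le> u x powr \<theta>" .
    have "v x powr p = (\<sigma> * l powr (\<theta> + 1)) * v x powr (\<sigma> - 1 + \<sigma> * \<theta>)"
    proof -
      have "\<sigma> - 1 + \<sigma> * \<theta> = p" using s(3) by (simp add: algebra_simps)
      then show ?thesis using l by simp
    qed
    also have "\<dots> = l * \<sigma> * v x powr (\<sigma> - 1) * (l powr \<theta> * v x powr (\<sigma> * \<theta>))"
      using l(1) by (simp add: powr_add)
    also have "\<dots> \<le> l * \<sigma> * v x powr (\<sigma> - 1) * u x powr \<theta>"
      using ut l s by (intro mult_left_mono) auto
    finally have "v x powr p \<le> l * \<sigma> * v x powr (\<sigma> - 1) * u x powr \<theta>" .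
    then have "\<rho> x * v x powr p \<le> \<rho> x * (l * \<sigma> * v x powr (\<sigma> - 1) * u x powr \<theta>)"
      using weighted_solution_nonneg[OF ad A(1)] by (rule mult_left_mono)
    moreover have "0 \<le> l * (\<sigma> * ((1 - \<sigma>) * v x powr (\<sigma> - 1 - 1)) * (norm (grad v x))^2)"
      using l s by (intro mult_nonneg_nonneg) auto
    ultimately show "0 \<le> laplacian f x" unfolding lf d(7,8) by (simp add: algebra_simps)
  qed
  then show ?thesis unfolding f_def l_def \<sigma>_def by simp
qed

text \<open>Where v > l u, boundedness lowers the exponent: l^\<theta> u^\<theta> \<le> v^\<theta>
  \<le> B^(\<theta>-p) v^p, and l is chosen with l^(\<theta>+1) = B^(\<theta>-p). Hence u^\<theta>
  \<le> l v^p, and v - l u is subharmonic there.\<close>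

lemma comparison_v:
  fixes u v :: "real^'n::finite \<Rightarrow> real"
  assumes p: "1 < p" "p \<le> \<theta>" and A: "A > 0" "\<alpha> \<ge> 0"
    and ad: "weighted_solution p \<theta> \<alpha> A \<rho> u v" and rA: "\<And>x. A \<le> \<rho> x" and B: "\<And>x. v x \<le> B"
  shows "v x \<le> B powr ((\<theta> - p) / (\<theta> + 1)) * u x"
proof -
  note d = weighted_solutionD[OF ad]
  define l where "l = B powr ((\<theta> - p) / (\<theta> + 1))"
  have B0: "B > 0" using B[of 0] d(6)[of 0] by simp
  have l: "l > 0" "l powr (\<theta> + 1) = B powr (\<theta> - p)"
    using B0 p by (auto simp: l_def powr_powr)
  define f where "f x = v x + (- l) * u x" for x
  have f2: "C2_fun f" unfolding f_def[abs_def] by (intro C2_fun_add(1) C2_fun_cmult(1) d(3,4))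
  have lf: "laplacian f x = laplacian v x + (- l) * laplacian u x" for x
    unfolding f_def[abs_def] C2_fun_add(2)[OF d(4) C2_fun_cmult(1)[OF d(3)]] C2_fun_cmult(2)[OF d(3)] ..
  have "f x \<le> 0" for x
  proof (rule subharmonic_pos_part_zero[OF f2 _ C2_fun_continuous[OF d(4)]])
    show "0 \<le> v x" for x using d(6)[of x] by simp
    show "f x \<le> v x" for x using l d(5)[of x] by (simp add: f_def)
    show "\<exists>t>0. (\<integral>y. v (c + t *\<^sub>R y) * bump y \<partial>lborel) \<le> e" if "e > 0" for c e
      by (rule averages_small(2)[OF p A ad rA that])
    fix x assume "0 < f x"
    then have ul: "l * u x \<le> v x" by (simp add: f_def)
    have vp: "v x > 0" by (rule d(6))
    have "l powr \<theta> * u x powr \<theta> = (l * u x) powr \<theta>" by (simp add: powr_mult)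
    also have "\<dots> \<le> v x powr \<theta>" using ul l p d(5)[of x] by (intro powr_mono2) auto
    also have "\<dots> = v x powr (\<theta> - p) * v x powr p" by (simp flip: powr_add)
    also have "\<dots> \<le> B powr (\<theta> - p) * v x powr p" using B vp p by (intro mult_right_mono powr_mono2) auto
    also have "\<dots> = l powr \<theta> * (l * v x powr p)" using l by (simp add: powr_add flip: l(2))
    finally have "u x powr \<theta> \<le> l * v x powr p" using l by simp
    then have "\<rho> x * u x powr \<theta> \<le> \<rho> x * (l * v x powr p)"
      using weighted_solution_nonneg[OF ad A(1)] by (rule mult_left_mono)
    then show "0 \<le> laplacian f x" unfolding lf d(7,8) by (simp add: algebra_simps)
  qed
  then show ?thesis unfolding f_def l_def by simp
qed

subsection \<open>The bootstrap\<close>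

text \<open>Collects what survives rescaling with unchanged constants. The bound \<rho> \<ge> A is
  not among these, so the comparison is derived once for the original solution and carried
  along.\<close>

definition stable_comparable :: "real \<Rightarrow> real \<Rightarrow> real \<Rightarrow> real \<Rightarrow> real \<Rightarrow> (real^'n::finite \<Rightarrow> real) \<Rightarrow> (real^'n \<Rightarrow> real) \<Rightarrow> (real^'n \<Rightarrow> real) \<Rightarrow> bool" where
  "stable_comparable p \<theta> \<alpha> A l \<rho> u v \<longleftrightarrow> weighted_solution p \<theta> \<alpha> A \<rho> u v \<and> stable_weight (linearized_weight p \<theta> \<rho> u v) \<and>
    (\<forall>x. u x \<le> l * v x powr ((p + 1) / (\<theta> + 1)))"

lemma stable_energy_weight:
  fixes p \<theta> l s A \<alpha> :: real
  assumes "1 < p" "p \<le> \<theta>" "l > 0" "A > 0" "quart p \<theta> s < 0" "1/2 < s" "(p + 1) / 4 \<le> s"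
  shows "\<exists>C>0. \<forall>(\<rho>::real^'n::finite \<Rightarrow> real) u v \<eta> \<eta>'. stable_comparable p \<theta> \<alpha> A l \<rho> u v \<longrightarrow> has_grad \<eta> \<eta>' \<longrightarrow> cc \<eta> \<longrightarrow>
    (\<integral>x. \<rho> x * u x powr ((\<theta> - 1) / 2) * v x powr ((p - 1) / 2 + 2 * s) * (\<eta> x)^2 \<partial>lborel)
      \<le> C * (\<integral>x. v x powr (2 * s) * (norm (\<eta>' x))^2 \<partial>lborel)"
  using energy[OF assms, of \<alpha>, where 'n='n] unfolding stable_comparable_def by fast

lemma stable_energy_grad:
  fixes p \<theta> l s A \<alpha> :: real
  assumes "1 < p" "p \<le> \<theta>" "l > 0" "A > 0" "quart p \<theta> s < 0" "1/2 < s" "(p + 1) / 4 \<le> s"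
  shows "\<exists>C>0. \<forall>(\<rho>::real^'n::finite \<Rightarrow> real) u v \<eta> \<eta>'. stable_comparable p \<theta> \<alpha> A l \<rho> u v \<longrightarrow> has_grad \<eta> \<eta>' \<longrightarrow> cc \<eta> \<longrightarrow>
    (\<integral>x. (norm (grad_powr_mult s v \<eta> \<eta>' x))^2 \<partial>lborel) \<le> C * (\<integral>x. v x powr (2 * s) * (norm (\<eta>' x))^2 \<partial>lborel)"
  using energy[OF assms, of \<alpha>, where 'n='n] unfolding stable_comparable_def by fast

lemma cutoff_grad:
  fixes \<omega> :: "real^'n::finite \<Rightarrow> real"
  assumes "is_cutoff r \<omega>"
  shows "has_grad \<omega> (grad \<omega>)" "cc (grad \<omega>)" "norm x < r \<or> 2 * r < norm x \<Longrightarrow> grad \<omega> x = 0"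
    "\<exists>B>0. \<forall>x. (norm (grad \<omega> x))^2 \<le> B"
proof -
  note d = is_cutoffD[OF assms]
  show g: "has_grad \<omega> (grad \<omega>)" by (rule C2_fun_has_grad[OF d(1)])
  show c: "cc (grad \<omega>)" by (rule cc_grad[OF cutoff_cc[OF assms] g])
  show "\<exists>B>0. \<forall>x. (norm (grad \<omega> x))^2 \<le> B"
  proof -
    obtain M where "M > 0" "\<And>x. norm (grad \<omega> x) \<le> M" using cc_bounded[OF c] by auto
    then show ?thesis by (intro exI[of _ "M^2"]) (auto intro!: power_mono)
  qed
  show "grad \<omega> x = 0" if "norm x < r \<or> 2 * r < norm x"
    using that
  proof
    assume x: "norm x < r"
    have o: "open {x::real^'n. norm x < r}" by (intro open_Collect_less continuous_intros)
    show ?thesis using grad_zero_open[OF g o, of x 1] x d(4) by auto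
  next
    assume x: "2 * r < norm x"
    have o: "open {x::real^'n. 2 * r < norm x}" by (intro open_Collect_less continuous_intros)
    show ?thesis using grad_zero_open[OF g o, of x 0] x d(5) by auto
  qed
qed

text \<open>The energy inequality bounds the gradient of v^s \<omega>1, the Sobolev gain raises the
  exponent by the factor 1 + 1/N, and the gradient of \<omega>2 is supported where \<omega>1 = 1.
  \<open>M\<close> scales like v, which keeps the constants free of the solution; r \<le> 1 puts the
  support into the ball of radius 2.\<close>

lemma bootstrap_step:
  fixes \<omega>1 \<omega>2 :: "real^'n::finite \<Rightarrow> real"
  assumes p: "1 < p" "p \<le> \<theta>" and l: "l > 0" and A: "A > 0"
    and s: "quart p \<theta> s < 0" "1/2 < s" "(p + 1) / 4 \<le> s"
    and s': "s \<le> s'" "s' \<le> s * (1 + 1 / real CARD('n))"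
    and om: "is_cutoff r \<omega>1" "is_cutoff (r / 2) \<omega>2" and r: "0 < r" "r \<le> 1"
  shows "\<exists>C>0. \<forall>\<rho> u v M. stable_comparable p \<theta> \<alpha> A l \<rho> u v \<longrightarrow> M > 0 \<longrightarrow>
    (\<integral>x. v x powr (2 * s) * (norm (grad \<omega>1 x))^2 \<partial>lborel) \<le> M powr (2 * s) \<longrightarrow>
    (\<integral>x. v x powr (2 * s') * (norm (grad \<omega>2 x))^2 \<partial>lborel) \<le> C * M powr (2 * s')"
proof -
  define k where "k = 1 + 1 / real CARD('n)"
  have k: "k > 1" "2 + 2 / real CARD('n) = 2 * k" by (simp_all add: k_def)
  obtain Ce where Ce: "Ce > 0" "\<And>(\<rho>::real^'n \<Rightarrow> real) u v \<eta> \<eta>'. stable_comparable p \<theta> \<alpha> A l \<rho> u v \<Longrightarrow> has_grad \<eta> \<eta>' \<Longrightarrow> cc \<eta> \<Longrightarrow>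
    (\<integral>x. (norm (grad_powr_mult s v \<eta> \<eta>' x))^2 \<partial>lborel) \<le> Ce * (\<integral>x. v x powr (2 * s) * (norm (\<eta>' x))^2 \<partial>lborel)"
    using stable_energy_grad[OF p l A s, of \<alpha>, where 'n='n] by blast
  obtain Cs where Cs: "Cs > 0" "\<And>(f::real^'n \<Rightarrow> real) g M. has_grad f g \<Longrightarrow> (\<And>x. 2 < norm x \<Longrightarrow> f x = 0) \<Longrightarrow> M > 0 \<Longrightarrow>
    (\<integral>x. (norm (g x))^2 \<partial>lborel) \<le> M \<Longrightarrow> (\<integral>x. \<bar>f x\<bar> powr (2 * k) \<partial>lborel) \<le> Cs * M powr k"
    using sobolev_gain[where 'n='n] unfolding k(2) k_def[symmetric] by blast
  note d1 = is_cutoffD[OF om(1)] and g1 = cutoff_grad[OF om(1)] and g2 = cutoff_grad[OF om(2)]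
  note cc1 = cutoff_cc[OF om(1)]
  obtain B where B: "B > 0" "\<And>x. (norm (grad \<omega>2 x))^2 \<le> B" using g2(4) by blast
  define V where "V = integral\<^sup>L lborel \<omega>1"
  have V: "V > 0" unfolding V_def by (rule cc_integral_pos[OF cc1 d1(2), of 0]) (use d1(4)[of 0] r in simp)
  define K where "K = B * (V + Cs * Ce powr k)"
  have K: "K > 0" using B V Cs Ce by (auto simp: K_def intro!: mult_pos_pos add_pos_pos)
  have "(\<integral>x. v x powr (2 * s') * (norm (grad \<omega>2 x))^2 \<partial>lborel) \<le> K * M powr (2 * s')"
    if n: "stable_comparable p \<theta> \<alpha> A l \<rho> u v" and M: "M > 0"
      and le: "(\<integral>x. v x powr (2 * s) * (norm (grad \<omega>1 x))^2 \<partial>lborel) \<le> M powr (2 * s)" for \<rho> u v M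
  proof -
    have ad: "weighted_solution p \<theta> \<alpha> A \<rho> u v" using n by (simp add: stable_comparable_def)
    note d = weighted_solutionD[OF ad]
    note pv = continuous_on_pos_powr[OF C2_fun_continuous[OF d(4)] d(6)]
    define f where "f x = v x powr s * \<omega>1 x" for x
    have hf: "has_grad f (grad_powr_mult s v \<omega>1 (grad \<omega>1))"
      unfolding f_def[abs_def] by (rule has_grad_powr_mult[OF d(4,6) g1(1)])
    have f0: "f x \<ge> 0" for x using d1(2) by (simp add: f_def)
    have "(\<integral>x. (norm (grad_powr_mult s v \<omega>1 (grad \<omega>1) x))^2 \<partial>lborel) \<le> Ce * (\<integral>x. v x powr (2 * s) * (norm (grad \<omega>1 x))^2 \<partial>lborel)"
      by (rule Ce(2)[OF n g1(1) cc1])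
    also have "\<dots> \<le> Ce * M powr (2 * s)" using le Ce(1) by (intro mult_left_mono) auto
    finally have gr: "(\<integral>x. (norm (grad_powr_mult s v \<omega>1 (grad \<omega>1) x))^2 \<partial>lborel) \<le> Ce * M powr (2 * s)" .
    have "(\<integral>x. \<bar>f x\<bar> powr (2 * k) \<partial>lborel) \<le> Cs * (Ce * M powr (2 * s)) powr k"
    proof (rule Cs(2)[OF hf _ _ gr])
      show "f x = 0" if "2 < norm x" for x using d1(5)[of x] that r by (simp add: f_def)
      show "0 < Ce * M powr (2 * s)" using Ce M by simp
    qed
    also have "(Ce * M powr (2 * s)) powr k = Ce powr k * M powr (2 * s * k)" by (simp add: powr_mult powr_powr)
    finally have gain: "(\<integral>x. \<bar>f x\<bar> powr (2 * k) \<partial>lborel) \<le> Cs * (Ce powr k * M powr (2 * s * k))" .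
    have c1: "cc (\<lambda>x. v x powr (2 * s') * (norm (grad \<omega>2 x))^2)"
      by (rule cc_mult2[OF cc_norm_power[OF g2(2)] pv]) simp
    have c2: "cc (\<lambda>x. \<bar>f x\<bar> powr (2 * k))"
    proof (rule cc_mono_support[OF cc1])
      show "continuous_on UNIV (\<lambda>x. \<bar>f x\<bar> powr (2 * k))"
        using has_grad_continuous[OF hf] k by (intro continuous_on_powr') (auto intro!: continuous_intros)
      show "\<bar>f x\<bar> powr (2 * k) = 0" if "\<omega>1 x = 0" for x using that by (simp add: f_def)
    qed
    have "(\<integral>x. v x powr (2 * s') * (norm (grad \<omega>2 x))^2 \<partial>lborel)
      \<le> (\<integral>x. B * M powr (2 * s') * \<omega>1 x + B * M powr (2 * s' - 2 * s * k) * \<bar>f x\<bar> powr (2 * k) \<partial>lborel)"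
    proof (rule cc_integral_mono[OF c1])
      show "cc (\<lambda>x. B * M powr (2 * s') * \<omega>1 x + B * M powr (2 * s' - 2 * s * k) * \<bar>f x\<bar> powr (2 * k))"
        by (intro cc_add cc_cmult cc1 c2)
      fix x
      show "v x powr (2 * s') * (norm (grad \<omega>2 x))^2 \<le> B * M powr (2 * s') * \<omega>1 x + B * M powr (2 * s' - 2 * s * k) * \<bar>f x\<bar> powr (2 * k)"
      proof (cases "norm x \<le> r")
        case True
        then have w: "\<omega>1 x = 1" by (rule d1(4))
        \<comment> \<open>Reaches every exponent between s and s k: below M the first term
          dominates, above M the second, and both are homogeneous of degree 2s' in v and M
          together.\<close>
        have "v x powr (2 * s') \<le> M powr (2 * s') + M powr (2 * s' - 2 * s * k) * v x powr (2 * s * k)"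
        proof (cases "v x \<le> M")
          case True
          then have "v x powr (2 * s') \<le> M powr (2 * s')" using d(6)[of x] s s' by (intro powr_mono2) auto
          moreover have "0 \<le> M powr (2 * s' - 2 * s * k) * v x powr (2 * s * k)" by simp
          ultimately show ?thesis by linarith
        next
          case False
          have "v x powr (2 * s') = v x powr (2 * s' - 2 * s * k) * v x powr (2 * s * k)" by (simp flip: powr_add)
          also have "\<dots> \<le> M powr (2 * s' - 2 * s * k) * v x powr (2 * s * k)"
            using False M s' unfolding k_def by (intro mult_right_mono powr_mono2') auto
          finally show ?thesis using powr_ge_zero[of M "2 * s'"] by linarith
        qed
        moreover have "\<bar>f x\<bar> powr (2 * k) = v x powr (2 * s * k)"
          using f0[of x] by (simp add: f_def w powr_powr mult_ac)
        ultimately have "v x powr (2 * s') * (norm (grad \<omega>2 x))^2 \<le> (M powr (2 * s') + M powr (2 * s' - 2 * s * k) * \<bar>f x\<bar> powr (2 * k)) * B"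
          using B by (intro mult_mono) (auto intro!: add_nonneg_nonneg)
        then show ?thesis by (simp add: w algebra_simps)
      next
        case False
        then have "grad \<omega>2 x = 0" using g2(3)[of x] by simp
        then show ?thesis using B d1(2)[of x] by (auto intro!: add_nonneg_nonneg mult_nonneg_nonneg)
      qed
    qed
    also have "\<dots> = B * M powr (2 * s') * V + B * M powr (2 * s' - 2 * s * k) * (\<integral>x. \<bar>f x\<bar> powr (2 * k) \<partial>lborel)"
      unfolding V_def using cc_integrable[OF cc1] cc_integrable[OF c2] by simp
    also have "\<dots> \<le> B * M powr (2 * s') * V + B * M powr (2 * s' - 2 * s * k) * (Cs * (Ce powr k * M powr (2 * s * k)))"
      using gain B by (intro add_left_mono mult_left_mono) auto
    also have "\<dots> = B * M powr (2 * s') * V + B * Cs * Ce powr k * (M powr (2 * s' - 2 * s * k) * M powr (2 * s * k))" by simp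
    also have "M powr (2 * s' - 2 * s * k) * M powr (2 * s * k) = M powr (2 * s')" by (simp flip: powr_add)
    finally show ?thesis by (simp add: K_def algebra_simps)
  qed
  then show ?thesis using K by (intro exI[of _ K]) auto
qed

text \<open>Finitely many steps with ratio k, truncated at s2. Each halves the radius, so the final
  radius and constant do not depend on the solution.\<close>

lemma bootstrap:
  fixes \<omega>1 :: "real^'n::finite \<Rightarrow> real"
  assumes p: "1 < p" "p \<le> \<theta>" and l: "l > 0" and A: "A > 0" and om: "is_cutoff 1 \<omega>1"
    and s1: "1/2 < s1" "(p + 1) / 4 \<le> s1" "s1 \<le> s2" and good: "\<And>s. s1 \<le> s \<Longrightarrow> s \<le> s2 \<Longrightarrow> quart p \<theta> s < 0"
  shows "\<exists>C>0. \<exists>r>0. \<exists>\<omega>. r \<le> 1 \<and> is_cutoff r \<omega> \<and> (\<forall>\<rho> u v M. stable_comparable p \<theta> \<alpha> A l \<rho> u v \<longrightarrow> M > 0 \<longrightarrow>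
    (\<integral>x. v x powr (2 * s1) * (norm (grad \<omega>1 x))^2 \<partial>lborel) \<le> M powr (2 * s1) \<longrightarrow>
    (\<integral>x. v x powr (2 * s2) * (norm (grad \<omega> x))^2 \<partial>lborel) \<le> C * M powr (2 * s2))"
proof -
  define k where "k = 1 + 1 / real CARD('n)"
  have k: "k > 1" by (simp add: k_def)
  define S where "S j = min s2 (s1 * k^j)" for j :: nat
  have S: "s1 \<le> S j" "S j \<le> s2" for j
  proof -
    have "s1 * 1 \<le> s1 * k^j" using k s1 by (intro mult_left_mono one_le_power) auto
    then show "s1 \<le> S j" "S j \<le> s2" using s1 by (auto simp: S_def)
  qed
  have claim: "\<exists>C>0. \<exists>r>0. \<exists>\<omega>. r \<le> 1 \<and> is_cutoff r \<omega> \<and> (\<forall>(\<rho>::real^'n \<Rightarrow> real) u v M. stable_comparable p \<theta> \<alpha> A l \<rho> u v \<longrightarrow> M > 0 \<longrightarrow>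
    (\<integral>x. v x powr (2 * s1) * (norm (grad \<omega>1 x))^2 \<partial>lborel) \<le> M powr (2 * s1) \<longrightarrow>
    (\<integral>x. v x powr (2 * S j) * (norm (grad \<omega> x))^2 \<partial>lborel) \<le> C * M powr (2 * S j))" for j
  proof (induction j)
    case 0
    have "S 0 = s1" using s1 by (simp add: S_def)
    then show ?case using om by (intro exI[of _ "1::real"] conjI exI[of _ \<omega>1]) auto
  next
    case (Suc j)
    then obtain C r \<omega> where C: "C > 0" and r: "r > 0" "r \<le> 1" and w: "is_cutoff r \<omega>"
      and H: "\<And>(\<rho>::real^'n \<Rightarrow> real) u v M. stable_comparable p \<theta> \<alpha> A l \<rho> u v \<Longrightarrow> M > 0 \<Longrightarrow>
        (\<integral>x. v x powr (2 * s1) * (norm (grad \<omega>1 x))^2 \<partial>lborel) \<le> M powr (2 * s1) \<Longrightarrow>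
        (\<integral>x. v x powr (2 * S j) * (norm (grad \<omega> x))^2 \<partial>lborel) \<le> C * M powr (2 * S j)" by blast
    obtain \<omega>2 :: "real^'n \<Rightarrow> real" where w2: "is_cutoff (r / 2) \<omega>2" using cutoff_exists[of "r / 2"] r by auto
    have up: "S j \<le> S (Suc j)" "S (Suc j) \<le> S j * (1 + 1 / real CARD('n))"
    proof -
      have kj: "k^j > 0" "s1 > 0" using k s1 by auto
      have "s1 * k^j * 1 \<le> s1 * k^j * k" using k kj by (intro mult_left_mono) auto
      then show "S j \<le> S (Suc j)" by (auto simp: S_def mult_ac)
      have "s2 \<le> s2 * k" using k s1 by simp
      then show "S (Suc j) \<le> S j * (1 + 1 / real CARD('n))"
        unfolding k_def[symmetric] by (cases "s2 \<le> s1 * k^j") (auto simp: S_def min_le_iff_disj mult_ac)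
    qed
    have sj: "1/2 < S j" "(p + 1) / 4 \<le> S j" using S(1)[of j] s1 by linarith+
    obtain C' where C': "C' > 0" "\<And>(\<rho>::real^'n \<Rightarrow> real) u v M. stable_comparable p \<theta> \<alpha> A l \<rho> u v \<Longrightarrow> M > 0 \<Longrightarrow>
        (\<integral>x. v x powr (2 * S j) * (norm (grad \<omega> x))^2 \<partial>lborel) \<le> M powr (2 * S j) \<Longrightarrow>
        (\<integral>x. v x powr (2 * S (Suc j)) * (norm (grad \<omega>2 x))^2 \<partial>lborel) \<le> C' * M powr (2 * S (Suc j))"
      using bootstrap_step[OF p l A good[OF S] sj up w w2 r] by blast
    \<comment> \<open>Absorbs the constant of the earlier steps into M: C M^(2 S j) = (c M)^(2 S
      j).\<close>
    define c where "c = C powr (1 / (2 * S j))"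
    have c: "c > 0" "c powr (2 * S j) = C" using C sj by (auto simp: c_def powr_powr)
    have "(\<integral>x. v x powr (2 * S (Suc j)) * (norm (grad \<omega>2 x))^2 \<partial>lborel) \<le> C' * c powr (2 * S (Suc j)) * M powr (2 * S (Suc j))"
      if n: "stable_comparable p \<theta> \<alpha> A l \<rho> u v" and M: "M > 0"
        and le: "(\<integral>x. v x powr (2 * s1) * (norm (grad \<omega>1 x))^2 \<partial>lborel) \<le> M powr (2 * s1)" for \<rho> u v :: "real^'n \<Rightarrow> real" and M
      using C'(2)[OF n, of "c * M"] H[OF n M le] c M by (simp add: powr_mult)
    then show ?case using C' c r w2
      by (intro exI[of _ "C' * c powr (2 * S (Suc j))"] conjI exI[of _ "r / 2"] exI[of _ \<omega>2]) auto
  qed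
  obtain j where "s2 / s1 < k^j" using real_arch_pow[OF k] by blast
  then have Sj: "S j = s2" using s1 by (simp add: S_def field_simps)
  show ?thesis using claim[of j] unfolding Sj .
qed

text \<open>Divides the weight out of the a priori bound. The test function \<open>h\<close>
  vanishes for |x| < 1, since A |x|^\<alpha> is known to be at least A for |x| \<ge> 1.\<close>

lemma annulus_bound_powr_p:
  fixes \<omega>1 :: "real^'n::finite \<Rightarrow> real"
  assumes p: "1 < p" "p \<le> \<theta>" and A: "A > 0" "\<alpha> \<ge> 0" and r: "r \<ge> 1" "R \<ge> r"
  shows "\<exists>C>0. \<forall>(\<rho>::real^'n \<Rightarrow> real) u v h. weighted_solution p \<theta> \<alpha> A \<rho> u v \<longrightarrow> cc h \<longrightarrow> (\<forall>x. 0 \<le> h x \<and> h x \<le> 1) \<longrightarrow>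
    (\<forall>x. norm x < 1 \<or> R < norm x \<longrightarrow> h x = 0) \<longrightarrow> (\<integral>x. v x powr p * h x \<partial>lborel) \<le> C"
proof -
  obtain m :: nat where m: "3 \<le> m" "2 * p \<le> real m * (p - 1)" using exists_exponent[OF p(1)] by blast
  obtain \<omega> :: "real^'n \<Rightarrow> real" where om: "is_cutoff R \<omega>" using cutoff_exists[of R] r by auto
  note d' = is_cutoffD[OF om]
  have m2: "2 \<le> m" using m by simp
  obtain C where C: "C > 0" "\<And>\<rho> u v. weighted_solution p \<theta> \<alpha> A \<rho> u v \<Longrightarrow> (\<integral>x. \<rho> x * v x powr p * \<omega> x ^ m \<partial>lborel) \<le> C"
    using apriori[OF p A om _ m] r by auto
  have "(\<integral>x. v x powr p * h x \<partial>lborel) \<le> C / A"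
    if ad: "weighted_solution p \<theta> \<alpha> A \<rho> u v" and h: "cc h" "\<And>x. 0 \<le> h x" "\<And>x. h x \<le> 1" "\<And>x. norm x < 1 \<or> R < norm x \<Longrightarrow> h x = 0"
    for \<rho> u v h :: "real^'n \<Rightarrow> real"
  proof -
    note d = weighted_solutionD[OF ad]
    note pv = continuous_on_pos_powr[OF C2_fun_continuous[OF d(4)] d(6)]
    have "A * (\<integral>x. v x powr p * h x \<partial>lborel) = (\<integral>x. A * (v x powr p * h x) \<partial>lborel)" by simp
    also have "\<dots> \<le> (\<integral>x. \<rho> x * v x powr p * \<omega> x ^ m \<partial>lborel)"
    proof (rule cc_integral_mono)
      show "cc (\<lambda>x. A * (v x powr p * h x))" by (intro cc_cmult cc_mult2[OF h(1)] pv)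
      show "cc (\<lambda>x. \<rho> x * v x powr p * \<omega> x ^ m)"
        by (intro cc_mult2[OF cutoff_power(2)[OF om m2]] continuous_intros d(1) pv)
      fix x
      show "A * (v x powr p * h x) \<le> \<rho> x * v x powr p * \<omega> x ^ m"
      proof (cases "norm x < 1 \<or> R < norm x")
        case True
        then show ?thesis using h(4)[of x] weighted_solution_nonneg[OF ad A(1)] d'(2)[of x] by simp
      next
        case False
        then have "A * 1 \<le> A * norm x powr \<alpha>" using A by (intro mult_left_mono ge_one_powr_ge_zero) auto
        then have rA: "A \<le> \<rho> x" using d(2)[of x] by simp
        have "\<omega> x = 1" using False by (intro d'(4)) auto
        then show ?thesis using mult_mono[OF rA mult_left_mono[OF h(3)[of x], of "v x powr p"]] A h(2)[of x] weighted_solution_nonneg[OF ad A(1), of x] by simp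
      qed
    qed
    also have "\<dots> \<le> C" by (rule C(2)[OF ad])
    finally show ?thesis using A by (simp add: field_simps)
  qed
  note main = this
  show ?thesis
  proof (intro exI[of _ "C / A"] conjI allI impI)
    show "0 < C / A" using C A by simp
  qed (rule main; blast)
qed

text \<open>If y^(\<mu>-2) w^2 \<ge> c/d, the absorbing term wins. Otherwise w^2 is below (c/d)
  y^(-(\<mu>-2)), and its power n - 1 brings y^2 down to y^p for y > 1 by the last hypothesis; for y
  \<le> 1 that follows from p \<le> 2.\<close>

lemma interpolation_young:
  fixes c d p \<mu> :: real
  assumes "0 < c" "0 < d" "p \<le> 2" "2 < \<mu>" "1 \<le> n" "2 - p \<le> (\<mu> - 2) * real (n - 1)"
  shows "\<exists>C>0. \<forall>y>0. \<forall>w. 0 \<le> w \<longrightarrow> w \<le> 1 \<longrightarrow> c * (y powr 2 * w ^ (2 * n - 2)) \<le> d * (y powr \<mu> * w ^ (2 * n)) + C * y powr p"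
proof -
  define C where "C = c + c * (c / d)^(n - 1)"
  have C: "C > 0" using assms by (simp add: C_def add_pos_pos)
  have "c * (y powr 2 * w ^ (2 * n - 2)) \<le> d * (y powr \<mu> * w ^ (2 * n)) + C * y powr p"
    if y: "y > 0" and w: "0 \<le> w" "w \<le> 1" for y w
  proof (cases "c / d \<le> y powr (\<mu> - 2) * w^2")
    case True
    then have "c \<le> d * (y powr (\<mu> - 2) * w^2)" using assms by (simp add: field_simps)
    then have "c * (y powr 2 * w ^ (2 * n - 2)) \<le> d * (y powr (\<mu> - 2) * w^2) * (y powr 2 * w ^ (2 * n - 2))"
      using w by (intro mult_right_mono) auto
    also have "\<dots> = d * ((y powr (\<mu> - 2) * y powr 2) * (w^2 * w ^ (2 * n - 2)))" by (simp only: mult_ac)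
    also have "y powr (\<mu> - 2) * y powr 2 = y powr \<mu>" by (simp flip: powr_add)
    also have "w^2 * w ^ (2 * n - 2) = w ^ (2 * n)"
    proof -
      have "2 + (2 * n - 2) = 2 * n" using assms by simp
      then show ?thesis by (simp only: power_add[symmetric])
    qed
    finally have "c * (y powr 2 * w ^ (2 * n - 2)) \<le> d * (y powr \<mu> * w ^ (2 * n))" .
    moreover have "0 \<le> C * y powr p" using C by simp
    ultimately show ?thesis by linarith
  next
    case False
    have nn: "0 \<le> d * (y powr \<mu> * w ^ (2 * n))" using assms w by simp
    have "y powr 2 * w ^ (2 * n - 2) \<le> (1 + (c / d)^(n - 1)) * y powr p"
    proof (cases "y \<le> 1")
      case True
      have "y powr 2 * w ^ (2 * n - 2) \<le> y powr p * 1"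
        using True y w assms by (intro mult_mono powr_mono' power_le_one) auto
      also have "\<dots> \<le> (1 + (c / d)^(n - 1)) * y powr p" using assms by (simp add: algebra_simps)
      finally show ?thesis .
    next
      case y1: False
      have "w^2 * y powr (\<mu> - 2) \<le> c / d" using False by (simp only: not_le mult.commute less_imp_le)
      then have "w^2 \<le> c / d / y powr (\<mu> - 2)" using y by (subst pos_le_divide_eq) auto
      then have "w^2 \<le> c / d * y powr (- (\<mu> - 2))" unfolding powr_minus_divide by simp
      then have "(w^2)^(n - 1) \<le> (c / d * y powr (- (\<mu> - 2)))^(n - 1)" by (intro power_mono) auto
      also have "\<dots> = (c / d)^(n - 1) * (y powr (- (\<mu> - 2)))^(n - 1)" by (rule power_mult_distrib)
      also have "(y powr (- (\<mu> - 2)))^(n - 1) = (y powr (- (\<mu> - 2))) powr real (n - 1)"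
        using y by (subst powr_realpow) auto
      also have "\<dots> = y powr (- ((\<mu> - 2) * real (n - 1)))" unfolding powr_powr by (simp only: mult_minus_left)
      finally have "w ^ (2 * n - 2) \<le> (c / d)^(n - 1) * y powr (- ((\<mu> - 2) * real (n - 1)))"
        by (simp add: power_mult[symmetric] right_diff_distrib')
      then have "y powr 2 * w ^ (2 * n - 2) \<le> y powr 2 * ((c / d)^(n - 1) * y powr (- ((\<mu> - 2) * real (n - 1))))"
        by (intro mult_left_mono) auto
      also have "\<dots> = (c / d)^(n - 1) * (y powr 2 * y powr (- ((\<mu> - 2) * real (n - 1))))" by (simp only: mult_ac)
      also have "y powr 2 * y powr (- ((\<mu> - 2) * real (n - 1))) = y powr (2 - (\<mu> - 2) * real (n - 1))" by (simp flip: powr_add)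
      also have "(c / d)^(n - 1) * y powr (2 - (\<mu> - 2) * real (n - 1)) \<le> (c / d)^(n - 1) * y powr p"
        using y1 assms by (intro mult_left_mono powr_mono) auto
      also have "\<dots> \<le> (1 + (c / d)^(n - 1)) * y powr p" by (simp add: algebra_simps)
      finally show ?thesis .
    qed
    then have "c * (y powr 2 * w ^ (2 * n - 2)) \<le> c * ((1 + (c / d)^(n - 1)) * y powr p)"
      using assms by (intro mult_left_mono) auto
    also have "\<dots> = C * y powr p" by (simp add: C_def algebra_simps)
    finally show ?thesis using nn by linarith
  qed
  then show ?thesis using C by blast
qed

text \<open>For p < 2 the a priori bound on v^p does not reach v^2. The energy inequality at s = 1
  with v \<le> K u controls v^\<mu> for \<mu> = 2 + (p-1)/2 + (\<theta>-1)/2 at the price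
  K^((\<theta>-1)/2), and v^2 is interpolated between v^p and v^\<mu>. The exponent of K is
  (\<theta>-1)/2 times (2-p)/(\<mu>-2).\<close>

lemma annulus_bound_square:
  fixes \<omega>1 :: "real^'n::finite \<Rightarrow> real"
  assumes p: "1 < p" "p < 2" "p \<le> \<theta>" and l: "l > 0" and A: "A > 0" "\<alpha> \<ge> 0" and om: "is_cutoff 1 \<omega>1"
  shows "\<exists>C>0. \<forall>\<rho> u v K. stable_comparable p \<theta> \<alpha> A l \<rho> u v \<longrightarrow> K > 0 \<longrightarrow> (\<forall>x. v x \<le> K * u x) \<longrightarrow>
    (\<integral>x. v x powr 2 * (norm (grad \<omega>1 x))^2 \<partial>lborel) \<le> C * K powr ((\<theta> - 1) * (2 - p) / (\<theta> + p - 2))"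
proof -
  define e where "e = (\<theta> - 1) * (2 - p) / (\<theta> + p - 2)"
  define \<mu> where "\<mu> = (p - 1) / 2 + 2 + (\<theta> - 1) / 2"
  have mu: "\<mu> > 2" proof -
    have "0 < (p - 1) / 2" "0 < (\<theta> - 1) / 2" using p by simp_all
    then show ?thesis unfolding \<mu>_def by linarith
  qed
  obtain n0 :: nat where n0: "(2 - p) / (\<mu> - 2) \<le> real n0" using real_arch_simple by blast
  define n where "n = n0 + 2"
  have n: "1 \<le> n" "2 \<le> n" "2 - p \<le> (\<mu> - 2) * real (n - 1)"
  proof -
    have "2 - p \<le> real n0 * (\<mu> - 2)" using n0 mu by (simp add: pos_divide_le_eq)
    also have "\<dots> \<le> (\<mu> - 2) * real (n - 1)" using mu by (simp add: n_def algebra_simps)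
    finally show "2 - p \<le> (\<mu> - 2) * real (n - 1)" .
  qed (auto simp: n_def)
  obtain m :: nat where m: "3 \<le> m" "2 * p \<le> real m * (p - 1)" using exists_exponent[OF p(1)] by blast
  have m2: "2 \<le> m" using m by simp
  obtain \<omega>2 \<omega>4 :: "real^'n \<Rightarrow> real" where w2: "is_cutoff 2 \<omega>2" and w4: "is_cutoff 4 \<omega>4"
    using cutoff_exists[of 2] cutoff_exists[of 4] by (metis zero_less_numeral)
  note d2 = is_cutoffD[OF w2] and d4 = is_cutoffD[OF w4] and g1 = cutoff_grad[OF om] and cp4 = cutoff_power[OF w4 m2]
  note cp2 = cutoff_power[OF w2 n(2)]
  \<comment> \<open>Equal to 1 on the annulus 1 \<le> |x| \<le> 2 that carries the gradient of
    \<omega>1, with its own gradient in 2 \<le> |x| \<le> 4, where \<omega>4 = 1; the power n makes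
    the cutoff error absorbable.\<close>
  define \<eta> where "\<eta> x = \<omega>2 x ^ n" for x
  have he: "has_grad \<eta> (grad \<eta>)" "cc \<eta>"
    using C2_fun_has_grad[OF cp2(1)] cp2(2) by (simp_all add: \<eta>_def[abs_def])
  obtain G where G: "G > 0" "\<And>x. (norm (grad \<eta> x))^2 \<le> G * \<omega>2 x ^ (2 * n - 2)"
    using cp2(4) unfolding \<eta>_def[abs_def] by blast
  have gout: "grad \<eta> x = 0" if "norm x < 2 \<or> 4 < norm x" for x
    using cp2(3)[of x] that unfolding \<eta>_def[abs_def] by simp
  obtain B where B: "B > 0" "\<And>x. (norm (grad \<omega>1 x))^2 \<le> B" using g1(4) by blast
  obtain Ca where Ca: "Ca > 0" "\<And>\<rho> u v. weighted_solution p \<theta> \<alpha> A \<rho> u v \<Longrightarrow> (\<integral>x. \<rho> x * v x powr p * \<omega>4 x ^ m \<partial>lborel) \<le> Ca"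
    using apriori[OF p(1,3) A w4 _ m] by auto
  have s1: "quart p \<theta> 1 < 0" "1/2 < (1::real)" "(p + 1) / 4 \<le> 1" using quart_one[OF p(1,3)] p by auto
  obtain Ce where Ce: "Ce > 0" "\<And>(\<rho>::real^'n \<Rightarrow> real) u v \<eta> \<eta>'. stable_comparable p \<theta> \<alpha> A l \<rho> u v \<Longrightarrow> has_grad \<eta> \<eta>' \<Longrightarrow> cc \<eta> \<Longrightarrow>
    (\<integral>x. \<rho> x * u x powr ((\<theta> - 1) / 2) * v x powr ((p - 1) / 2 + 2 * 1) * (\<eta> x)^2 \<partial>lborel)
      \<le> Ce * (\<integral>x. v x powr (2 * 1) * (norm (\<eta>' x))^2 \<partial>lborel)"
    using stable_energy_weight[OF p(1,3) l A(1) s1, of \<alpha>, where 'n='n] by blast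
  have p2: "p \<le> 2" using p by simp
  obtain C1 where C1: "C1 > 0" "\<And>y w. y > 0 \<Longrightarrow> 0 \<le> w \<Longrightarrow> w \<le> 1 \<Longrightarrow> Ce * G * (y powr 2 * w ^ (2 * n - 2)) \<le> A / 2 * (y powr \<mu> * w ^ (2 * n)) + C1 * y powr p"
    using interpolation_young[of "Ce * G" "A / 2" p \<mu> n] Ce G A p2 mu n by auto
  obtain C2 where C2: "C2 > 0" "\<And>y w. y > 0 \<Longrightarrow> 0 \<le> w \<Longrightarrow> w \<le> 1 \<Longrightarrow> B * (y powr 2 * w ^ (2 * n - 2)) \<le> A * (y powr \<mu> * w ^ (2 * n)) + C2 * y powr p"
    using interpolation_young[of B A p \<mu> n] B A p2 mu n by auto
  define C where "C = 2 * (C1 * Ca / A) + C2 * Ca / A"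
  have C: "C > 0" using C1 C2 Ca A by (simp add: C_def add_pos_pos)
  have "(\<integral>x. v x powr 2 * (norm (grad \<omega>1 x))^2 \<partial>lborel) \<le> C * K powr e"
    if nc: "stable_comparable p \<theta> \<alpha> A l \<rho> u v" and K: "K > 0" and vK: "\<And>x. v x \<le> K * u x" for \<rho> u v K
  proof -
    have ad: "weighted_solution p \<theta> \<alpha> A \<rho> u v" using nc by (simp add: stable_comparable_def)
    note d = weighted_solutionD[OF ad]
    note pv = continuous_on_pos_powr[OF C2_fun_continuous[OF d(4)] d(6)] and pu = continuous_on_pos_powr[OF C2_fun_continuous[OF d(3)] d(5)]
    note rho0 = weighted_solution_nonneg[OF ad A(1)]
    define F where "F x = \<rho> x * u x powr ((\<theta> - 1) / 2) * v x powr ((p - 1) / 2 + 2) * (\<eta> x)^2" for x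
    define Q where "Q x = \<rho> x * v x powr p * \<omega>4 x ^ m" for x
    have h2: "cc (\<lambda>x. (\<eta> x)^2)" using cc_norm_power[OF he(2), of 2] by simp
    have cF: "cc F" unfolding F_def[abs_def] by (intro cc_mult2[OF h2] continuous_intros d(1) pu pv)
    have cQ: "cc Q" unfolding Q_def[abs_def] by (intro cc_mult2[OF cp4(2)] continuous_intros d(1) pv)
    have F0: "0 \<le> F x" and Q0: "0 \<le> Q x" for x using rho0 d4(2) by (auto simp: F_def Q_def)
    define \<beta> where "\<beta> = K powr ((\<theta> - 1) / 2)"
    \<comment> \<open>The unit of v in which the factor K^((\<theta>-1)/2) disappears: M^(\<mu>-2)
      equals it, and then M^(2-p) = K^e.\<close>
    define M where "M = \<beta> powr (1 / (\<mu> - 2))"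
    have be: "\<beta> > 0" using K by (simp add: \<beta>_def)
    have M: "M > 0" using be by (simp add: M_def)
    have Mmu: "M powr (\<mu> - 2) = \<beta>" using be mu by (simp add: M_def powr_powr)
    have Me: "M powr (2 - p) = K powr e"
    proof -
      have "(\<theta> - 1) / 2 * (1 / (\<mu> - 2)) * (2 - p) = e"
      proof -
        have m2: "\<mu> - 2 = (\<theta> + p - 2) / 2" by (simp add: \<mu>_def field_simps)
        have gen: "a / 2 * (1 / (z / 2)) * b = a * b / z" for a b z :: real by simp
        show ?thesis unfolding m2 e_def by (rule gen)
      qed
      then show ?thesis by (simp add: M_def \<beta>_def powr_powr)
    qed
    \<comment> \<open>Applied twice: with t = 1/2 to absorb the cutoff term into the energy, and
      with t = 1 to bound v^2 on the inner annulus.\<close>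
    have pw: "c * v x powr 2 * \<omega>2 x ^ (2 * n - 2) \<le> t * F x + C' * K powr e / A * Q x"
      if x: "1 \<le> norm x" "norm x \<le> 4" and t: "t > 0" and C': "C' > 0" and cy: "\<And>y w. y > 0 \<Longrightarrow> 0 \<le> w \<Longrightarrow> w \<le> 1 \<Longrightarrow> c * (y powr 2 * w ^ (2 * n - 2)) \<le> A * t * (y powr \<mu> * w ^ (2 * n)) + C' * y powr p"
      for x c t C'
    proof -
      define y where "y = v x / M"
      have y: "y > 0" "v x = M * y" using d(6)[of x] M by (auto simp: y_def)
      define w where "w = \<omega>2 x"
      have "A * 1 \<le> A * norm x powr \<alpha>" using A x by (intro mult_left_mono ge_one_powr_ge_zero) auto
      then have rA: "A \<le> \<rho> x" using d(2)[of x] by simp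
      have "M powr 2 * (c * (y powr 2 * w ^ (2 * n - 2))) \<le> M powr 2 * (A * t * (y powr \<mu> * w ^ (2 * n)) + C' * y powr p)"
        using d2(2,3) y by (intro mult_left_mono cy) (auto simp: w_def)
      then have "c * v x powr 2 * w ^ (2 * n - 2) \<le> t * (A * (M powr 2 * y powr \<mu> * w ^ (2 * n))) + C' * (M powr 2 * y powr p)"
        using M y by (simp add: powr_mult algebra_simps)
      also have "M powr 2 * y powr p = K powr e * v x powr p"
      proof -
        have "M powr 2 = M powr (2 - p) * M powr p" by (simp flip: powr_add)
        then show ?thesis using M y by (simp add: Me powr_mult)
      qed
      also have "C' * (K powr e * v x powr p) \<le> C' * K powr e / A * Q x"
      proof -
        have "\<omega>4 x = 1" using x by (intro d4(4)) auto
        moreover have "A * v x powr p \<le> \<rho> x * v x powr p" using rA by (intro mult_right_mono) auto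
        ultimately have "v x powr p \<le> Q x / A" using A by (simp add: Q_def field_simps)
        then have "C' * K powr e * v x powr p \<le> C' * K powr e * (Q x / A)" using C' by (intro mult_left_mono) auto
        then show ?thesis by (simp add: mult.assoc)
      qed
      also have "t * (A * (M powr 2 * y powr \<mu> * w ^ (2 * n))) \<le> t * F x"
      proof (rule mult_left_mono)
        have "M powr \<mu> = M powr 2 * \<beta>"
          unfolding Mmu[symmetric] by (simp flip: powr_add)
        then have e1: "M powr 2 * y powr \<mu> = v x powr \<mu> / \<beta>" using M y be by (simp add: powr_mult)
        have "v x powr ((\<theta> - 1) / 2) \<le> (K * u x) powr ((\<theta> - 1) / 2)"
          using vK[of x] d(6)[of x] p by (intro powr_mono2) auto
        also have "\<dots> = \<beta> * u x powr ((\<theta> - 1) / 2)" using K by (simp add: \<beta>_def powr_mult)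
        finally have e2: "v x powr ((\<theta> - 1) / 2) \<le> \<beta> * u x powr ((\<theta> - 1) / 2)" .
        have "v x powr \<mu> = v x powr ((p - 1) / 2 + 2) * v x powr ((\<theta> - 1) / 2)" unfolding \<mu>_def by (rule powr_add)
        also have "\<dots> \<le> v x powr ((p - 1) / 2 + 2) * (\<beta> * u x powr ((\<theta> - 1) / 2))" using e2 by (intro mult_left_mono) auto
        finally have "v x powr \<mu> / \<beta> \<le> u x powr ((\<theta> - 1) / 2) * v x powr ((p - 1) / 2 + 2)" using be by (simp add: field_simps)
        then have "A * (v x powr \<mu> / \<beta>) \<le> \<rho> x * (u x powr ((\<theta> - 1) / 2) * v x powr ((p - 1) / 2 + 2))"
          using rA A rho0[of x] be by (intro mult_mono) auto
        then have "A * (v x powr \<mu> / \<beta>) * w ^ (2 * n) \<le> \<rho> x * (u x powr ((\<theta> - 1) / 2) * v x powr ((p - 1) / 2 + 2)) * w ^ (2 * n)"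
          using d2(2) by (intro mult_right_mono) (auto simp: w_def)
        moreover have "w ^ (2 * n) = (\<eta> x)^2" by (simp add: w_def \<eta>_def power_mult[symmetric] mult.commute)
        ultimately show "A * (M powr 2 * y powr \<mu> * w ^ (2 * n)) \<le> F x" unfolding e1 by (simp add: F_def mult_ac)
      qed (use t in simp)
      finally show ?thesis by (simp add: w_def)
    qed
    define iF where "iF = integral\<^sup>L lborel F"
    have iQ: "integral\<^sup>L lborel Q \<le> Ca" unfolding Q_def[abs_def] by (rule Ca(2)[OF ad])
    have "iF \<le> Ce * (\<integral>x. v x powr 2 * (norm (grad \<eta> x))^2 \<partial>lborel)"
      using Ce(2)[OF nc he] unfolding iF_def F_def[abs_def] by simp
    also have "\<dots> = (\<integral>x. Ce * (v x powr 2 * (norm (grad \<eta> x))^2) \<partial>lborel)" by simp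
    also have "\<dots> \<le> (\<integral>x. 1/2 * F x + C1 * K powr e / A * Q x \<partial>lborel)"
    proof (rule cc_integral_mono)
      show "cc (\<lambda>x. Ce * (v x powr 2 * (norm (grad \<eta> x))^2))"
        by (intro cc_cmult cc_mult2 cc_norm_power[OF cc_grad[OF he(2,1)]] pv) simp
      show "cc (\<lambda>x. 1/2 * F x + C1 * K powr e / A * Q x)" by (intro cc_add cc_cmult cF cQ)
      fix x
      show "Ce * (v x powr 2 * (norm (grad \<eta> x))^2) \<le> 1/2 * F x + C1 * K powr e / A * Q x"
      proof (cases "norm x < 2 \<or> 4 < norm x")
        case True
        then show ?thesis using gout[OF True] F0[of x] Q0[of x] C1(1) A by simp
      next
        case False
        have "Ce * (v x powr 2 * (norm (grad \<eta> x))^2) \<le> Ce * (v x powr 2 * (G * \<omega>2 x ^ (2 * n - 2)))"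
          using Ce(1) G(2) by (intro mult_left_mono) auto
        also have "\<dots> = Ce * G * v x powr 2 * \<omega>2 x ^ (2 * n - 2)" by simp
        also have "\<dots> \<le> 1/2 * F x + C1 * K powr e / A * Q x"
          by (rule pw) (use False C1 in auto)
        finally show ?thesis .
      qed
    qed
    also have "\<dots> = 1/2 * iF + C1 * K powr e / A * integral\<^sup>L lborel Q"
      unfolding iF_def using cc_integrable[OF cF] cc_integrable[OF cQ] by simp
    also have "\<dots> \<le> 1/2 * iF + C1 * K powr e / A * Ca"
      using iQ C1 A by (intro add_left_mono mult_left_mono) auto
    also have "C1 * K powr e / A * Ca = (C1 * Ca / A) * K powr e" by simp
    finally have iFle: "iF \<le> 2 * (C1 * Ca / A) * K powr e" by linarith
    have "(\<integral>x. v x powr 2 * (norm (grad \<omega>1 x))^2 \<partial>lborel) \<le> (\<integral>x. 1 * F x + C2 * K powr e / A * Q x \<partial>lborel)"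
    proof (rule cc_integral_mono)
      show "cc (\<lambda>x. v x powr 2 * (norm (grad \<omega>1 x))^2)"
        by (intro cc_mult2 cc_norm_power[OF g1(2)] pv) simp
      show "cc (\<lambda>x. 1 * F x + C2 * K powr e / A * Q x)" by (intro cc_add cc_cmult cF cQ)
      fix x
      show "v x powr 2 * (norm (grad \<omega>1 x))^2 \<le> 1 * F x + C2 * K powr e / A * Q x"
      proof (cases "norm x < 1 \<or> 2 < norm x")
        case True
        then have "grad \<omega>1 x = 0" using g1(3)[of x] by simp
        then show ?thesis using F0[of x] Q0[of x] C2(1) A by simp
      next
        case False
        have w: "\<omega>2 x = 1" using False by (intro d2(4)) auto
        have "v x powr 2 * (norm (grad \<omega>1 x))^2 \<le> v x powr 2 * B"
          using B(2) by (intro mult_left_mono) auto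
        also have "\<dots> = B * v x powr 2 * \<omega>2 x ^ (2 * n - 2)" by (simp add: w)
        also have "\<dots> \<le> 1 * F x + C2 * K powr e / A * Q x"
          by (rule pw) (use False C2 in auto)
        finally show ?thesis .
      qed
    qed
    also have "\<dots> = iF + C2 * K powr e / A * integral\<^sup>L lborel Q"
      unfolding iF_def using cc_integrable[OF cF] cc_integrable[OF cQ] by simp
    also have "\<dots> \<le> 2 * (C1 * Ca / A) * K powr e + C2 * K powr e / A * Ca"
      using iQ C2 A iFle by (intro add_mono mult_left_mono) auto
    also have "\<dots> = C * K powr e" by (simp add: C_def algebra_simps)
    finally show ?thesis .
  qed
  note main = this
  show ?thesis unfolding e_def[symmetric]
  proof (intro exI[of _ C] conjI allI impI)
    show "0 < C" by (rule C)
  qed (rule main; blast)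
qed

lemma stable_comparable_rescale:
  assumes n: "stable_comparable p \<theta> \<alpha> A l \<rho> u v" and R: "R > 0" and A: "A > 0" and p: "1 < p" "p \<le> \<theta>"
    and E: "E * (p * \<theta> - 1) = 2 + \<alpha>"
  shows "stable_comparable p \<theta> \<alpha> A l (rescale (- \<alpha>) R \<rho>) (rescale (E * (p + 1)) R u) (rescale (E * (\<theta> + 1)) R v)"
proof -
  have ad: "weighted_solution p \<theta> \<alpha> A \<rho> u v" and W: "stable_weight (linearized_weight p \<theta> \<rho> u v)"
    and c: "\<And>x. u x \<le> l * v x powr ((p + 1) / (\<theta> + 1))" using n by (auto simp: stable_comparable_def)
  have "rescale (E * (p + 1)) R u x \<le> l * rescale (E * (\<theta> + 1)) R v x powr ((p + 1) / (\<theta> + 1))" for x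
  proof -
    \<comment> \<open>The scaling exponents of u and v are in the ratio of the comparison, so
      \<open>l\<close> is unchanged.\<close>
    have "E * (\<theta> + 1) * ((p + 1) / (\<theta> + 1)) = E * (p + 1)" using p by simp
    then have "rescale (E * (\<theta> + 1)) R v x powr ((p + 1) / (\<theta> + 1)) = R powr (E * (p + 1)) * v (R *\<^sub>R x) powr ((p + 1) / (\<theta> + 1))"
      unfolding rescale_def by (simp only: powr_mult powr_powr)
    moreover have "R powr (E * (p + 1)) * u (R *\<^sub>R x) \<le> R powr (E * (p + 1)) * (l * v (R *\<^sub>R x) powr ((p + 1) / (\<theta> + 1)))"
      by (intro mult_left_mono c) simp
    ultimately show ?thesis unfolding rescale_def[of _ _ u] by (simp add: mult_ac)
  qed
  moreover have "stable_weight (linearized_weight p \<theta> (rescale (- \<alpha>) R \<rho>) (rescale (E * (p + 1)) R u) (rescale (E * (\<theta> + 1)) R v))"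
    unfolding linearized_weight_rescale[OF R E] by (rule stable_weight_rescale[OF W R])
  ultimately show ?thesis
    unfolding stable_comparable_def using weighted_solution_rescale[OF ad R A E] by blast
qed

section \<open>From growth in the scale to a bound on the dimension\<close>

lemma powr_le_imp_exponent_le:
  fixes a b C :: real
  assumes "\<And>R. R \<ge> 2 \<Longrightarrow> R powr a \<le> C * R powr b" "C > 0" shows "a \<le> b"
proof (rule ccontr)
  assume ab: "\<not> a \<le> b"
  define R where "R = max 2 ((C + 1) powr (1 / (a - b)))"
  have R: "R \<ge> 2" by (simp add: R_def)
  have "C + 1 = ((C + 1) powr (1 / (a - b))) powr (a - b)" using ab assms(2) by (simp add: powr_powr)
  also have "\<dots> \<le> R powr (a - b)" using ab by (intro powr_mono2) (auto simp: R_def)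
  also have "\<dots> = R powr a / R powr b" using R by (simp add: powr_diff)
  also have "\<dots> \<le> C" using assms(1)[OF R] R by (simp add: pos_divide_le_eq)
  finally show False by simp
qed

text \<open>A unit-scale bound for all rescaled solutions becomes, after undoing the rescaling, the growth of a power of
  \<open>R\<close> that a nontrivial solution cannot satisfy in low dimension.\<close>

lemma dimension_bound:
  fixes \<rho> u v \<omega>1 :: "real^'n::finite \<Rightarrow> real"
  assumes p: "1 < p" "p \<le> \<theta>" and l: "l > 0" and A: "A > 0" and E: "E * (p * \<theta> - 1) = 2 + \<alpha>"
    and om: "is_cutoff 1 \<omega>1" and s1: "1/2 < s1" "(p + 1) / 4 \<le> s1" "s1 \<le> s2"
    and good: "\<And>s. s1 \<le> s \<Longrightarrow> s \<le> s2 \<Longrightarrow> quart p \<theta> s < 0"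
    and n: "stable_comparable p \<theta> \<alpha> A l \<rho> u v" and c: "c > 0"
    and start: "\<And>R. R \<ge> 2 \<Longrightarrow> (\<integral>x. rescale (E * (\<theta> + 1)) R v x powr (2 * s1) * (norm (grad \<omega>1 x))^2 \<partial>lborel) \<le> (c * R powr \<tau>) powr (2 * s1)"
  shows "2 + 2 * s2 * (E * (\<theta> + 1) - \<tau>) \<le> real CARD('n)"
proof -
  have ad: "weighted_solution p \<theta> \<alpha> A \<rho> u v" using n by (simp add: stable_comparable_def)
  note d = weighted_solutionD[OF ad]
  note pv = continuous_on_pos_powr[OF C2_fun_continuous[OF d(4)] d(6)] and pu = continuous_on_pos_powr[OF C2_fun_continuous[OF d(3)] d(5)]
  note rho0 = weighted_solution_nonneg[OF ad A]
  obtain C r \<omega> where C: "C > 0" and r: "r > 0" "r \<le> 1" and w: "is_cutoff r \<omega>"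
    and H: "\<And>(\<rho>::real^'n \<Rightarrow> real) u v M. stable_comparable p \<theta> \<alpha> A l \<rho> u v \<Longrightarrow> M > 0 \<Longrightarrow>
      (\<integral>x. v x powr (2 * s1) * (norm (grad \<omega>1 x))^2 \<partial>lborel) \<le> M powr (2 * s1) \<Longrightarrow>
      (\<integral>x. v x powr (2 * s2) * (norm (grad \<omega> x))^2 \<partial>lborel) \<le> C * M powr (2 * s2)"
    using bootstrap[OF p l A om s1 good] by blast
  have s2: "quart p \<theta> s2 < 0" "1/2 < s2" "(p + 1) / 4 \<le> s2" using good[of s2] s1 by auto
  obtain Ce where Ce: "Ce > 0" "\<And>(\<rho>::real^'n \<Rightarrow> real) u v \<eta> \<eta>'. stable_comparable p \<theta> \<alpha> A l \<rho> u v \<Longrightarrow> has_grad \<eta> \<eta>' \<Longrightarrow> cc \<eta> \<Longrightarrow>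
    (\<integral>x. \<rho> x * u x powr ((\<theta> - 1) / 2) * v x powr ((p - 1) / 2 + 2 * s2) * (\<eta> x)^2 \<partial>lborel)
      \<le> Ce * (\<integral>x. v x powr (2 * s2) * (norm (\<eta>' x))^2 \<partial>lborel)"
    using stable_energy_weight[OF p l A s2, of \<alpha>, where 'n='n] by blast
  note dw = is_cutoffD[OF w] and gw = cutoff_grad[OF w] and ccw = cutoff_cc[OF w]
  have ccw2: "cc (\<lambda>x. (\<omega> x)^2)" using cc_norm_power[OF ccw, of 2] by simp
  define F where "F x = \<rho> x * u x powr ((\<theta> - 1) / 2) * v x powr ((p - 1) / 2 + 2 * s2)" for x
  have cF: "continuous_on UNIV F" unfolding F_def[abs_def] by (intro continuous_intros d(1) pu pv)
  have F0: "0 \<le> F x" for x using rho0 by (simp add: F_def)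
  define c0 where "c0 = (\<integral>x. F x * (\<omega> x)^2 \<partial>lborel)"
  have c0: "c0 > 0"
  proof -
    \<comment> \<open>The lower bound for \<rho> is 0 at the origin, so positivity is checked at a
      point of norm r, where \<omega> is still 1.\<close>
    define a :: "real^'n" where "a = r *\<^sub>R axis undefined 1"
    have na: "norm a = r" using r by (simp add: a_def norm_axis_1)
    have "0 < A * norm a powr \<alpha>" using A na r by simp
    then have "0 < \<rho> a" using d(2)[of a] by linarith
    then have "0 < F a * (\<omega> a)^2" using dw(4)[of a] na d(5,6)[of a] by (simp add: F_def)
    then show ?thesis unfolding c0_def
      using F0 by (intro cc_integral_pos[of _ a] cc_mult2[OF ccw2 cF]) auto
  qed
  have key: "R powr (2 - real CARD('n) + 2 * s2 * (E * (\<theta> + 1))) \<le> Ce * C * c powr (2 * s2) / c0 * R powr (2 * s2 * \<tau>)" if R: "R \<ge> 2" for R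
  proof -
    have R0: "R > 0" using R by simp
    note ns = stable_comparable_rescale[OF n R0 A p E]
    have M: "c * R powr \<tau> > 0" using c R0 by simp
    have up: "(\<integral>x. rescale (- \<alpha>) R \<rho> x * rescale (E * (p + 1)) R u x powr ((\<theta> - 1) / 2) * rescale (E * (\<theta> + 1)) R v x powr ((p - 1) / 2 + 2 * s2) * (\<omega> x)^2 \<partial>lborel)
      \<le> Ce * (C * (c * R powr \<tau>) powr (2 * s2))"
      using order_trans[OF Ce(2)[OF ns gw(1) ccw] mult_left_mono[OF H[OF ns M start[OF R]]]] Ce(1) by simp
    have ex: "- \<alpha> + E * (p + 1) * ((\<theta> - 1) / 2) + E * (\<theta> + 1) * ((p - 1) / 2 + 2 * s2) = 2 + 2 * s2 * (E * (\<theta> + 1))"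
      using E by (simp add: field_simps)
    have "rescale (- \<alpha>) R \<rho> x * rescale (E * (p + 1)) R u x powr ((\<theta> - 1) / 2) * rescale (E * (\<theta> + 1)) R v x powr ((p - 1) / 2 + 2 * s2)
      = R powr (2 + 2 * s2 * (E * (\<theta> + 1))) * F (R *\<^sub>R x)" for x
      unfolding ex[symmetric] powr_add[of R] rescale_def F_def powr_mult powr_powr by (simp only: mult_ac)
    then have up': "R powr (2 + 2 * s2 * (E * (\<theta> + 1))) * (\<integral>x. F (R *\<^sub>R x) * (\<omega> x)^2 \<partial>lborel) \<le> Ce * (C * (c * R powr \<tau>) powr (2 * s2))"
      using up by (simp add: mult.assoc)
    have cw': "cc (\<lambda>x. (\<omega> ((1 / R) *\<^sub>R x))^2)" using cc_affine[OF ccw2, of "1 / R" 0] R0 by simp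
    have c1: "cc (\<lambda>x. F x * (\<omega> ((1 / R) *\<^sub>R x))^2)" by (rule cc_mult2[OF cw' cF])
    \<comment> \<open>Since R \<ge> 2, the dilated cutoff equals 1 wherever \<omega> is nonzero, so
      the fixed energy \<open>c0\<close> stays below the energy at scale R.\<close>
    have "c0 \<le> (\<integral>x. F x * (\<omega> ((1 / R) *\<^sub>R x))^2 \<partial>lborel)"
      unfolding c0_def
    proof (rule cc_integral_mono[OF cc_mult2[OF ccw2 cF] c1])
      fix x
      have "(\<omega> x)^2 \<le> (\<omega> ((1 / R) *\<^sub>R x))^2"
      proof (cases "2 * r \<le> norm x")
        case True then show ?thesis using dw(5)[OF True] by simp
      next
        case False
        have "norm ((1 / R) *\<^sub>R x) = norm x / R" using R0 by simp
        also have "\<dots> \<le> 2 * r / 2" using False R r by (intro frac_le) auto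
        finally have "\<omega> ((1 / R) *\<^sub>R x) = 1" by (intro dw(4)) simp
        then show ?thesis using dw(2,3)[of x] by (simp add: power_le_one)
      qed
      then show "F x * (\<omega> x)^2 \<le> F x * (\<omega> ((1 / R) *\<^sub>R x))^2" using F0 by (intro mult_left_mono) auto
    qed
    also have "\<dots> = R ^ CARD('n) * (\<integral>x. F (R *\<^sub>R x) * (\<omega> x)^2 \<partial>lborel)"
      using cc_integral_affine[OF R0 c1, of 0] R0 by (simp add: field_simps)
    finally have low: "c0 \<le> R powr real CARD('n) * (\<integral>x. F (R *\<^sub>R x) * (\<omega> x)^2 \<partial>lborel)"
      using R0 by (simp add: powr_realpow)
    define X where "X = (\<integral>x. F (R *\<^sub>R x) * (\<omega> x)^2 \<partial>lborel)"
    define T where "T = R powr (2 + 2 * s2 * (E * (\<theta> + 1)))"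
    define N where "N = R powr real CARD('n)"
    have e: "R powr (2 - real CARD('n) + 2 * s2 * (E * (\<theta> + 1))) = T / N"
      unfolding T_def N_def powr_diff[symmetric] by (simp add: algebra_simps)
    have "R powr (2 - real CARD('n) + 2 * s2 * (E * (\<theta> + 1))) * c0 = T / N * c0" by (simp only: e)
    also have "\<dots> \<le> T / N * (N * X)" using low by (intro mult_left_mono) (auto simp: X_def N_def T_def)
    also have "T / N * (N * X) = T * X" using R0 by (simp add: N_def)
    also have "\<dots> \<le> Ce * (C * (c * R powr \<tau>) powr (2 * s2))" using up' by (simp add: T_def X_def)
    also have "\<dots> = Ce * C * c powr (2 * s2) * R powr (2 * s2 * \<tau>)" using c by (simp add: powr_mult powr_powr mult_ac)
    finally have "R powr (2 - real CARD('n) + 2 * s2 * (E * (\<theta> + 1))) \<le> Ce * C * c powr (2 * s2) * R powr (2 * s2 * \<tau>) / c0"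
      by (subst pos_le_divide_eq[OF c0])
    then show ?thesis by simp
  qed
  have "2 - real CARD('n) + 2 * s2 * (E * (\<theta> + 1)) \<le> 2 * s2 * \<tau>"
    by (rule powr_le_imp_exponent_le[OF key]) (use Ce C c c0 in \<open>auto intro!: divide_pos_pos mult_pos_pos\<close>)
  then show ?thesis by (simp add: algebra_simps)
qed

subsection \<open>Nonexistence\<close>

text \<open>The target lies halfway between the largest root and the larger of y and the point
  belonging to s1. Stopping strictly below the root keeps the quartic negative on the whole closed
  interval from s1 to s2.\<close>

lemma exponent_below_x0:
  assumes p: "1 < p" "p \<le> \<theta>" and s1: "1/2 < s1" "quart p \<theta> s1 < 0" and y: "y < x0 p \<theta>"
  obtains s2 where "s1 \<le> s2" "y < 2 * (\<theta> + 1) * s2 / (p * \<theta> - 1)"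
    "\<And>s. s1 \<le> s \<Longrightarrow> s \<le> s2 \<Longrightarrow> quart p \<theta> s < 0"
proof -
  define D where "D = p * \<theta> - 1"
  have D: "D > 0" using p less_1_mult[of p \<theta>] by (simp add: D_def)
  define x1 where "x1 = 2 * (\<theta> + 1) * s1 / D"
  have "poly (H_poly p \<theta>) x1 < 0"
    unfolding x1_def D_def H_poly_quart[OF p] using quart_factor_pos[OF p] s1(2) by (rule mult_pos_neg)
  then have x1: "x1 < x0 p \<theta>" by (rule x0_greater[OF p])
  define x' where "x' = (x0 p \<theta> + max x1 y) / 2"
  have x': "x1 < x'" "y < x'" "x' < x0 p \<theta>" using x1 y by (auto simp: x'_def max_def)
  define s2 where "s2 = x' * D / (2 * (\<theta> + 1))"
  have xs: "2 * (\<theta> + 1) * s2 / D = x'" using D p by (simp add: s2_def)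
  have mono: "s \<le> t" if "2 * (\<theta> + 1) * s / D \<le> 2 * (\<theta> + 1) * t / D" for s t
    using that D p by (simp add: divide_le_cancel)
  have mono': "2 * (\<theta> + 1) * s / D \<le> 2 * (\<theta> + 1) * t / D" if "s \<le> t" for s t
    using that D p by (simp add: divide_le_cancel)
  show ?thesis
  proof (rule that[of s2])
    have "2 * (\<theta> + 1) * s1 / D \<le> 2 * (\<theta> + 1) * s2 / D" unfolding xs x1_def[symmetric] using x' by linarith
    then show "s1 \<le> s2" by (rule mono)
    show "y < 2 * (\<theta> + 1) * s2 / (p * \<theta> - 1)" using x'(2) xs by (simp add: D_def)
    fix s assume s: "s1 \<le> s" "s \<le> s2"
    have "2 * (\<theta> + 1) * s / D < x0 p \<theta>" using mono'[OF s(2)] x'(3) unfolding xs by linarith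
    then show "quart p \<theta> s < 0" using quart_neg_below_x0[OF p s1 s(1)] by (simp add: D_def)
  qed
qed

text \<open>The hypothesis on \<rho> is used in two forms: the bound A |x|^\<alpha>, which rescales,
  and the bound A, on which the comparison of the components rests.\<close>

lemma stable_solution_comparable:
  fixes \<rho> u v :: "real^'n::finite \<Rightarrow> real"
  assumes A: "A > 0" "\<alpha> \<ge> 0" and c: "continuous_on UNIV \<rho>"
    and rho: "\<forall>x. \<rho> x \<ge> A * (1 + (norm x)^2) powr (\<alpha> / 2)"
    and p: "1 < p" "p \<le> \<theta>" and st: "stable_classical_solution \<rho> p \<theta> u v"
  shows "weighted_solution p \<theta> \<alpha> A \<rho> u v" "A \<le> \<rho> x"
    "stable_comparable p \<theta> \<alpha> A (((p + 1) / (\<theta> + 1)) powr (- 1 / (\<theta> + 1))) \<rho> u v"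
proof -
  have low: "A * norm x powr \<alpha> \<le> \<rho> x" for x
  proof -
    have "norm x powr \<alpha> = ((norm x)^2) powr (\<alpha> / 2)"
      by (cases "x = 0") (auto simp: powr_powr simp flip: powr_numeral)
    also have "\<dots> \<le> (1 + (norm x)^2) powr (\<alpha> / 2)" using A by (intro powr_mono2) auto
    finally have "A * norm x powr \<alpha> \<le> A * (1 + (norm x)^2) powr (\<alpha> / 2)" using A by simp
    then show ?thesis using rho order_trans by blast
  qed
  show rA: "A \<le> \<rho> x" for x
  proof -
    have "A * 1 \<le> A * (1 + (norm x)^2) powr (\<alpha> / 2)" using A by (intro mult_left_mono ge_one_powr_ge_zero) auto
    then show ?thesis using rho order_trans by fastforce
  qed
  show ad: "weighted_solution p \<theta> \<alpha> A \<rho> u v"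
    using c low st by (simp add: weighted_solution_def stable_classical_solution_def)
  show "stable_comparable p \<theta> \<alpha> A (((p + 1) / (\<theta> + 1)) powr (- 1 / (\<theta> + 1))) \<rho> u v"
    unfolding stable_comparable_def
    using ad stable_weight_linearized[OF ad A(1) p st] comparison_u[OF p A ad rA] by blast
qed

text \<open>The start s1 = p/2 makes 2 s1 = p, so the a priori bound on the annulus serves at every
  scale with one constant, and \<tau> = 0.\<close>

lemma no_stable_solution:
  fixes \<rho> u v :: "real^'n::finite \<Rightarrow> real"
  assumes A: "A > 0" "\<alpha> \<ge> 0" and c: "continuous_on UNIV \<rho>"
    and rho: "\<forall>x. \<rho> x \<ge> A * (1 + (norm x)^2) powr (\<alpha> / 2)"
    and p: "4/3 < p" "p \<le> \<theta>" and N: "real CARD('n) < 2 + (2 + \<alpha>) * x0 p \<theta>"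
  shows "\<not> stable_classical_solution \<rho> p \<theta> u v"
proof
  assume st: "stable_classical_solution \<rho> p \<theta> u v"
  have p1: "1 < p" using p by simp
  note S = stable_solution_comparable[OF A c rho p1 p(2) st]
  define D where "D = p * \<theta> - 1"
  have D: "D > 0" using p1 p(2) less_1_mult[of p \<theta>] by (simp add: D_def)
  define E where "E = (2 + \<alpha>) / D"
  have E: "E * (p * \<theta> - 1) = 2 + \<alpha>" using D by (simp add: E_def D_def)
  have half: "1/2 < p / 2" "(p + 1) / 4 \<le> p / 2" using p1 by auto
  have "(real CARD('n) - 2) / (2 + \<alpha>) < x0 p \<theta>" using N A by (simp add: pos_divide_less_eq algebra_simps)
  then obtain s2 where s2: "p / 2 \<le> s2" "(real CARD('n) - 2) / (2 + \<alpha>) < 2 * (\<theta> + 1) * s2 / (p * \<theta> - 1)"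
    "\<And>s. p / 2 \<le> s \<Longrightarrow> s \<le> s2 \<Longrightarrow> quart p \<theta> s < 0"
    using exponent_below_x0[OF p1 p(2) half(1) quart_half_p[OF p]] by blast
  obtain \<omega> :: "real^'n \<Rightarrow> real" where om: "is_cutoff 1 \<omega>" using cutoff_exists[of 1] by auto
  note g = cutoff_grad[OF om]
  obtain B where B: "B > 0" "\<And>x. (norm (grad \<omega> x))^2 \<le> B" using g(4) by blast
  have r12: "(1::real) \<le> 1" "(1::real) \<le> 2" by auto
  obtain C where C: "C > 0" "\<And>(\<rho>::real^'n \<Rightarrow> real) u v h. weighted_solution p \<theta> \<alpha> A \<rho> u v \<Longrightarrow> cc h \<Longrightarrow> (\<And>x. 0 \<le> h x \<and> h x \<le> 1) \<Longrightarrow>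
    (\<And>x. norm x < 1 \<or> 2 < norm x \<Longrightarrow> h x = 0) \<Longrightarrow> (\<integral>x. v x powr p * h x \<partial>lborel) \<le> C"
    using annulus_bound_powr_p[OF p1 p(2) A r12] by blast
  define k where "k = (B * C) powr (1 / p)"
  have k: "k > 0" "k powr p = B * C" using B C p1 by (auto simp: k_def powr_powr)
  define l where "l = ((p + 1) / (\<theta> + 1)) powr (- 1 / (\<theta> + 1))"
  have l: "l > 0" using p by (simp add: l_def)
  have start: "(\<integral>x. rescale (E * (\<theta> + 1)) R v x powr (2 * (p / 2)) * (norm (grad \<omega> x))^2 \<partial>lborel) \<le> (k * R powr 0) powr (2 * (p / 2))"
    if R: "R \<ge> 2" for R
  proof -
    have R0: "R > 0" using R by simp
    \<comment> \<open>Divided by \<open>B\<close>, the squared gradient is an admissible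
      \<open>h\<close> with values in [0, 1].\<close>
    have h: "cc (\<lambda>x. (1 / B) * (norm (grad \<omega> x))^2)" by (intro cc_cmult cc_norm_power[OF g(2)]) simp
    have h1: "0 \<le> (1 / B) * (norm (grad \<omega> x))^2 \<and> (1 / B) * (norm (grad \<omega> x))^2 \<le> 1" for x
      using B by (simp add: field_simps)
    have h2: "(1 / B) * (norm (grad \<omega> x))^2 = 0" if "norm x < 1 \<or> 2 < norm x" for x
      using g(3)[of x] that by simp
    have "(\<integral>x. rescale (E * (\<theta> + 1)) R v x powr p * ((1 / B) * (norm (grad \<omega> x))^2) \<partial>lborel) \<le> C"
      by (rule C(2)[OF weighted_solution_rescale[OF S(1) R0 A(1) E] h h1 h2])
    then have "(\<integral>x. rescale (E * (\<theta> + 1)) R v x powr p * (norm (grad \<omega> x))^2 \<partial>lborel) / B \<le> C" by simp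
    then have "(\<integral>x. rescale (E * (\<theta> + 1)) R v x powr p * (norm (grad \<omega> x))^2 \<partial>lborel) \<le> B * C"
      using B by (simp add: field_simps)
    then show ?thesis using k R0 by simp
  qed
  have "2 + 2 * s2 * (E * (\<theta> + 1) - 0) \<le> real CARD('n)"
    by (rule dimension_bound[OF p1 p(2) l A(1) E om half s2(1,3) S(3)[folded l_def] k(1) start])
  also have "2 * s2 * (E * (\<theta> + 1) - 0) = (2 + \<alpha>) * (2 * (\<theta> + 1) * s2 / (p * \<theta> - 1))"
    by (simp add: E_def D_def)
  finally have "(2 + \<alpha>) * (2 * (\<theta> + 1) * s2 / (p * \<theta> - 1)) \<le> real CARD('n) - 2" by simp
  moreover have "real CARD('n) - 2 < (2 + \<alpha>) * (2 * (\<theta> + 1) * s2 / (p * \<theta> - 1))"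
    using s2(2) A by (subst (asm) pos_divide_less_eq) (auto simp: mult.commute)
  ultimately show False by linarith
qed

text \<open>The left side is the fraction of the scaling exponent E(\<theta> + 1) that remains after
  the loss \<tau>; the right side is the bracket of the theorem.\<close>

lemma bracket_identity:
  fixes p \<theta> :: real
  assumes "1 < p" "p \<le> \<theta>"
  shows "1 - (\<theta> - p) * ((\<theta> - 1) * (2 - p) / (\<theta> + p - 2)) / (2 * (\<theta> + 1))
    = p / 2 + (2 - p) * (p * \<theta> - 1) / ((\<theta> + p - 2) * (\<theta> + 1))"
proof -
  define z where "z = \<theta> + p - 2"
  define w where "w = \<theta> + 1"
  have zw: "z \<noteq> 0" "w \<noteq> 0" using assms by (auto simp: z_def w_def)
  have "(1 - (\<theta> - p) * ((\<theta> - 1) * (2 - p) / z) / (2 * w)) * (2 * z * w) = 2 * z * w - (\<theta> - p) * (\<theta> - 1) * (2 - p)"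
    using zw by (simp add: field_simps)
  also have "\<dots> = p * z * w + 2 * (2 - p) * (p * \<theta> - 1)" unfolding z_def w_def by algebra
  also have "\<dots> = (p / 2 + (2 - p) * (p * \<theta> - 1) / (z * w)) * (2 * z * w)" using zw by (simp add: field_simps)
  finally show ?thesis using zw unfolding z_def w_def by simp
qed

text \<open>Boundedness gives v \<le> C0 u. Since v scales with E(\<theta> + 1) and u with E(p + 1),
  the constant becomes C0 R^(E(\<theta> - p)) at scale R, and \<open>annulus_bound_square\<close>
  costs its power e. Half of the resulting exponent is \<tau>, as 2 s1 = 2.\<close>

lemma no_bounded_stable_solution:
  fixes \<rho> u v :: "real^'n::finite \<Rightarrow> real"
  assumes A: "A > 0" "\<alpha> \<ge> 0" and c: "continuous_on UNIV \<rho>"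
    and rho: "\<forall>x. \<rho> x \<ge> A * (1 + (norm x)^2) powr (\<alpha> / 2)"
    and p: "1 < p" "p \<le> 4/3" "p \<le> \<theta>"
    and N: "real CARD('n) < 2 + (p / 2 + (2 - p) * (p * \<theta> - 1) / ((\<theta> + p - 2) * (\<theta> + 1))) * (\<alpha> + 2) * x0 p \<theta>"
    and bd: "bounded_pair u v"
  shows "\<not> stable_classical_solution \<rho> p \<theta> u v"
proof
  assume st: "stable_classical_solution \<rho> p \<theta> u v"
  note S = stable_solution_comparable[OF A c rho p(1,3) st]
  note d = weighted_solutionD[OF S(1)]
  define D where "D = p * \<theta> - 1"
  have D: "D > 0" using p less_1_mult[of p \<theta>] by (simp add: D_def)
  define E where "E = (2 + \<alpha>) / D"
  have E: "E * (p * \<theta> - 1) = 2 + \<alpha>" using D by (simp add: E_def D_def)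
  define e where "e = (\<theta> - 1) * (2 - p) / (\<theta> + p - 2)"
  define br where "br = p / 2 + (2 - p) * (p * \<theta> - 1) / ((\<theta> + p - 2) * (\<theta> + 1))"
  have br: "br > 0" unfolding br_def using p D by (intro add_pos_nonneg divide_nonneg_nonneg mult_nonneg_nonneg) (auto simp: D_def)
  have s1: "1/2 < (1::real)" "(p + 1) / 4 \<le> 1" using p by auto
  have ba: "0 < br * (\<alpha> + 2)" using br A by simp
  have "(real CARD('n) - 2) / (br * (\<alpha> + 2)) < x0 p \<theta>"
    using N ba unfolding br_def[symmetric] by (simp add: pos_divide_less_eq algebra_simps)
  then obtain s2 where s2: "1 \<le> s2" "(real CARD('n) - 2) / (br * (\<alpha> + 2)) < 2 * (\<theta> + 1) * s2 / (p * \<theta> - 1)"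
    "\<And>s. 1 \<le> s \<Longrightarrow> s \<le> s2 \<Longrightarrow> quart p \<theta> s < 0"
    using exponent_below_x0[OF p(1,3) s1(1) quart_one[OF p(1,3)]] by blast
  obtain \<omega> :: "real^'n \<Rightarrow> real" where om: "is_cutoff 1 \<omega>" using cutoff_exists[of 1] by auto
  define l where "l = ((p + 1) / (\<theta> + 1)) powr (- 1 / (\<theta> + 1))"
  have l: "l > 0" using p by (simp add: l_def)
  have n: "stable_comparable p \<theta> \<alpha> A l \<rho> u v" using S(3) by (simp add: l_def)
  obtain b where b: "\<And>x. v x \<le> b"
    using bd unfolding bounded_pair_def bounded_iff by (metis abs_le_D1 rangeI real_norm_def)
  define C0 where "C0 = b powr ((\<theta> - p) / (\<theta> + 1))"
  have b0: "b > 0" using b[of 0] d(6)[of 0] by simp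
  have C0: "C0 > 0" "\<And>x. v x \<le> C0 * u x"
    using comparison_v[OF p(1,3) A S(1,2) b] b0 by (auto simp: C0_def)
  have p2: "p < 2" using p by simp
  obtain C where C: "C > 0" "\<And>(\<rho>::real^'n \<Rightarrow> real) u v K. stable_comparable p \<theta> \<alpha> A l \<rho> u v \<Longrightarrow> K > 0 \<Longrightarrow> (\<And>x. v x \<le> K * u x) \<Longrightarrow>
    (\<integral>x. v x powr 2 * (norm (grad \<omega> x))^2 \<partial>lborel) \<le> C * K powr e"
    using annulus_bound_square[OF p(1) p2 p(3) l A om] unfolding e_def[symmetric] by blast
  define \<tau> where "\<tau> = E * (\<theta> - p) * e / 2"
  define k where "k = (C * C0 powr e) powr (1 / 2)"
  have k: "k > 0" "k powr 2 = C * C0 powr e" using C C0 by (auto simp: k_def powr_powr)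
  have start: "(\<integral>x. rescale (E * (\<theta> + 1)) R v x powr (2 * 1) * (norm (grad \<omega> x))^2 \<partial>lborel) \<le> (k * R powr \<tau>) powr (2 * 1)"
    if R: "R \<ge> 2" for R
  proof -
    have R0: "R > 0" using R by simp
    define K where "K = C0 * R powr (E * (\<theta> - p))"
    have K: "K > 0" using C0 R0 by (simp add: K_def)
    have le: "rescale (E * (\<theta> + 1)) R v x \<le> K * rescale (E * (p + 1)) R u x" for x
    proof -
      have "E * (\<theta> + 1) = E * (\<theta> - p) + E * (p + 1)" by (simp add: algebra_simps)
      then have "R powr (E * (\<theta> + 1)) = R powr (E * (\<theta> - p)) * R powr (E * (p + 1))" by (simp only: powr_add)
      moreover have "R powr (E * (\<theta> + 1)) * v (R *\<^sub>R x) \<le> R powr (E * (\<theta> + 1)) * (C0 * u (R *\<^sub>R x))"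
        by (intro mult_left_mono C0) simp
      ultimately show ?thesis by (simp add: rescale_def K_def mult_ac)
    qed
    have "(\<integral>x. rescale (E * (\<theta> + 1)) R v x powr 2 * (norm (grad \<omega> x))^2 \<partial>lborel) \<le> C * K powr e"
      by (rule C(2)[OF stable_comparable_rescale[OF n R0 A(1) p(1,3) E] K le])
    also have "C * K powr e = (k * R powr \<tau>) powr 2"
    proof -
      have "K powr e = C0 powr e * R powr (E * (\<theta> - p) * e)" unfolding K_def powr_mult powr_powr ..
      moreover have "(k * R powr \<tau>) powr 2 = k powr 2 * R powr (\<tau> * 2)" unfolding powr_mult powr_powr ..
      moreover have "\<tau> * 2 = E * (\<theta> - p) * e" by (simp add: \<tau>_def)
      ultimately show ?thesis by (simp only: k(2) mult.assoc)
    qed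
    finally show ?thesis by simp
  qed
  have "2 + 2 * s2 * (E * (\<theta> + 1) - \<tau>) \<le> real CARD('n)"
    by (rule dimension_bound[OF p(1,3) l A(1) E om s1 s2(1,3) n k(1) start])
  also have "2 * s2 * (E * (\<theta> + 1) - \<tau>) = br * (\<alpha> + 2) * (2 * (\<theta> + 1) * s2 / (p * \<theta> - 1))"
  proof -
    have w: "\<theta> + 1 \<noteq> 0" using p by simp
    have "a * t * (b / (2 * t)) = a * b / 2" if "t \<noteq> 0" for a b t :: real using that by simp
    from this[OF w, of E "(\<theta> - p) * e"]
    have "\<tau> = E * (\<theta> + 1) * ((\<theta> - p) * e / (2 * (\<theta> + 1)))" by (simp only: \<tau>_def mult.assoc)
    then have "E * (\<theta> + 1) - \<tau> = E * (\<theta> + 1) * (1 - (\<theta> - p) * e / (2 * (\<theta> + 1)))"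
      by (simp only: right_diff_distrib mult_1_right)
    also have "\<dots> = E * (\<theta> + 1) * br" unfolding e_def br_def bracket_identity[OF p(1,3)] ..
    finally have "E * (\<theta> + 1) - \<tau> = (2 + \<alpha>) / (p * \<theta> - 1) * (\<theta> + 1) * br" by (simp only: E_def D_def)
    moreover have "2 * s2 * (a / z * t * br) = br * a * (2 * t * s2 / z)" for a t z :: real by simp
    ultimately show ?thesis by (simp only: add.commute[of 2 \<alpha>])
  qed
  finally have "br * (\<alpha> + 2) * (2 * (\<theta> + 1) * s2 / (p * \<theta> - 1)) \<le> real CARD('n) - 2" by simp
  moreover have "real CARD('n) - 2 < br * (\<alpha> + 2) * (2 * (\<theta> + 1) * s2 / (p * \<theta> - 1))"
    using s2(2) ba by (subst (asm) pos_divide_less_eq) (auto simp: mult.commute)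
  ultimately show False by linarith
qed

theorem theorem1p1:
  fixes \<rho> :: "real^'n::finite \<Rightarrow> real" and \<alpha> A :: real
  assumes "\<alpha> \<ge> 0" and "A > 0"
    and "radial \<rho>" and "continuous_on UNIV \<rho>"
    and "\<forall>x. \<rho> x \<ge> A * (1 + (norm x)^2) powr (\<alpha> / 2)"
  shows "(\<forall>p \<theta>. 4/3 < p \<and> p \<le> \<theta> \<and> real CARD('n) < 2 + (2 + \<alpha>) * x0 p \<theta> \<longrightarrow>
            \<not> (\<exists>u v. stable_classical_solution \<rho> p \<theta> u v)) \<and>
         (real CARD('n) \<le> 10 + 4 * \<alpha> \<longrightarrow>
            (\<forall>p \<theta>. 4/3 < p \<and> p \<le> \<theta> \<longrightarrow>
              \<not> (\<exists>u v. stable_classical_solution \<rho> p \<theta> u v))) \<and>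
         (\<forall>p \<theta>. 1 < p \<and> p \<le> min (4/3) \<theta> \<and>
            real CARD('n) < 2 + (p / 2 + (2 - p) * (p * \<theta> - 1) / ((\<theta> + p - 2) * (\<theta> + 1)))
                                * (\<alpha> + 2) * x0 p \<theta> \<longrightarrow>
            \<not> (\<exists>u v. bounded_pair u v \<and> stable_classical_solution \<rho> p \<theta> u v)) \<and>
         (real CARD('n) \<le> 6 + 2 * \<alpha> \<longrightarrow>
            (\<forall>p \<theta>. 1 < p \<and> p \<le> \<theta> \<longrightarrow>
              \<not> (\<exists>u v. bounded_pair u v \<and> stable_classical_solution \<rho> p \<theta> u v)))"
proof -
  note hyp = assms(2,1,4,5)
  have part1: "\<not> (\<exists>u v. stable_classical_solution \<rho> p \<theta> u v)"
    if "4/3 < p" "p \<le> \<theta>" "real CARD('n) < 2 + (2 + \<alpha>) * x0 p \<theta>" for p \<theta>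
    using no_stable_solution[OF hyp that] by blast
  have part2: "\<not> (\<exists>u v. stable_classical_solution \<rho> p \<theta> u v)"
    if N: "real CARD('n) \<le> 10 + 4 * \<alpha>" and p: "4/3 < p" "p \<le> \<theta>" for p \<theta>
  proof -
    \<comment> \<open>2 + 4(2 + \<alpha>) = 10 + 4\<alpha>; the strict inequality for the root
      covers the case of equality.\<close>
    have "(2 + \<alpha>) * 4 < (2 + \<alpha>) * x0 p \<theta>" using x0_greater_4[OF p] assms(1) by (intro mult_strict_left_mono) auto
    then show ?thesis using N by (intro part1[OF p]) simp
  qed
  have part3: "\<not> (\<exists>u v. bounded_pair u v \<and> stable_classical_solution \<rho> p \<theta> u v)"
    if "1 < p" "p \<le> 4/3" "p \<le> \<theta>" "real CARD('n) < 2 + (p / 2 + (2 - p) * (p * \<theta> - 1) / ((\<theta> + p - 2) * (\<theta> + 1)))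
                                * (\<alpha> + 2) * x0 p \<theta>" for p \<theta>
    using no_bounded_stable_solution[OF hyp that] by blast
  have part4: "\<not> (\<exists>u v. bounded_pair u v \<and> stable_classical_solution \<rho> p \<theta> u v)"
    if N: "real CARD('n) \<le> 6 + 2 * \<alpha>" and p: "1 < p" "p \<le> \<theta>" for p \<theta>
  proof (cases "p \<le> 4/3")
    case True
    define br where "br = p / 2 + (2 - p) * (p * \<theta> - 1) / ((\<theta> + p - 2) * (\<theta> + 1))"
    \<comment> \<open>2 + 2(\<alpha> + 2) = 6 + 2\<alpha>, and the product of bracket and root
      exceeds 2.\<close>
    have "(\<alpha> + 2) * 2 < (\<alpha> + 2) * (br * x0 p \<theta>)"
      using bracket_x0[OF p(1) True p(2)] assms(1) unfolding br_def by (intro mult_strict_left_mono) auto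
    then have "real CARD('n) < 2 + br * (\<alpha> + 2) * x0 p \<theta>" using N by (simp add: mult_ac)
    then show ?thesis using part3[OF p(1) True p(2)] unfolding br_def by blast
  next
    \<comment> \<open>Above 4/3 the result for arbitrary solutions applies, as 6 + 2\<alpha> \<le>
      10 + 4\<alpha>.\<close>
    case False
    then show ?thesis using part2[OF _ _ p(2)] N assms(1) by auto
  qed
  show ?thesis
    using part1 part2 part3 part4 by auto
qed

end
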